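(* Let $n\geq 1$ be an integer. Let $H_n(t;x,y)$ be the heat kernel associated with the Fubini-Study Laplacian $\Delta_{\mathbb{P}^n(\mathbb{H})}$ on the quaternionic projective space $\mathbb{P}^n(\mathbb{H})$. Write $H_n(t;d)=H_n(t;x,y)$ with $d=d(x,y)$ the Fubini-Study (geodesic) distance on $\mathbb{P}^n(\mathbb{H})$; the kernel depends on $x,y$ only through $d$. Then for all $t>0$ the kernel admits the following two representations: (i) for $0\le d<\pi/2$, $$H_n(t;d)=\frac{e^{(2n+1)^2t}}{2^{2n-2}\pi^{2n+1}}\int_d^{\pi/2}\frac{\sqrt{\cos^2(d)-\cos^2(u)}}{\cos^2(d)}\,\Psi_{2n+1}(t,u)\,du,$$ where $$\Psi_{2n+1}(t,u)=\sin(u)\left(-\frac{1}{\sin(u)}\frac{d}{du}\right)^{2n+1}\left(\sum_{l=0}^{+\infty}e^{-4t(l+n+1/2)^2}\cos\big((2l+2n+1)u\big)\right);$$ (ii) $$H_n(t;d)=\frac{1}{\pi^{2n}}\sum_{l=0}^{+\infty}(2l+2n+1)\frac{(l+2n)!}{(l+1)!}\,e^{-4l(l+2n+1)t}\,P_l^{(2n-1,1)}(\cos(2d)).$$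
   Context: $\mathbb{H}$ denotes the quaternions, and $\mathbb{P}^n(\mathbb{H})$ is the space of (right) quaternionic lines in $\mathbb{H}^{n+1}$. It carries its canonical Fubini-Study Riemannian metric, normalized so that the geodesic distance $d(x,y)\in[0,\pi/2]$ between the points represented by nonzero $x=(x_0,\dots,x_n)$, $y=(y_0,\dots,y_n)\in\mathbb{H}^{n+1}$ is given by $$\cos(d(x,y))=\frac{\left|\sum_{i=0}^n\overline{x_i}\,y_i\right|}{|x|\,|y|}.$$ $\Delta_{\mathbb{P}^n(\mathbb{H})}$ denotes the Laplace-Beltrami operator of this metric (with the sign making it nonpositive), and $dy$ is the Riemannian volume measure. The heat kernel $H_n(t;x,y)$ is the solution of $$\frac{\partial}{\partial t}H_n(t;x,y)=\Delta_{\mathbb{P}^n(\mathbb{H})}H_n(t;x,y),\quad t>0,\ x,y\in\mathbb{P}^n(\mathbb{H}),$$ $$\lim_{t\to0^+}\int_{\mathbb{P}^n(\mathbb{H})}H_n(t;x,y)f(y)\,dy=f(x),\quad x\in\mathbb{P}^n(\mathbb{H}),\ f\in\mathcal{C}^\infty(\mathbb{P}^n(\mathbb{H})).$$ The power $\left(-\frac{1}{\sin u}\frac{d}{du}\right)^{m}$ is the $m$-fold composition of the differential operator $-\frac{1}{\sin u}\frac{d}{du}$ (at points where $\sin u=0$ the result is understood by continuous extension). $P_l^{(\alpha,\beta)}$ is the classical Jacobi polynomial of degree $l$, normalized by $P_l^{(\alpha,\beta)}(1)=\binom{l+\alpha}{l}$. *)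

theory Defs
  imports "HOL-Analysis.Analysis"
begin

section \<open>Quaternions\<close>

datatype quat = Quat (qRe: real) (qI: real) (qJ: real) (qK: real)

lemma quat_eq_iff: "p = q \<longleftrightarrow> qRe p = qRe q \<and> qI p = qI q \<and> qJ p = qJ q \<and> qK p = qK q"
  by (cases p; cases q) auto

definition qcnj :: "quat \<Rightarrow> quat" where
  "qcnj q = Quat (qRe q) (- qI q) (- qJ q) (- qK q)"

instantiation quat :: real_algebra_1
begin

definition zero_quat :: quat where "0 = Quat 0 0 0 0"
definition one_quat :: quat where "1 = Quat 1 0 0 0"
definition plus_quat :: "quat \<Rightarrow> quat \<Rightarrow> quat" where
  "p + q = Quat (qRe p + qRe q) (qI p + qI q) (qJ p + qJ q) (qK p + qK q)"
definition uminus_quat :: "quat \<Rightarrow> quat" where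
  "- q = Quat (- qRe q) (- qI q) (- qJ q) (- qK q)"
definition minus_quat :: "quat \<Rightarrow> quat \<Rightarrow> quat" where
  "p - q = Quat (qRe p - qRe q) (qI p - qI q) (qJ p - qJ q) (qK p - qK q)"
definition times_quat :: "quat \<Rightarrow> quat \<Rightarrow> quat" where
  "p * q = Quat
     (qRe p * qRe q - qI p * qI q - qJ p * qJ q - qK p * qK q)
     (qRe p * qI q + qI p * qRe q + qJ p * qK q - qK p * qJ q)
     (qRe p * qJ q - qI p * qK q + qJ p * qRe q + qK p * qI q)
     (qRe p * qK q + qI p * qJ q - qJ p * qI q + qK p * qRe q)"
definition scaleR_quat :: "real \<Rightarrow> quat \<Rightarrow> quat" where
  "scaleR r q = Quat (r * qRe q) (r * qI q) (r * qJ q) (r * qK q)"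

lemmas quat_arith_defs = zero_quat_def one_quat_def plus_quat_def uminus_quat_def
  minus_quat_def times_quat_def scaleR_quat_def qcnj_def

instance
  by standard (simp_all add: quat_arith_defs algebra_simps)

end

instantiation quat :: real_normed_vector
begin

definition norm_quat :: "quat \<Rightarrow> real" where
  "norm q = sqrt ((qRe q)\<^sup>2 + (qI q)\<^sup>2 + (qJ q)\<^sup>2 + (qK q)\<^sup>2)"
definition sgn_quat :: "quat \<Rightarrow> quat" where
  "sgn_quat q = scaleR (inverse (norm q)) q"
definition dist_quat :: "quat \<Rightarrow> quat \<Rightarrow> real" where
  "dist_quat p q = norm (p - q)"
definition uniformity_quat :: "(quat \<times> quat) filter" where
  "uniformity_quat = (INF e\<in>{0<..}. principal {(x, y). dist x y < e})"
definition open_quat :: "quat set \<Rightarrow> bool" where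
  "open_quat U = (\<forall>x\<in>U. eventually (\<lambda>(x', y). x' = x \<longrightarrow> y \<in> U) uniformity)"

lemma norm_quat_tuple: "norm q = norm (qRe q, qI q, qJ q, qK q)"
  by (simp add: norm_quat_def norm_Pair add_ac)

instance
proof
  fix p q :: quat and r :: real and U :: "quat set"
  show "dist p q = norm (p - q)" by (rule dist_quat_def)
  show "sgn p = inverse (norm p) *\<^sub>R p" by (rule sgn_quat_def)
  show "(uniformity :: (quat \<times> quat) filter) =
      (INF e\<in>{0<..}. principal {(x, y). dist x y < e})" by (rule uniformity_quat_def)
  show "open U = (\<forall>x\<in>U. eventually (\<lambda>(x', y). x' = x \<longrightarrow> y \<in> U) uniformity)"
    by (rule open_quat_def)
  show "norm p = 0 \<longleftrightarrow> p = 0"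
    unfolding norm_quat_tuple norm_eq_zero by (cases p) (simp add: zero_quat_def zero_prod_def)
  show "norm (p + q) \<le> norm p + norm q"
    unfolding norm_quat_tuple
    using norm_triangle_ineq[of "(qRe p, qI p, qJ p, qK p)" "(qRe q, qI q, qJ q, qK q)"]
    by (simp add: plus_quat_def)
  show "norm (r *\<^sub>R p) = \<bar>r\<bar> * norm p"
    unfolding norm_quat_tuple
    using norm_scaleR[of r "(qRe p, qI p, qJ p, qK p)"]
    by (simp add: scaleR_quat_def)
qed

end

lemma norm_quat_sq: "(norm q)\<^sup>2 = (qRe q)\<^sup>2 + (qI q)\<^sup>2 + (qJ q)\<^sup>2 + (qK q)\<^sup>2" for q :: quat
  by (simp add: norm_quat_def)

instantiation quat :: real_normed_div_algebra
begin

definition inverse_quat :: "quat \<Rightarrow> quat" where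
  "inverse q = scaleR (inverse ((norm q)\<^sup>2)) (qcnj q)"
definition divide_quat :: "quat \<Rightarrow> quat \<Rightarrow> quat" where
  "p div q = p * inverse q" for p q :: quat

instance
proof
  fix a p q :: quat
  show "p div q = p * inverse q" by (rule divide_quat_def)
  have "(norm (p * q))\<^sup>2 = (norm p * norm q)\<^sup>2"
    unfolding power_mult_distrib norm_quat_sq times_quat_def quat.sel by algebra
  then show "norm (p * q) = norm p * norm q"
    by (simp only: power2_eq_iff_nonneg norm_ge_zero mult_nonneg_nonneg)
  show "inverse (0 :: quat) = 0"
    by (simp add: inverse_quat_def quat_arith_defs)
  assume "a \<noteq> 0"
  then have "(norm a)\<^sup>2 \<noteq> 0" by simp
  moreover have "qcnj a * a = (norm a)\<^sup>2 *\<^sub>R 1" "a * qcnj a = (norm a)\<^sup>2 *\<^sub>R 1"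
    unfolding norm_quat_sq by (simp_all add: quat_arith_defs algebra_simps power2_eq_square)
  ultimately show "inverse a * a = 1" "a * inverse a = 1"
    by (simp_all add: inverse_quat_def)
qed

end

lemma qcnj_mult: "qcnj (p * q) = qcnj q * qcnj p"
  by (simp add: quat_arith_defs algebra_simps)

lemma norm_qcnj: "norm (qcnj q) = norm q"
  by (simp add: norm_quat_def qcnj_def)


section \<open>Quaternionic projective space\<close>

text \<open>
  The homogeneous coordinates of a point of \<open>n\<close>-dimensional projective space are indexed by
  \<^typ>\<open>'n option\<close>, where \<^typ>\<open>'n\<close> has \<open>n\<close> elements; \<^const>\<open>None\<close> is the index \<open>0\<close>.
\<close>

definition hscale :: "quat ^ 'm \<Rightarrow> quat \<Rightarrow> quat ^ 'm" where
  "hscale x q = (\<chi> i. x $ i * q)"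

definition hinner :: "quat ^ 'm \<Rightarrow> quat ^ 'm \<Rightarrow> quat" where
  "hinner x y = (\<Sum>i\<in>UNIV. qcnj (x $ i) * y $ i)"

definition same_line :: "quat ^ 'm \<Rightarrow> quat ^ 'm \<Rightarrow> bool" where
  "same_line x y \<longleftrightarrow> x \<noteq> 0 \<and> (\<exists>q. q \<noteq> 0 \<and> y = hscale x q)"

lemma hscale_hscale: "hscale (hscale x p) q = hscale x (p * q)"
  by (simp add: hscale_def vec_eq_iff mult.assoc)

lemma hscale_one: "hscale x 1 = x"
  by (simp add: hscale_def)

lemma hscale_eq_zero: "hscale x q = 0 \<longleftrightarrow> x = 0 \<or> q = 0"
  by (auto simp: hscale_def vec_eq_iff)

lemma hinner_hscale: "hinner (hscale x p) (hscale y q) = qcnj p * hinner x y * q"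
  by (simp add: hinner_def hscale_def qcnj_mult mult.assoc sum_distrib_left sum_distrib_right)

lemma norm_hscale: "norm (hscale x q) = norm x * norm q"
  by (simp add: norm_vec_def hscale_def norm_mult L2_set_left_distrib)

lemma part_equivp_same_line: "part_equivp same_line"
proof (rule part_equivpI)
  show "\<exists>x. same_line x x"
    by (rule exI[of _ "1"], auto simp: same_line_def vec_eq_iff hscale_def intro: exI[of _ 1])
  show "symp same_line"
  proof (rule sympI)
    fix x y :: "quat ^ 'm" assume "same_line x y"
    then obtain q where "x \<noteq> 0" "q \<noteq> 0" "y = hscale x q" by (auto simp: same_line_def)
    then show "same_line y x" unfolding same_line_def
      by (intro conjI exI[of _ "inverse q"]) (auto simp: hscale_hscale hscale_one hscale_eq_zero)
  qed
  show "transp same_line"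
    by (rule transpI) (auto simp: same_line_def hscale_hscale, metis mult_eq_0_iff)
qed

quotient_type 'n hproj = "quat ^ ('n::finite) option" / partial: same_line
  by (rule part_equivp_same_line)

instantiation hproj :: (finite) topological_space
begin

definition open_hproj :: "'a hproj set \<Rightarrow> bool" where
  "open_hproj U \<longleftrightarrow> open {x. x \<noteq> 0 \<and> abs_hproj x \<in> U}"

instance
proof
  show "open (UNIV :: 'a hproj set)"
    by (simp add: open_hproj_def open_Collect_neq)
  fix S T :: "'a hproj set" assume "open S" "open T"
  moreover have "{x. x \<noteq> 0 \<and> abs_hproj x \<in> S \<inter> T}
      = {x. x \<noteq> 0 \<and> abs_hproj x \<in> S} \<inter> {x. x \<noteq> 0 \<and> abs_hproj x \<in> T}" by auto
  ultimately show "open (S \<inter> T)" by (simp add: open_hproj_def open_Int)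
next
  fix K :: "'a hproj set set" assume "\<forall>S\<in>K. open S"
  moreover have "{x. x \<noteq> 0 \<and> abs_hproj x \<in> \<Union>K} = (\<Union>S\<in>K. {x. x \<noteq> 0 \<and> abs_hproj x \<in> S})"
    by auto
  ultimately show "open (\<Union>K)" by (simp add: open_hproj_def open_UN)
qed

end

lift_definition fs_dist :: "'n::finite hproj \<Rightarrow> 'n hproj \<Rightarrow> real" is
  "\<lambda>x y. arccos (norm (hinner x y) / (norm x * norm y))"
  by (auto simp: same_line_def hinner_hscale norm_hscale norm_mult norm_qcnj field_simps)


section \<open>Affine charts and smooth functions\<close>

text \<open>
  The chart with index \<open>j\<close> identifies real \<open>4n\<close>-space with the set of points whose homogeneous
  coordinate \<open>x j\<close> does not vanish, normalized by \<open>x j = 1\<close>. For \<open>j = Some k\<close> the affine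
  coordinate with index \<open>k\<close>, which has no place of its own, is put at position \<^const>\<open>None\<close>.
\<close>

definition quat_coord :: "real ^ ('n::finite \<times> 4) \<Rightarrow> 'n \<Rightarrow> quat" where
  "quat_coord v k = Quat (v $ (k, 0)) (v $ (k, 1)) (v $ (k, 2)) (v $ (k, 3))"

definition affine_lift :: "'n option \<Rightarrow> real ^ ('n::finite \<times> 4) \<Rightarrow> quat ^ 'n option" where
  "affine_lift j v = (\<chi> i. case (if i = j then None else if i = None then j else i) of
      None \<Rightarrow> 1 | Some k \<Rightarrow> quat_coord v k)"

definition hchart :: "'n option \<Rightarrow> real ^ ('n::finite \<times> 4) \<Rightarrow> 'n hproj" where
  "hchart j v = abs_hproj (affine_lift j v)"

fun Ck_on :: "nat \<Rightarrow> 'a::euclidean_space set \<Rightarrow> ('a \<Rightarrow> real) \<Rightarrow> bool" where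
  "Ck_on 0 S f \<longleftrightarrow> continuous_on S f"
| "Ck_on (Suc k) S f \<longleftrightarrow> (\<forall>x\<in>S. f differentiable at x) \<and>
     (\<forall>b\<in>Basis. Ck_on k S (\<lambda>x. frechet_derivative f (at x) b))"

text \<open>Intended for open \<open>S\<close> only.\<close>

definition smooth_on :: "'a::euclidean_space set \<Rightarrow> ('a \<Rightarrow> real) \<Rightarrow> bool" where
  "smooth_on S f \<longleftrightarrow> (\<forall>k. Ck_on k S f)"

definition hproj_smooth :: "('n::finite hproj \<Rightarrow> real) \<Rightarrow> bool" where
  "hproj_smooth f \<longleftrightarrow> (\<forall>j. smooth_on UNIV (\<lambda>v. f (hchart j v)))"


section \<open>Fubini-Study metric, volume and Laplacian\<close>

text \<open>
  The Fubini-Study tensor in homogeneous coordinates: the tangent vectors \<open>a\<close> and \<open>b\<close> at \<open>x\<close> are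
  projected to the orthogonal complement of the line through \<open>x\<close>, and the Euclidean inner product
  of the projections is divided by \<open>|x|\<^sup>2\<close>. This makes the Hopf fibration of the unit sphere a
  Riemannian submersion, so that the diameter is \<open>\<pi>/2\<close>.
\<close>

definition fs_tensor :: "quat ^ 'm \<Rightarrow> quat ^ 'm \<Rightarrow> quat ^ 'm \<Rightarrow> real" where
  "fs_tensor x a b =
     (qRe (hinner a b) * (norm x)\<^sup>2 - qRe (hinner a x * hinner x b)) / (norm x) ^ 4"

definition fs_metric ::
    "'n option \<Rightarrow> real ^ ('n::finite \<times> 4) \<Rightarrow> real ^ ('n \<times> 4) ^ ('n \<times> 4)" where
  "fs_metric j v = (\<chi> a b. fs_tensor (affine_lift j v)
      (frechet_derivative (affine_lift j) (at v) (axis a 1))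
      (frechet_derivative (affine_lift j) (at v) (axis b 1)))"

text \<open>
  The measure with density \<open>\<surd>(det g)\<close> in every chart. The charts overlap; they are glued by the
  partition of unity that gives equal weight to each chart containing a given point.
\<close>

definition fs_volume :: "'n::finite hproj measure" where
  "fs_volume = distr
     (density (count_space UNIV \<Otimes>\<^sub>M lborel)
        (\<lambda>(j, v). ennreal (sqrt (det (fs_metric j v)) / card {k. hchart j v \<in> range (hchart k)})))
     borel (\<lambda>(j, v). hchart j v)"

definition partial_deriv :: "'m::finite \<Rightarrow> (real ^ 'm \<Rightarrow> real) \<Rightarrow> real ^ 'm \<Rightarrow> real" where
  "partial_deriv a f v = frechet_derivative f (at v) (axis a 1)"

definition laplace_beltrami ::
    "(real ^ 'm \<Rightarrow> real ^ 'm ^ 'm::finite) \<Rightarrow> (real ^ 'm \<Rightarrow> real) \<Rightarrow> real ^ 'm \<Rightarrow> real" where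
  "laplace_beltrami g f v = (\<Sum>a\<in>UNIV. \<Sum>b\<in>UNIV.
      partial_deriv a (\<lambda>w. sqrt (det (g w)) * matrix_inv (g w) $ a $ b * partial_deriv b f w) v)
      / sqrt (det (g v))"

text \<open>The value does not depend on the chart chosen around the point \<open>p\<close>.\<close>

definition fs_laplacian :: "('n::finite hproj \<Rightarrow> real) \<Rightarrow> 'n hproj \<Rightarrow> real" where
  "fs_laplacian f p = (let (j, v) = (SOME (j, v). hchart j v = p) in
      laplace_beltrami (fs_metric j) (\<lambda>w. f (hchart j w)) v)"


section \<open>The heat kernel\<close>

text \<open>
  The Laplacian acts on the variable \<open>y\<close>, the one paired with test functions in the initial
  condition. (The kernel is symmetric, but with the Laplacian in \<open>x\<close> the pointwise initial
  condition alone would not single it out.)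
\<close>

definition is_heat_kernel :: "(real \<Rightarrow> 'n::finite hproj \<Rightarrow> 'n hproj \<Rightarrow> real) \<Rightarrow> bool" where
  "is_heat_kernel H \<longleftrightarrow>
     (\<forall>x j. smooth_on ({0<..} \<times> UNIV) (\<lambda>(t, v). H t x (hchart j v))) \<and>
     (\<forall>t>0. \<forall>x y. ((\<lambda>s. H s x y) has_real_derivative fs_laplacian (H t x) y) (at t)) \<and>
     (\<forall>f x. hproj_smooth f \<longrightarrow>
        ((\<lambda>t. \<integral>y. H t x y * f y \<partial>fs_volume) \<longlongrightarrow> f x) (at_right 0))"


section \<open>Special functions in the two representations\<close>

text \<open>The terminating hypergeometric form of the Jacobi polynomial.\<close>

definition jacobi_P :: "nat \<Rightarrow> real \<Rightarrow> real \<Rightarrow> real \<Rightarrow> real" where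
  "jacobi_P l \<alpha> \<beta> x = pochhammer (\<alpha> + 1) l / fact l *
     (\<Sum>k\<le>l. pochhammer (- real l) k * pochhammer (real l + \<alpha> + \<beta> + 1) k /
        (pochhammer (\<alpha> + 1) k * fact k) * ((1 - x) / 2) ^ k)"

lemma jacobi_P_1: "jacobi_P l \<alpha> \<beta> 1 = (real l + \<alpha>) gchoose l"
  by (simp add: jacobi_P_def gbinomial_pochhammer' power_0_left sum.delta if_distrib
      add_ac cong: if_cong)

definition neg_csc_deriv :: "(real \<Rightarrow> real) \<Rightarrow> real \<Rightarrow> real" where
  "neg_csc_deriv f u = (if sin u = 0 then Lim (at u) (\<lambda>v. - (1 / sin v) * deriv f v)
     else - (1 / sin u) * deriv f u)"

definition hp_Psi :: "nat \<Rightarrow> real \<Rightarrow> real \<Rightarrow> real" where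
  "hp_Psi n t u = sin u * (neg_csc_deriv ^^ (2 * n + 1))
     (\<lambda>v. \<Sum>l. exp (- 4 * t * (real l + real n + 1 / 2)\<^sup>2) * cos (real (2 * l + 2 * n + 1) * v)) u"

end

theory Submission
  imports Defs "HOL-Analysis.Analysis" "HOL-Real_Asymp.Real_Asymp" "HOL-Probability.Distributions"
begin

text \<open>
  Fix a point \<open>y\<close> and let \<open>u\<close> be the function \<open>cos\<^sup>2\<close> of the distance to \<open>y\<close>. In homogeneous
  coordinates \<open>u\<close> is a quotient of two quadratic forms, and the Laplacian maps its powers to
  \<open>\<Delta> u\<^sup>N = 4 N (N + 1) u\<^sup>N\<^sup>-\<^sup>1 - \<lambda>\<^sub>N u\<^sup>N\<close> with \<open>\<lambda>\<^sub>N = 4 N (N + 2 n + 1)\<close> (\<open>chart_lap_cossq_power\<close>).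
  Consider the moments \<open>m\<^sub>N(t) = \<integral> H(t,x,z) u(z)\<^sup>N dz\<close>. The heat equation and Green's identity
  (\<open>heat_kernel_moment_deriv\<close>, \<open>green_cossq_power\<close>) turn this relation into the triangular system
  \<open>m\<^sub>N' = 4 N (N + 1) m\<^sub>N\<^sub>-\<^sub>1 - \<lambda>\<^sub>N m\<^sub>N\<close>, and the initial condition, tested on the smooth function \<open>u\<^sup>N\<close>,
  says that \<open>m\<^sub>N\<close> tends to \<open>u(x)\<^sup>N\<close> as \<open>t\<close> tends to \<open>0\<close>. Hence the moments are known
  (\<open>moment_ode_unique\<close>): they are \<open>\<Sum>\<^bsub>l\<le>N\<^esub> b\<^sub>N\<^sub>,\<^sub>l exp(-\<lambda>\<^sub>l t) P\<^sub>l(u(x))\<close>, where the polynomials \<open>P\<^sub>l\<close>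
  diagonalize the system. These are the Jacobi polynomials of the second representation, in the
  variable \<open>cos (2 d) = 2 cos\<^sup>2 d - 1\<close> (\<open>jacobi_P_eq_zonal\<close>).

  The moments determine the kernel because \<open>u < 1\<close> away from \<open>y\<close>: the probability measures
  proportional to \<open>u\<^sup>N dz\<close> concentrate at \<open>y\<close> (\<open>cossq_power_concentration\<close>), so \<open>m\<^sub>N(t)\<close> divided by
  \<open>\<integral> u\<^sup>N\<close> tends to \<open>H(t,x,y)\<close>. By Tannery's theorem the same quotient tends to the series of the
  second representation (\<open>zonal_moment_asymptotics\<close>).

  The geometric input is obtained in the affine charts. There the metric is a perturbation of rank
  four of a multiple of the Euclidean one, so its determinant and its inverse are explicit. The
  Laplacian agrees with \<open>|x|\<^sup>2\<close> times the Euclidean Laplacian of the function of homogeneous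
  coordinates \<open>x\<close>; this form does not mention a chart, so it shows independence of the chart
  (\<open>fs_laplacian_hchart\<close>), and it is also the form in which the Laplacian of \<open>u\<^sup>N\<close> is computed.
  Green's identity is proved in each chart separately, by means of cutoff functions; this is
  possible because the complement of a chart is a null set and because \<open>u\<^sup>N\<close> has a bounded radial
  derivative, so that the errors made by the cutoff vanish in the limit (\<open>green_chart\<close>).

  For the first representation put \<open>c = cos u\<close>. Then \<open>-(1 / sin u) d/du\<close> is \<open>d/dc\<close> and \<open>cos (M u)\<close> is
  the Chebyshev polynomial \<open>T\<^sub>M(c)\<close>, so \<open>\<Psi>\<close> is a series in the derivatives of order \<open>2 n + 1\<close> of
  the \<open>T\<^sub>M\<close>. Integrating the powers of \<open>c\<close> against the square root produces factors that
  transform the recurrence for the coefficients of these derivatives into the one for \<open>P\<^sub>l\<close>;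
  therefore the integral of the term with index \<open>l\<close> is a multiple of the corresponding term of the
  second representation (\<open>cheb_deriv_half_beta\<close>, \<open>hp_Psi_integral\<close>).
\<close>

section \<open>Zonal polynomials\<close>

text \<open>
  The eigenvalues of minus the Laplacian on the space of quaternionic dimension \<open>n\<close>.
\<close>

definition eigval :: "nat \<Rightarrow> nat \<Rightarrow> real" where
  "eigval n l = 4 * real l * (real l + 2 * real n + 1)"

text \<open>
  The coefficients of the Jacobi polynomial \<open>P\<^sub>l\<close> with parameters \<open>2 n - 1\<close> and \<open>1\<close> at \<open>2 u - 1\<close>,
  expanded in powers of \<open>u\<close>; the definition of \<open>jacobi_P\<close> is an expansion in powers of \<open>1 - u\<close>.
\<close>

definition zonal_coeff :: "nat \<Rightarrow> nat \<Rightarrow> nat \<Rightarrow> real" where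
  "zonal_coeff n l i = (if i \<le> l then (-1) ^ (l - i) * fact (l + 1) * fact (l + i + 2 * n) /
     (fact i * fact (i + 1) * fact (l - i) * fact (l + 2 * n)) else 0)"

definition zonal :: "nat \<Rightarrow> nat \<Rightarrow> real \<Rightarrow> real" where
  "zonal n l u = (\<Sum>i\<le>l. zonal_coeff n l i * u ^ i)"

definition zonal_weight :: "nat \<Rightarrow> nat \<Rightarrow> real" where
  "zonal_weight n l = real (2 * l + 2 * n + 1) * (fact (l + 2 * n) / fact (l + 1))"

text \<open>
  The coefficients of the expansion of \<open>u\<^sup>N\<close> in the polynomials \<open>zonal n l\<close>; see
  \<open>power_zonal_expansion\<close>.
\<close>

definition power_coeff :: "nat \<Rightarrow> nat \<Rightarrow> nat \<Rightarrow> real" where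
  "power_coeff n N l = (if l \<le> N then zonal_weight n l *
     (fact N * fact (N + 1) / (fact (N - l) * fact (N + l + 2 * n + 1))) else 0)"

text \<open>
  The Laplacian acts on polynomials in the squared cosine by
  \<open>u\<^sup>i \<mapsto> 4 i (i + 1) u\<^sup>i\<^sup>-\<^sup>1 - eigval n i u\<^sup>i\<close>. Comparing coefficients, the recurrence says that
  \<open>zonal n l\<close> is an eigenvector of this operator.
\<close>

lemma zonal_coeff_rec: "(eigval n l - eigval n i) * zonal_coeff n l i + 4 * (real i + 1) * (real i + 2) * zonal_coeff n l (Suc i) = 0"
proof -
  consider "i > l" | "i = l" | k where "l = Suc (i + k)"
    by (metis less_imp_Suc_add linorder_neqE_nat)
  then show ?thesis
  proof cases
    case 3
    \<comment> \<open>With names for the factorials that occur, only an identity of rational functions is left.\<close>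
    define a b c G F H :: real where "a = fact i" and "b = fact (Suc i)" and "c = fact k"
      and "G = fact (Suc (2 * i + k + 2 * n))" and "F = fact (Suc l)" and "H = fact (l + 2 * n)"
    have nz: "a \<noteq> 0" "b \<noteq> 0" "c \<noteq> 0" "G \<noteq> 0" "F \<noteq> 0" "H \<noteq> 0"
      by (simp_all add: a_def b_def c_def G_def F_def H_def)
    have e: "l + i + 2 * n = Suc (2 * i + k + 2 * n)" "l + Suc i + 2 * n = Suc (Suc (2 * i + k + 2 * n))"
      "l - i = Suc k" "l - Suc i = k" "l + 1 = Suc l" "i + 1 = Suc i" "Suc i + 1 = Suc (Suc i)"
      using 3 by simp_all
    have f: "(fact (Suc (Suc (2 * i + k + 2 * n))) :: real) = (2 * real i + real k + 2 * real n + 2) * G"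
       "(fact (Suc (Suc i)) :: real) = (real i + 2) * b" "(fact (Suc i) :: real) = b"
       "b = (real i + 1) * a" "(fact (Suc k) :: real) = (real k + 1) * c"
      unfolding G_def b_def c_def a_def by (subst fact_Suc, simp)+
    have 1: "zonal_coeff n l i = - ((-1) ^ k) * F * G / (a * b * ((real k + 1) * c) * H)"
      unfolding zonal_coeff_def e f(3,5) using 3 by (simp add: a_def G_def F_def H_def del: fact_Suc)
    have 2: "zonal_coeff n l (Suc i) = (-1) ^ k * F * ((2 * real i + real k + 2 * real n + 2) * G) /
        (b * ((real i + 2) * b) * c * H)"
      unfolding zonal_coeff_def e f using 3 by (simp add: c_def F_def H_def f(3) del: fact_Suc)
    have 3: "eigval n l - eigval n i = 4 * (real k + 1) * (2 * real i + real k + 2 * real n + 2)"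
      unfolding eigval_def 3 by (simp add: algebra_simps)
    have 4: "real i + 1 \<noteq> 0" "real i + 2 \<noteq> 0" "real k + 1 \<noteq> 0" by linarith+
    show ?thesis unfolding 1 2 3 using nz 4 by (simp add: f(4) divide_simps) (simp add: algebra_simps)
  qed (auto simp: zonal_coeff_def)
qed

text \<open>
  The eigenvalues are distinct, so the recurrence determines all coefficients from the one of
  highest degree. This reduces every identification of polynomials below to a comparison of leading
  coefficients.
\<close>

lemma eigen_coeffs_unique:
  assumes rec: "\<And>i. i < l \<Longrightarrow> (eigval n l - eigval n i) * p i + 4 * (real i + 1) * (real i + 2) * p (Suc i) = 0"
    and top: "p l = 0" and "i \<le> l"
  shows "p i = (0 :: real)"
  using \<open>i \<le> l\<close>
proof (induction rule: inc_induct)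
  case (step i)
  have "eigval n l - eigval n i = 4 * (real l - real i) * (real l + real i + 2 * real n + 1)"
    by (simp add: eigval_def algebra_simps)
  then have "eigval n l - eigval n i \<noteq> 0" using step by simp
  then show ?case using rec[of i] step by simp
qed (rule top)

text \<open>
  Because of this relation, \<open>\<Sum>\<^bsub>l\<le>N\<^esub> power_coeff n N l exp (- eigval n l t) P\<^sub>l\<close> solves the system of
  differential equations for the moments.
\<close>

lemma power_coeff_rec:
  assumes "l \<le> Suc N"
  shows "(eigval n (Suc N) - eigval n l) * power_coeff n (Suc N) l = 4 * real (Suc N) * (real N + 2) * power_coeff n N l"
proof (cases "l = Suc N")
  case False
  then obtain k where N: "N = l + k" using assms by (metis le_Suc_eq le_iff_add)
  define a b c G w :: real where "a = fact N" and "b = fact (Suc N)" and "c = fact k"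
      and "G = fact (Suc (2 * l + k + 2 * n))" and "w = zonal_weight n l"
  have nz: "a \<noteq> 0" "b \<noteq> 0" "c \<noteq> 0" "G \<noteq> 0"
    by (simp_all add: a_def b_def c_def G_def)
  have e: "N + l + 2 * n + 1 = Suc (2 * l + k + 2 * n)" "Suc N + l + 2 * n + 1 = Suc (Suc (2 * l + k + 2 * n))"
      "N - l = k" "Suc N - l = Suc k" "N + 1 = Suc N" "Suc N + 1 = Suc (Suc N)"
    using N by simp_all
  have f: "(fact (Suc (Suc (2 * l + k + 2 * n))) :: real) = (2 * real l + real k + 2 * real n + 2) * G"
     "(fact (Suc (Suc N)) :: real) = (real N + 2) * b" "(fact (Suc N) :: real) = b"
     "b = (real N + 1) * a" "(fact (Suc k) :: real) = (real k + 1) * c"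
    unfolding G_def b_def c_def a_def by (subst fact_Suc, simp)+
  have 1: "power_coeff n N l = w * (a * b / (c * G))"
    unfolding power_coeff_def e f using N by (simp add: a_def G_def c_def w_def)
  have 2: "power_coeff n (Suc N) l = w * (b * ((real N + 2) * b) / ((real k + 1) * c * ((2 * real l + real k + 2 * real n + 2) * G)))"
    unfolding power_coeff_def e f using N by (simp add: w_def)
  have 3: "eigval n (Suc N) - eigval n l = 4 * (real k + 1) * (2 * real l + real k + 2 * real n + 2)"
    by (simp add: eigval_def N algebra_simps)
  have 4: "real k + 1 \<noteq> 0" "2 * real l + real k + 2 * real n + 2 \<noteq> 0" by linarith+
  show ?thesis unfolding 1 2 3 using nz 4 by (simp add: f(4) divide_simps) (simp add: algebra_simps)
qed (simp add: power_coeff_def)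

text \<open>
  As functions of \<open>i\<close>, both sides satisfy the eigenvector recurrence up to the same inhomogeneous
  term: by \<open>power_coeff_rec\<close> the operator of \<open>zonal_coeff_rec\<close> lowers \<open>N\<close> on the left-hand side,
  which makes induction applicable.
\<close>

lemma power_coeff_zonal_coeff_inverse:
  "i \<le> N \<Longrightarrow> (\<Sum>l\<le>N. power_coeff n N l * zonal_coeff n l i) = (if i = N then 1 else 0)"
proof (induction N arbitrary: i)
  case 0
  then show ?case by (simp add: power_coeff_def zonal_coeff_def zonal_weight_def)
next
  case (Suc N)
  define q where "q i = (\<Sum>l\<le>Suc N. power_coeff n (Suc N) l * zonal_coeff n l i) - (if i = Suc N then 1 else 0)" for i
  have top: "q (Suc N) = 0"
  proof -
    have "(\<Sum>l\<le>Suc N. power_coeff n (Suc N) l * zonal_coeff n l (Suc N)) = power_coeff n (Suc N) (Suc N) * zonal_coeff n (Suc N) (Suc N)"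
      by (simp add: zonal_coeff_def)
    also have "\<dots> = 1"
    proof -
      define a b c d :: real where "a = fact (Suc N)" and "b = fact (Suc (Suc N))"
        and "c = fact (Suc (2 * N + 1 + 2 * n + 1))" and "d = fact (Suc N + 2 * n)"
      have nz: "a \<noteq> 0" "b \<noteq> 0" "c \<noteq> 0" "d \<noteq> 0"
        by (simp_all add: a_def b_def c_def d_def)
      have e: "Suc N + Suc N + 2 * n = Suc (2 * N + 1 + 2 * n)"
        "Suc (2 * N + 1 + 2 * n) + 1 = Suc (Suc (2 * N + 1 + 2 * n))" "Suc N + 1 = Suc (Suc N)" by simp_all
      have f: "c = (2 * real N + 2 * real n + 3) * fact (Suc (2 * N + 1 + 2 * n))"
        unfolding c_def by (subst fact_Suc) simp
      have 1: "power_coeff n (Suc N) (Suc N) = (2 * real N + 2 * real n + 3) * (d / b) * (a * b / c)"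
        unfolding power_coeff_def zonal_weight_def e by (simp add: a_def b_def c_def d_def del: fact_Suc)
      have 2: "zonal_coeff n (Suc N) (Suc N) = b * fact (Suc (2 * N + 1 + 2 * n)) / (a * b * d)"
        unfolding zonal_coeff_def e by (simp add: a_def b_def d_def del: fact_Suc)
      have "2 * real N + 2 * real n + 3 \<noteq> 0" by linarith
      then show ?thesis unfolding 1 2 f using nz by simp
    qed
    finally show ?thesis by (simp add: q_def)
  qed
  have rec: "(eigval n (Suc N) - eigval n i) * q i + 4 * (real i + 1) * (real i + 2) * q (Suc i) = 0"
    if "i < Suc N" for i
  proof -
    have "(eigval n (Suc N) - eigval n i) * (\<Sum>l\<le>Suc N. power_coeff n (Suc N) l * zonal_coeff n l i)
        + 4 * (real i + 1) * (real i + 2) * (\<Sum>l\<le>Suc N. power_coeff n (Suc N) l * zonal_coeff n l (Suc i))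
       = (\<Sum>l\<le>Suc N. (eigval n (Suc N) - eigval n l) * power_coeff n (Suc N) l * zonal_coeff n l i +
           power_coeff n (Suc N) l * ((eigval n l - eigval n i) * zonal_coeff n l i + 4 * (real i + 1) * (real i + 2) * zonal_coeff n l (Suc i)))"
      unfolding sum_distrib_left sum.distrib[symmetric] by (intro sum.cong) (auto simp: algebra_simps)
    also have "\<dots> = (\<Sum>l\<le>Suc N. 4 * real (Suc N) * (real N + 2) * (power_coeff n N l * zonal_coeff n l i))"
      unfolding zonal_coeff_rec by (intro sum.cong) (auto simp: power_coeff_rec)
    also have "\<dots> = 4 * real (Suc N) * (real N + 2) * (\<Sum>l\<le>N. power_coeff n N l * zonal_coeff n l i)"
      unfolding sum_distrib_left[symmetric] by (simp add: power_coeff_def)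
    also have "\<dots> = (if i = N then 4 * real (Suc N) * (real N + 2) else 0)"
      using Suc.IH[of i] that by simp
    finally show ?thesis using that unfolding q_def
      by (auto simp: algebra_simps split: if_splits)
  qed
  show ?case using eigen_coeffs_unique[of "Suc N" n q i, OF rec top] Suc.prems by (simp add: q_def)
qed

lemma power_zonal_expansion: "u ^ N = (\<Sum>l\<le>N. power_coeff n N l * zonal n l u)"
proof -
  have z: "zonal n l u = (\<Sum>i\<le>N. zonal_coeff n l i * u ^ i)" if "l \<le> N" for l
    unfolding zonal_def by (rule sum.mono_neutral_left) (use that in \<open>auto simp: zonal_coeff_def\<close>)
  have "(\<Sum>l\<le>N. power_coeff n N l * zonal n l u) = (\<Sum>l\<le>N. \<Sum>i\<le>N. power_coeff n N l * zonal_coeff n l i * u ^ i)"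
    by (intro sum.cong) (auto simp: z sum_distrib_left mult.assoc)
  also have "\<dots> = (\<Sum>i\<le>N. (\<Sum>l\<le>N. power_coeff n N l * zonal_coeff n l i) * u ^ i)"
    by (subst sum.swap) (simp add: sum_distrib_right)
  also have "\<dots> = (\<Sum>i\<le>N. if i = N then u ^ i else 0)"
    by (intro sum.cong) (auto simp: power_coeff_zonal_coeff_inverse)
  finally show ?thesis by (simp add: sum.delta)
qed

text \<open>
  The hypergeometric coefficients of \<open>jacobi_P\<close> give a differential equation of second order in the
  variable \<open>1 - u\<close>. In the variable \<open>u\<close> it is the eigenvector equation of \<open>zonal n l\<close>, so only the
  leading coefficients have to be compared.
\<close>

lemma jacobi_P_eq_zonal:
  assumes "n \<ge> 1"
  shows "jacobi_P l (2 * real n - 1) 1 (2 * u - 1) = zonal n l u"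
proof -
  define c :: "nat \<Rightarrow> real" where "c k = pochhammer (2 * real n) l / fact l *
     (pochhammer (- real l) k * pochhammer (real l + 2 * real n + 1) k /
        (pochhammer (2 * real n) k * fact k))" for k
  define S where "S = (\<Sum>k\<le>l. monom (c k) k)"
  have c0: "c k = 0" if "k > l" for k
    using that pochhammer_of_nat_eq_0_lemma[of l k, where 'a = real] by (simp add: c_def)
  have coeffS: "coeff S k = c k" for k
    using c0[of k] by (auto simp: S_def coeff_sum)
  have pn0: "pochhammer (2 * real n) k \<noteq> 0" for k
    using assms by (intro less_imp_neq[THEN not_sym] pochhammer_pos) simp
  have crec: "c (Suc k) * (real k + 1) * (real k + 2 * real n) = (real k - real l) * (real l + 2 * real n + 1 + real k) * c k" for k
  proof -
    define A B C D E where "A = pochhammer (2 * real n) l / fact l" and "B = pochhammer (- real l) k"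
      and "C = pochhammer (real l + 2 * real n + 1) k" and "D = pochhammer (2 * real n) k"
      and "E = (fact k :: real)"
    have nz: "D \<noteq> 0" "E \<noteq> 0" using pn0[of k] by (simp_all add: D_def E_def)
    have 1: "c k = A * (B * C / (D * E))" by (simp add: c_def A_def B_def C_def D_def E_def)
    have 2: "c (Suc k) = A * ((B * (real k - real l)) * (C * (real l + 2 * real n + 1 + real k)) /
        ((D * (2 * real n + real k)) * ((real k + 1) * E)))"
      by (simp add: c_def A_def B_def C_def D_def E_def pochhammer_Suc algebra_simps)
    have 3: "real k + 1 \<noteq> 0" "2 * real n + real k \<noteq> 0" "real k + 2 * real n \<noteq> 0" using assms by linarith+
    show ?thesis unfolding 1 2 using nz 3 by (simp add: divide_simps)
  qed
  have eigS: "[:0, 4, -4:] * pderiv (pderiv S) + [:8 * real n, - 8 * (real n + 1):] * pderiv S + smult (eigval n l) S = 0"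
    (is "?E = 0")
  proof (rule poly_eqI)
    fix k
    show "coeff ?E k = coeff 0 k"
      using crec[of k]
      by (cases k; cases "k - 1") (simp_all add: coeffS coeff_pderiv eigval_def algebra_simps)
  qed
  define p where "p = pcompose S [:1, -1:]"
  have eigp: "[:0, 4, -4:] * pderiv (pderiv p) + [:8, - 8 * (real n + 1):] * pderiv p + smult (eigval n l) p = 0"
    (is "?F = 0")
  proof -
    have d1: "pderiv p = - pcompose (pderiv S) [:1, -1:]"
      by (simp add: p_def pderiv_pcompose pderiv_pCons)
    have d2: "pderiv (pderiv p) = pcompose (pderiv (pderiv S)) [:1, -1:]"
      unfolding d1 by (simp add: pderiv_pcompose pderiv_minus pderiv_pCons)
    have "0 = pcompose ?E [:1, -1:]" unfolding eigS by simp
    also have "\<dots> = pcompose [:0, 4, -4:] [:1, -1:] * pderiv (pderiv p)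
         + pcompose [:8 * real n, - 8 * (real n + 1):] [:1, -1:] * (- pderiv p) + smult (eigval n l) p"
      unfolding d2 unfolding d1 by (simp only: pcompose_add pcompose_mult pcompose_smult p_def minus_minus)
    also have "pcompose [:0, 4, -4:] [:1, -1:] = [:0, 4, -4 :: real:]"
      by (simp add: pcompose_pCons)
    also have "pcompose [:8 * real n, - 8 * (real n + 1):] [:1, -1:] = [:-8, 8 * (real n + 1):]"
      by (simp add: pcompose_pCons algebra_simps)
    also have "[:-8, 8 * (real n + 1):] * (- pderiv p) = [:8, - 8 * (real n + 1):] * pderiv p"
    proof -
      have "[:-8, 8 * (real n + 1):] = - [:8, - 8 * (real n + 1):]" by simp
      then show ?thesis by (simp only: mult_minus_left mult_minus_right minus_minus)
    qed
    finally show ?thesis by simp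
  qed
  have degS: "degree S \<le> l"
    unfolding S_def by (intro degree_sum_le) (auto intro: order_trans[OF degree_monom_le])
  have degp: "degree p \<le> l"
    unfolding p_def using degS degree_pcompose_le[of S "[:1,-1:]"] by simp
  have topc: "coeff p l = zonal_coeff n l l"
  proof -
    have e: "(fact (l + l + 2*n) :: real) = fact (l + 2*n) * pochhammer (real l + 2 * real n + 1) l"
    proof -
      have "(fact (l + 2*n + l) :: real) = pochhammer 1 (l + 2*n + l)" by (simp add: pochhammer_fact)
      also have "\<dots> = pochhammer 1 (l+2*n) * pochhammer (1 + real (l+2*n)) l" by (rule pochhammer_product')
      finally show ?thesis by (simp add: pochhammer_fact add_ac)
    qed
    have f: "pochhammer (- real l) l = (-1) ^ l * fact l"
      by (simp add: pochhammer_same)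
    \<comment> \<open>The coefficient \<open>c l\<close> does not vanish, so \<open>S\<close> has degree \<open>l\<close>.\<close>
    have cl: "c l = (-1) ^ l * pochhammer (real l + 2 * real n + 1) l / fact l"
      unfolding c_def f using pn0[of l] by (simp add: field_simps)
    have "coeff p l = (-1) ^ l * c l"
    proof (cases "degree S = l")
      case True
      have "degree p = l" unfolding p_def using True by (simp add: degree_pcompose)
      then have "coeff p l = lead_coeff p" by simp
      also have "\<dots> = lead_coeff S * (-1) ^ degree S"
        unfolding p_def by (simp add: lead_coeff_comp)
      finally show ?thesis using True by (simp add: coeffS)
    next
      case False
      then have "degree S < l" using degS by simp
      moreover have "c l \<noteq> 0" unfolding cl
        using less_imp_neq[OF pochhammer_pos[of "real l + 2 * real n + 1" l]] by (auto simp: add_pos_nonneg)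
      ultimately show ?thesis using coeffS[of l] coeff_eq_0 by metis
    qed
    also have "\<dots> = zonal_coeff n l l" unfolding cl zonal_coeff_def e by (simp add: power_mult_distrib[symmetric] del: fact_Suc)
    finally show ?thesis .
  qed
  have co: "coeff p i = zonal_coeff n l i" if "i \<le> l" for i
  proof -
    have "coeff p i - zonal_coeff n l i = 0"
    proof (rule eigen_coeffs_unique[of l n "\<lambda>i. coeff p i - zonal_coeff n l i" i])
      fix i assume "i < l"
      have "coeff ?F i = 0" unfolding eigp by simp
      then have "(eigval n l - eigval n i) * coeff p i + 4 * (real i + 1) * (real i + 2) * coeff p (Suc i) = 0"
        by (cases i; cases "i - 1") (simp_all add: coeff_pderiv eigval_def algebra_simps)
      then show "(eigval n l - eigval n i) * (coeff p i - zonal_coeff n l i) + 4 * (real i + 1) * (real i + 2) * (coeff p (Suc i) - zonal_coeff n l (Suc i)) = 0"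
        using zonal_coeff_rec[of n l i] by (simp add: algebra_simps)
    qed (use topc that in auto)
    then show ?thesis by simp
  qed
  have "jacobi_P l (2 * real n - 1) 1 (2 * u - 1) = (\<Sum>k\<le>l. c k * (1 - u) ^ k)"
  proof -
    have e: "(1 - (2 * u - 1)) / 2 = 1 - u" "2 * real n - 1 + 1 = 2 * real n"
      "real l + (2 * real n - 1) + 1 + 1 = real l + 2 * real n + 1" by (simp_all add: field_simps)
    show ?thesis unfolding jacobi_P_def c_def sum_distrib_left e by (intro sum.cong refl) simp
  qed
  also have "\<dots> = poly p u"
    by (simp add: p_def poly_pcompose S_def poly_sum poly_monom)
  also have "\<dots> = (\<Sum>i\<le>l. coeff p i * u ^ i)"
    unfolding poly_altdef using degp by (intro sum.mono_neutral_left) (auto simp: coeff_eq_0)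
  also have "\<dots> = zonal n l u"
    unfolding zonal_def by (intro sum.cong) (auto simp: co)
  finally show ?thesis .
qed

section \<open>Asymptotics of the moments\<close>

text \<open>
  Geometric growth in \<open>l\<close> is harmless, since \<open>exp (- eigval n l * t)\<close> decays like a Gaussian.
\<close>

lemma abs_zonal_le:
  assumes "0 \<le> u" "u \<le> 1"
  shows "\<bar>zonal n l u\<bar> \<le> 2 ^ (4 * l + 2 * n + 1)"
proof -
  have b: "\<bar>zonal_coeff n l i\<bar> \<le> 2 ^ (3 * l + 2 * n + 1)" if i: "i \<le> l" for i
  proof -
    have c1: "fact (l + 1) / (fact (i + 1) * fact (l - i)) = real ((l + 1) choose (i + 1))"
      using i by (subst binomial_fact) (auto simp: Suc_diff_le)
    have c2: "fact (l + i + 2 * n) / (fact i * fact (l + 2 * n)) = real ((l + i + 2 * n) choose i)"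
      using i by (subst binomial_fact) auto
    have "\<bar>zonal_coeff n l i\<bar> = (fact (l + 1) / (fact (i + 1) * fact (l - i))) * (fact (l + i + 2 * n) / (fact i * fact (l + 2 * n)))"
      using i by (simp add: zonal_coeff_def abs_mult power_abs del: fact_Suc)
    also have "\<dots> = real (((l + 1) choose (i + 1)) * ((l + i + 2 * n) choose i))"
      unfolding c1 c2 by simp
    also have "\<dots> \<le> real (2 ^ (l + 1) * 2 ^ (2 * l + 2 * n))"
    proof (intro of_nat_mono mult_mono)
      have "(l + i + 2 * n) choose i \<le> 2 ^ (l + i + 2 * n)" by (rule binomial_le_pow2)
      also have "\<dots> \<le> 2 ^ (2 * l + 2 * n)" using i by (intro power_increasing) auto
      finally show "(l + i + 2 * n) choose i \<le> 2 ^ (2 * l + 2 * n)" .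
      show "(l + 1) choose (i + 1) \<le> 2 ^ (l + 1)" by (rule binomial_le_pow2)
    qed auto
    also have "\<dots> = 2 ^ (3 * l + 2 * n + 1)"
      unfolding power_add[symmetric] of_nat_power by simp
    finally show ?thesis .
  qed
  have "\<bar>zonal n l u\<bar> \<le> (\<Sum>i\<le>l. \<bar>zonal_coeff n l i\<bar> * u ^ i)"
    unfolding zonal_def by (rule order_trans[OF sum_abs]) (use assms in \<open>simp add: abs_mult\<close>)
  also have "\<dots> \<le> (\<Sum>i\<le>l. 2 ^ (3 * l + 2 * n + 1) * 1)"
    using assms by (intro sum_mono mult_mono b power_le_one) auto
  also have "\<dots> = real (l + 1) * 2 ^ (3 * l + 2 * n + 1)" by simp
  also have "\<dots> \<le> 2 ^ l * 2 ^ (3 * l + 2 * n + 1)"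
  proof (intro mult_right_mono)
    have "l + 1 \<le> 2 ^ l" using less_exp[of l] by (simp only: Suc_eq_plus1[symmetric] Suc_le_eq)
    then show "real (l + 1) \<le> 2 ^ l" using of_nat_mono[of "l + 1" "2 ^ l"] by simp
  qed simp
  also have "\<dots> = 2 ^ (4 * l + 2 * n + 1)" unfolding power_add[symmetric] by simp
  finally show ?thesis .
qed

lemma zonal_weight_pos: "zonal_weight n l > 0"
  unfolding zonal_weight_def by (intro mult_pos_pos divide_pos_pos) auto

lemma summable_zonal_weight_majorant:
  assumes "t > 0"
  shows "summable (\<lambda>l. zonal_weight n l * exp (- eigval n l * t) * 2 ^ (4 * l + 2 * n + 1))" (is "summable ?f")
proof -
  have "((\<lambda>l::nat. 48 * (2 * real n + 1) * exp (- (8 * t) * real l)) \<longlongrightarrow> 0) sequentially"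
    using assms by real_asymp
  then have "eventually (\<lambda>l::nat. 48 * (2 * real n + 1) * exp (- (8 * t) * real l) < 1 / 2) sequentially"
    by (rule order_tendstoD) simp
  then obtain N where N: "\<And>l. l \<ge> N \<Longrightarrow> 48 * (2 * real n + 1) * exp (- (8 * t) * real l) < 1 / 2"
    by (auto simp: eventually_sequentially)
  show ?thesis
  proof (rule summable_ratio_test[where c = "1/2" and N = N])
    fix l assume l: "N \<le> l"
    define W where "W = zonal_weight n l"
    have W: "W > 0" by (simp add: W_def zonal_weight_pos)
    have w: "zonal_weight n (Suc l) \<le> 3 * (2 * real n + 1) * W"
    proof -
      define A B :: real where "A = fact (l + 2 * n)" and "B = fact (l + 1)"
      have pos: "A > 0" "B > 0" by (simp_all add: A_def B_def)
      have e1: "zonal_weight n (Suc l) = (2 * real l + 2 * real n + 3) * ((real l + 2 * real n + 1) / (real l + 2)) * (A / B)"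
        unfolding zonal_weight_def A_def B_def by (simp add: field_simps)
      have e2: "W = (2 * real l + 2 * real n + 1) * (A / B)"
        unfolding W_def zonal_weight_def A_def B_def by (simp add: field_simps)
      have "(2 * real l + 2 * real n + 3) * ((real l + 2 * real n + 1) / (real l + 2))
          \<le> (3 * (2 * real l + 2 * real n + 1)) * (2 * real n + 1)"
      proof (rule mult_mono)
        have "real l + 2 * real n + 1 \<le> (2 * real n + 1) * (real l + 2)"
          by (simp add: algebra_simps)
        then show "(real l + 2 * real n + 1) / (real l + 2) \<le> 2 * real n + 1" by (simp add: divide_le_eq)
      qed auto
      then have "(2 * real l + 2 * real n + 3) * ((real l + 2 * real n + 1) / (real l + 2)) * (A / B)
          \<le> (3 * (2 * real l + 2 * real n + 1)) * (2 * real n + 1) * (A / B)"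
        using pos by (intro mult_right_mono) auto
      also have "\<dots> = 3 * (2 * real n + 1) * W" unfolding e2 by (simp only: mult_ac)
      finally show ?thesis unfolding e1 .
    qed
    have x: "exp (- eigval n (Suc l) * t) \<le> exp (- (8 * t) * real l) * exp (- eigval n l * t)"
    proof -
      have "0 \<le> t * (8 + 8 * real n)" using assms by simp
      then show ?thesis unfolding exp_add[symmetric] by (simp add: eigval_def algebra_simps)
    qed
    have "?f (Suc l) = zonal_weight n (Suc l) * exp (- eigval n (Suc l) * t) * (16 * 2 ^ (4 * l + 2 * n + 1))"
      by (simp add: power_add)
    also have "\<dots> \<le> (3 * (2 * real n + 1) * W) * (exp (- (8 * t) * real l) * exp (- eigval n l * t)) * (16 * 2 ^ (4 * l + 2 * n + 1))"
      by (intro mult_right_mono mult_mono w x) (use W in auto)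
    also have "\<dots> = (48 * (2 * real n + 1) * exp (- (8 * t) * real l)) * ?f l"
      by (simp add: W_def)
    also have "\<dots> \<le> 1 / 2 * ?f l"
      using N[OF l] zonal_weight_pos[of n l] by (intro mult_right_mono) auto
    finally show "norm (?f (Suc l)) \<le> 1 / 2 * norm (?f l)"
      using zonal_weight_pos[of n l] zonal_weight_pos[of n "Suc l"] by (simp add: abs_mult)
  qed simp
qed

text \<open>
  The value of \<open>\<integral> u\<^sup>N\<close>, by \<open>integral_cossq_power\<close>.
\<close>

definition power_mass :: "nat \<Rightarrow> nat \<Rightarrow> real" where
  "power_mass n N = pi ^ (2 * n) * fact (N + 1) / fact (N + 2 * n + 1)"

text \<open>
  The relation that Green's identity with the constant function \<open>1\<close> imposes on the integrals of powers.
\<close>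

lemma power_mass_rec: "eigval n (Suc N) * power_mass n (Suc N) = 4 * real (Suc N) * (real N + 2) * power_mass n N"
proof -
  have e: "(fact (Suc N + 2 * n + 1) :: real) = (real N + 2 * real n + 2) * fact (N + 2 * n + 1)"
    "(fact (Suc N + 1) :: real) = (real N + 2) * fact (N + 1)" by (simp_all add: algebra_simps)
  define A B C where "A = (fact (N + 1) :: real)" and "B = (fact (N + 2 * n + 1) :: real)" and "C = pi ^ (2 * n)"
  have nz: "B \<noteq> 0" "real N + 2 * real n + 2 \<noteq> 0" by (simp add: B_def) linarith
  have "4 * real (Suc N) * (real (Suc N) + 2 * real n + 1) * (C * ((real N + 2) * A) / ((real N + 2 * real n + 2) * B))
     = 4 * real (Suc N) * (real N + 2) * (C * A / B)"
    using nz by (simp add: divide_simps)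
  then show ?thesis unfolding power_mass_def e eigval_def A_def B_def C_def .
qed

text \<open>
  The quotient is the limit times the product of \<open>(N - k) / (N + k + 2 n + 2)\<close> over \<open>k < l\<close>. Every
  factor lies between \<open>0\<close> and \<open>1\<close> and tends to \<open>1\<close> with \<open>N\<close>.
\<close>

lemma power_coeff_over_mass_tendsto:
  "(\<lambda>N. power_coeff n N l / power_mass n N) \<longlonglongrightarrow> zonal_weight n l / pi ^ (2 * n)"
  and power_coeff_over_mass_le: "\<bar>power_coeff n N l / power_mass n N\<bar> \<le> zonal_weight n l / pi ^ (2 * n)"
proof -
  define r where "r l N = (if l \<le> N then fact N * fact (N + 2 * n + 1) / (fact (N - l) * fact (N + l + 2 * n + 1)) else (0::real))" for l N
  have e: "power_coeff n N l / power_mass n N = zonal_weight n l / pi ^ (2 * n) * r l N" for N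
    by (simp add: power_coeff_def power_mass_def r_def del: fact_Suc)
  have rs: "r (Suc l) N = r l N * ((real N - real l) / (real N + real l + 2 * real n + 2))" if lN: "l \<le> N" for l N
  proof (cases "l = N")
    case False
    then have "N - l = Suc (N - Suc l)" "Suc l \<le> N" using lN by auto
    then have f: "fact (N - l) = (real N - real l) * fact (N - Suc l)" by simp
    have g: "fact (N + Suc l + 2 * n + 1) = (real N + real l + 2 * real n + 2) * fact (N + l + 2 * n + 1)" by simp
    define P Q S x y where "P = (fact N * fact (N + 2 * n + 1) :: real)" and "Q = (fact (N - Suc l) :: real)"
      and "S = (fact (N + l + 2 * n + 1) :: real)" and "x = real N - real l" and "y = real N + real l + 2 * real n + 2"
    have "x \<noteq> 0" "y \<noteq> 0" using lN False unfolding x_def y_def by linarith+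
    then have "P / (Q * (y * S)) = P / (x * Q * S) * (x / y)" by simp
    then show ?thesis unfolding r_def f g P_def Q_def S_def x_def y_def using lN \<open>Suc l \<le> N\<close> by simp
  qed (simp add: r_def)
  have r01: "0 \<le> r l N \<and> r l N \<le> 1" for l N
  proof (induction l)
    case (Suc l)
    show ?case
    proof (cases "l \<le> N")
      case True
      have "(real N - real l) / (real N + real l + 2 * real n + 2) \<le> 1" "0 \<le> (real N - real l) / (real N + real l + 2 * real n + 2)"
        using True by auto
      then show ?thesis unfolding rs[OF True] using Suc by (intro conjI mult_nonneg_nonneg mult_le_one) simp_all
    qed (simp add: r_def)
  qed (simp add: r_def)
  have rt: "(\<lambda>N. r l N) \<longlonglongrightarrow> 1" for l
  proof (induction l)
    case (Suc l)
    have "(\<lambda>N. (real N - real l) / (real N + real l + 2 * real n + 2)) \<longlonglongrightarrow> 1" by real_asymp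
    from tendsto_mult[OF Suc this] have "(\<lambda>N. r l N * ((real N - real l) / (real N + real l + 2 * real n + 2))) \<longlonglongrightarrow> 1" by simp
    then show ?case
      by (rule Lim_transform_eventually) (use eventually_ge_at_top[of l] in \<open>eventually_elim; simp add: rs\<close>)
  qed (simp add: r_def del: fact_Suc)
  show "(\<lambda>N. power_coeff n N l / power_mass n N) \<longlonglongrightarrow> zonal_weight n l / pi ^ (2 * n)"
    unfolding e using tendsto_mult[OF tendsto_const[of "zonal_weight n l / pi ^ (2 * n)"] rt[of l]] by simp
  show "\<bar>power_coeff n N l / power_mass n N\<bar> \<le> zonal_weight n l / pi ^ (2 * n)"
    unfolding e using r01[of l N] zonal_weight_pos[of n l]
    by (simp add: abs_mult mult_left_le divide_right_mono)
qed

text \<open>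
  The \<open>N\<close>-th moment of the heat kernel at time \<open>t\<close>, as a function of \<open>u = cos\<^sup>2 d(x,y)\<close>.
\<close>

definition zonal_moment :: "nat \<Rightarrow> nat \<Rightarrow> real \<Rightarrow> real \<Rightarrow> real" where
  "zonal_moment n N u t = (\<Sum>l\<le>N. power_coeff n N l * exp (- eigval n l * t) * zonal n l u)"

text \<open>
  Tannery's theorem: \<open>power_coeff_over_mass_le\<close> bounds the terms uniformly in \<open>N\<close>.
\<close>

lemma zonal_moment_asymptotics:
  assumes "t > 0" "0 \<le> u" "u \<le> 1"
  shows "summable (\<lambda>l. zonal_weight n l * exp (- eigval n l * t) * zonal n l u)"
    and "(\<lambda>N. zonal_moment n N u t / power_mass n N) \<longlonglongrightarrow>
       1 / pi ^ (2 * n) * (\<Sum>l. zonal_weight n l * exp (- eigval n l * t) * zonal n l u)"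
proof -
  define M where "M l = zonal_weight n l * exp (- eigval n l * t) * 2 ^ (4 * l + 2 * n + 1)" for l
  have sM: "summable M" unfolding M_def by (rule summable_zonal_weight_majorant[OF assms(1)])
  have bM: "\<bar>zonal_weight n l * exp (- eigval n l * t) * zonal n l u\<bar> \<le> M l" for l
    unfolding M_def using abs_zonal_le[OF assms(2,3), of n l] zonal_weight_pos[of n l]
    by (simp add: abs_mult mult_left_mono)
  show s: "summable (\<lambda>l. zonal_weight n l * exp (- eigval n l * t) * zonal n l u)"
    by (rule summable_comparison_test[OF _ sM]) (use bM in auto)
  define a where "a l N = power_coeff n N l / power_mass n N * (exp (- eigval n l * t) * zonal n l u)" for l N
  have fin: "(\<Sum>l. a l N) = zonal_moment n N u t / power_mass n N" for N
  proof -
    have "(\<Sum>l. a l N) = (\<Sum>l\<le>N. a l N)"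
      by (rule suminf_finite) (auto simp: a_def power_coeff_def)
    then show ?thesis by (simp add: a_def zonal_moment_def sum_divide_distrib mult_ac)
  qed
  have "((\<lambda>N. \<Sum>l. a l N) \<longlongrightarrow> (\<Sum>l. zonal_weight n l / pi ^ (2 * n) * (exp (- eigval n l * t) * zonal n l u))) sequentially"
  proof (rule conjunct2[OF conjunct2[OF tannerys_theorem[where M = "\<lambda>l. M l / pi ^ (2 * n)"]]])
    show "((\<lambda>N. a l N) \<longlongrightarrow> zonal_weight n l / pi ^ (2 * n) * (exp (- eigval n l * t) * zonal n l u)) sequentially" for l
      unfolding a_def by (intro tendsto_intros power_coeff_over_mass_tendsto)
    have "norm (a l N) \<le> M l / pi ^ (2 * n)" for l N
    proof -
      have "\<bar>a l N\<bar> \<le> zonal_weight n l / pi ^ (2 * n) * \<bar>exp (- eigval n l * t) * zonal n l u\<bar>"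
        unfolding a_def abs_mult[of "power_coeff n N l / power_mass n N"]
        by (intro mult_right_mono power_coeff_over_mass_le) simp
      also have "\<dots> = \<bar>zonal_weight n l * exp (- eigval n l * t) * zonal n l u\<bar> / pi ^ (2 * n)"
        using zonal_weight_pos[of n l] by (simp add: abs_mult)
      also have "\<dots> \<le> M l / pi ^ (2 * n)" by (intro divide_right_mono bM) simp
      finally show ?thesis by simp
    qed
    then show "eventually (\<lambda>(k, N). norm (a k N) \<le> M k / pi ^ (2 * n)) (sequentially \<times>\<^sub>F sequentially)"
      by (intro always_eventually) auto
    show "summable (\<lambda>l. M l / pi ^ (2 * n))" using sM by (rule summable_divide)
  qed simp
  moreover have "(\<Sum>l. zonal_weight n l / pi ^ (2 * n) * (exp (- eigval n l * t) * zonal n l u))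
      = 1 / pi ^ (2 * n) * (\<Sum>l. zonal_weight n l * exp (- eigval n l * t) * zonal n l u)"
    by (subst suminf_mult[OF s, symmetric]) (simp add: mult_ac)
  ultimately show "(\<lambda>N. zonal_moment n N u t / power_mass n N) \<longlonglongrightarrow>
       1 / pi ^ (2 * n) * (\<Sum>l. zonal_weight n l * exp (- eigval n l * t) * zonal n l u)"
    unfolding fin by simp
qed

section \<open>The differential equations for the moments\<close>

text \<open>
  Given \<open>m (N - 1)\<close>, the equation for \<open>m N\<close> is a scalar linear one: its difference from the explicit
  solution, multiplied by \<open>exp (eigval n N * t)\<close>, is constant, and the initial condition makes the
  constant vanish. For \<open>N = 0\<close> the factor \<open>4 N (N + 1)\<close> removes the term \<open>m (0 - 1)\<close>, which is \<open>m 0\<close>.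
\<close>

lemma moment_ode_unique:
  fixes m :: "nat \<Rightarrow> real \<Rightarrow> real"
  assumes ode: "\<And>N t. t > 0 \<Longrightarrow> (m N has_real_derivative
      4 * real N * (real N + 1) * m (N - 1) t - eigval n N * m N t) (at t)"
    and init: "\<And>N. (m N \<longlongrightarrow> u ^ N) (at_right 0)"
    and t: "t > 0"
  shows "m N t = zonal_moment n N u t"
  using t
proof (induction N arbitrary: t rule: less_induct)
  case (less N t)
  define Z where "Z t = zonal_moment n N u t" for t
  have dZ: "(Z has_real_derivative 4 * real N * (real N + 1) * m (N - 1) t - eigval n N * Z t) (at t)"
    if "t > 0" for t
  proof -
    have d: "(Z has_real_derivative (\<Sum>l\<le>N. power_coeff n N l * (exp (- eigval n l * t) * - eigval n l) * zonal n l u)) (at t)"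
      unfolding Z_def zonal_moment_def by (auto intro!: derivative_eq_intros sum.cong simp: mult_ac)
    have "(\<Sum>l\<le>N. power_coeff n N l * (exp (- eigval n l * t) * - eigval n l) * zonal n l u) + eigval n N * Z t
       = (\<Sum>l\<le>N. ((eigval n N - eigval n l) * power_coeff n N l) * exp (- eigval n l * t) * zonal n l u)"
      unfolding Z_def zonal_moment_def sum_distrib_left sum.distrib[symmetric]
      by (intro sum.cong) (auto simp: algebra_simps)
    also have "\<dots> = 4 * real N * (real N + 1) * m (N - 1) t"
    proof (cases N)
      case 0
      then show ?thesis by (simp add: eigval_def)
    next
      case (Suc M)
      have "(\<Sum>l\<le>N. ((eigval n N - eigval n l) * power_coeff n N l) * exp (- eigval n l * t) * zonal n l u)
         = (\<Sum>l\<le>N. 4 * real (Suc M) * (real M + 2) * (power_coeff n M l * exp (- eigval n l * t) * zonal n l u))"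
        unfolding Suc by (intro sum.cong refl) (simp add: power_coeff_rec)
      also have "\<dots> = 4 * real (Suc M) * (real M + 2) * zonal_moment n M u t"
        unfolding sum_distrib_left[symmetric] zonal_moment_def by (simp add: Suc power_coeff_def)
      finally show ?thesis using less.IH[of M t] Suc that by (simp add: add_ac)
    qed
    finally have "(\<Sum>l\<le>N. power_coeff n N l * (exp (- eigval n l * t) * - eigval n l) * zonal n l u)
        = 4 * real N * (real N + 1) * m (N - 1) t - eigval n N * Z t" by linarith
    then show ?thesis using d by simp
  qed
  define D where "D t = (m N t - Z t) * exp (eigval n N * t)" for t
  have dD: "(D has_real_derivative 0) (at t within {0<..})" if "t \<in> {0<..}" for t
  proof -
    have "(D has_real_derivative ((m N t - Z t) * (exp (eigval n N * t) * eigval n N) +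
       ((4 * real N * (real N + 1) * m (N - 1) t - eigval n N * m N t) -
        (4 * real N * (real N + 1) * m (N - 1) t - eigval n N * Z t)) * exp (eigval n N * t))) (at t)"
      unfolding D_def using that by (auto intro!: derivative_eq_intros ode dZ)
    also have "((m N t - Z t) * (exp (eigval n N * t) * eigval n N) +
       ((4 * real N * (real N + 1) * m (N - 1) t - eigval n N * m N t) -
        (4 * real N * (real N + 1) * m (N - 1) t - eigval n N * Z t)) * exp (eigval n N * t)) = 0"
      by (simp add: algebra_simps)
    finally show ?thesis by (rule has_field_derivative_at_within)
  qed
  obtain c where c: "\<And>t. t > 0 \<Longrightarrow> D t = c"
    using has_field_derivative_zero_constant[OF _ dD] by auto
  have "(Z \<longlongrightarrow> zonal_moment n N u 0) (at_right 0)"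
  proof -
    have "continuous (at 0) Z" unfolding Z_def zonal_moment_def by (intro continuous_intros)
    then have "(Z \<longlongrightarrow> Z 0) (at 0)" by (simp add: continuous_at)
    then show ?thesis unfolding Z_def using filterlim_mono[OF _ order_refl at_le] by blast
  qed
  moreover have "zonal_moment n N u 0 = u ^ N"
    unfolding zonal_moment_def power_zonal_expansion[of u N n] by simp
  moreover have "((\<lambda>t. exp (eigval n N * t)) \<longlongrightarrow> exp (eigval n N * 0)) (at_right 0)"
    by (intro tendsto_intros)
  ultimately have "(D \<longlongrightarrow> (u ^ N - u ^ N) * exp (eigval n N * 0)) (at_right 0)"
    unfolding D_def by (intro tendsto_mult tendsto_diff init) simp_all
  moreover have "(D \<longlongrightarrow> c) (at_right 0)"
    by (rule Lim_transform_eventually[OF tendsto_const])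
      (auto simp: c eventually_at_right_less intro!: eventually_mono[OF eventually_at_right_less])
  ultimately have "c = 0" using tendsto_unique[of "at_right (0::real)"] by force
  then show ?case using c[OF less.prems] by (simp add: D_def Z_def)
qed

section \<open>Chebyshev polynomials and their derivatives\<close>

text \<open>
  The Chebyshev polynomials of the first kind.
\<close>

fun cheb :: "nat \<Rightarrow> real poly" where
  "cheb 0 = 1"
| "cheb (Suc 0) = [:0, 1:]"
| "cheb (Suc (Suc M)) = [:0, 2:] * cheb (Suc M) - cheb M"

lemma poly_cheb_cos: "poly (cheb M) (cos u) = cos (real M * u)"
proof (induction M rule: cheb.induct)
  case (3 M)
  have "cos (real (Suc (Suc M)) * u) + cos (real M * u) = 2 * cos u * cos (real (Suc M) * u)"
  proof -
    have e: "real (Suc (Suc M)) * u = real (Suc M) * u + u" "real M * u = real (Suc M) * u - u"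
      by (simp_all add: algebra_simps)
    show ?thesis unfolding e cos_add cos_diff by simp
  qed
  then show ?case using 3 by simp
qed simp_all

lemma coeff_cheb_Suc_Suc: "coeff (cheb (Suc (Suc M))) k =
    2 * (case k of 0 \<Rightarrow> 0 | Suc j \<Rightarrow> coeff (cheb (Suc M)) j) - coeff (cheb M) k"
  by (cases k) simp_all

lemma abs_coeff_cheb_le: "\<bar>coeff (cheb M) k\<bar> \<le> 3 ^ M"
proof (induction M arbitrary: k rule: cheb.induct)
  case (3 M)
  have "\<bar>2 * (case k of 0 \<Rightarrow> 0 | Suc j \<Rightarrow> coeff (cheb (Suc M)) j)\<bar> \<le> 2 * 3 ^ Suc M"
    using 3(1) by (auto split: nat.split simp: abs_mult)
  moreover have "\<bar>coeff (cheb M) k\<bar> \<le> 3 ^ Suc M" using order_trans[OF 3(2)[of k], of "3 ^ Suc M"] by simp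
  ultimately show ?case unfolding coeff_cheb_Suc_Suc by simp
qed (auto simp: coeff_pCons split: nat.split)

lemma coeff_cheb_eq_0: "k > M \<or> odd (k + M) \<Longrightarrow> coeff (cheb M) k = 0"
proof (induction M arbitrary: k rule: cheb.induct)
  case (1 k)
  then show ?case by (cases k) auto
next
  case (2 k)
  then show ?case by (auto simp: coeff_pCons split: nat.split)
next
  case (3 M k)
  have "coeff (cheb M) k = 0" using 3(2)[of k] 3(3) by auto
  moreover have "coeff (cheb (Suc M)) j = 0" if "k = Suc j" for j using 3(1)[of j] 3(3) that by auto
  ultimately show ?case unfolding coeff_cheb_Suc_Suc by (auto split: nat.split)
qed

lemma lead_coeff_cheb: "coeff (cheb (Suc M)) (Suc M) = 2 ^ M"
proof (induction M)
  case (Suc M)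
  have "coeff (cheb M) (Suc (Suc M)) = 0" by (rule coeff_cheb_eq_0) simp
  then show ?case unfolding coeff_cheb_Suc_Suc using Suc.IH by simp
qed simp

text \<open>
  Two differentiations of \<open>T\<^sub>M(cos u) = cos (M u)\<close> show that
  \<open>(1 - x\<^sup>2) T\<^sub>M'' - x T\<^sub>M' + M\<^sup>2 T\<^sub>M\<close> vanishes on \<open>[-1, 1]\<close>, hence everywhere.
\<close>

lemma cheb_ode_coeffs:
  "(real k + 1) * (real k + 2) * coeff (cheb M) (k + 2) = ((real k)\<^sup>2 - (real M)\<^sup>2) * coeff (cheb M) k"
proof -
  define T where "T = cheb M"
  define F where "F = [:1, 0, -1:] * pderiv (pderiv T) - [:0, 1:] * pderiv T + smult ((real M)\<^sup>2) T"
  have d1: "- sin u * poly (pderiv T) (cos u) = - real M * sin (real M * u)" for u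
  proof -
    have "((\<lambda>u. poly T (cos u)) has_real_derivative - sin u * poly (pderiv T) (cos u)) (at u)"
      using DERIV_chain2[OF poly_DERIV DERIV_cos, of T u] by (simp add: mult.commute)
    moreover have "((\<lambda>u. cos (real M * u)) has_real_derivative - real M * sin (real M * u)) (at u)"
      by (auto intro!: derivative_eq_intros)
    ultimately show ?thesis unfolding T_def poly_cheb_cos by (rule DERIV_unique)
  qed
  have d2: "- cos u * poly (pderiv T) (cos u) + (sin u)\<^sup>2 * poly (pderiv (pderiv T)) (cos u)
     = - (real M)\<^sup>2 * cos (real M * u)" for u
  proof -
    have "((\<lambda>u. - sin u * poly (pderiv T) (cos u)) has_real_derivative
       - cos u * poly (pderiv T) (cos u) + (sin u)\<^sup>2 * poly (pderiv (pderiv T)) (cos u)) (at u)"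
      using DERIV_mult[OF DERIV_minus[OF DERIV_sin[of u]] DERIV_chain2[OF poly_DERIV DERIV_cos, of "pderiv T" u]]
      by (simp add: power2_eq_square mult_ac)
    moreover have "((\<lambda>u. - real M * sin (real M * u)) has_real_derivative - (real M)\<^sup>2 * cos (real M * u)) (at u)"
      by (auto intro!: derivative_eq_intros simp: power2_eq_square)
    ultimately show ?thesis unfolding d1 by (rule DERIV_unique)
  qed
  have F0: "poly F (cos u) = 0" for u
  proof -
    have "poly F (cos u) = (1 - (cos u)\<^sup>2) * poly (pderiv (pderiv T)) (cos u)
        - cos u * poly (pderiv T) (cos u) + (real M)\<^sup>2 * cos (real M * u)"
      by (simp add: F_def T_def poly_cheb_cos algebra_simps power2_eq_square)
    then show ?thesis using d2[of u] unfolding sin_squared_eq by simp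
  qed
  have "F = 0"
  proof (rule ccontr)
    assume "F \<noteq> 0"
    then have "finite {x. poly F x = 0}" by (rule poly_roots_finite)
    moreover have "{-1..1} \<subseteq> {x. poly F x = 0}"
    proof
      fix x :: real assume "x \<in> {-1..1}"
      then show "x \<in> {x. poly F x = 0}" using F0[of "arccos x"] by simp
    qed
    ultimately have "finite {-1..1::real}" by (rule rev_finite_subset)
    then show False using infinite_Icc[of "-1::real" 1] by simp
  qed
  then have "coeff F k = 0" by simp
  then show ?thesis
  proof -
    consider "k = 0" | "k = 1" | j where "k = Suc (Suc j)"
      by (metis One_nat_def not0_implies_Suc)
    then show ?thesis
    proof cases
      case 1
      have "coeff F 0 = 2 * coeff T 2 + (real M)\<^sup>2 * coeff T 0"
        by (simp add: F_def coeff_pderiv numeral_2_eq_2)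
      then show ?thesis using \<open>coeff F k = 0\<close> by (simp add: 1 T_def numeral_2_eq_2)
    next
      case 2
      have "coeff F 1 = 6 * coeff T 3 - coeff T 1 + (real M)\<^sup>2 * coeff T 1"
        by (simp add: F_def coeff_pderiv numeral_3_eq_3)
      then show ?thesis using \<open>coeff F k = 0\<close> by (simp add: 2 T_def numeral_3_eq_3 algebra_simps)
    next
      case 3
      have "coeff F k = coeff (pderiv (pderiv T)) (Suc (Suc j)) - coeff (pderiv (pderiv T)) j
          - coeff (pderiv T) (Suc j) + (real M)\<^sup>2 * coeff T (Suc (Suc j))"
        by (simp add: F_def 3)
      then show ?thesis using \<open>coeff F k = 0\<close> unfolding T_def[symmetric]
        by (simp add: coeff_pderiv 3 algebra_simps power2_eq_square)
    qed
  qed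
qed

definition cheb_deriv :: "nat \<Rightarrow> nat \<Rightarrow> real poly" where
  "cheb_deriv m M = (pderiv ^^ m) (cheb M)"

lemma coeff_cheb_deriv: "coeff (cheb_deriv m M) k = pochhammer (real k + 1) m * coeff (cheb M) (k + m)"
  by (simp add: cheb_deriv_def coeff_higher_pderiv add_ac)

lemma cheb_deriv_rec:
  "(real k + 1) * (real k + 2) * coeff (cheb_deriv m M) (k + 2) = ((real k + real m)\<^sup>2 - (real M)\<^sup>2) * coeff (cheb_deriv m M) k"
proof -
  have p: "pochhammer (real k + 1) m * ((real k + real m + 1) * (real k + real m + 2))
     = (real k + 1) * (real k + 2) * pochhammer (real k + 3) m"
  proof -
    have "pochhammer (real k + 1) (m + 2) = pochhammer (real k + 1) m * ((real k + real m + 1) * (real k + real m + 2))"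
      by (simp add: pochhammer_Suc numeral_2_eq_2 algebra_simps)
    moreover have "pochhammer (real k + 1) (m + 2) = (real k + 1) * (real k + 2) * pochhammer (real k + 3) m"
      by (simp add: pochhammer_rec numeral_2_eq_2 add_ac)
    ultimately show ?thesis by simp
  qed
  have "(real k + 1) * (real k + 2) * coeff (cheb_deriv m M) (k + 2)
      = ((real k + 1) * (real k + 2) * pochhammer (real k + 3) m) * coeff (cheb M) (k + m + 2)"
    unfolding coeff_cheb_deriv by (simp add: add_ac)
  also have "\<dots> = pochhammer (real k + 1) m * ((real (k + m) + 1) * (real (k + m) + 2) * coeff (cheb M) (k + m + 2))"
    unfolding p[symmetric] by (simp add: add_ac)
  also have "\<dots> = pochhammer (real k + 1) m * (((real (k + m))\<^sup>2 - (real M)\<^sup>2) * coeff (cheb M) (k + m))"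
    unfolding cheb_ode_coeffs ..
  finally show ?thesis by (simp add: coeff_cheb_deriv)
qed

section \<open>Integrals of powers of the cosine\<close>

text \<open>
  The integral of \<open>sqrt (1 - s\<^sup>2) s\<^sup>2\<^sup>i\<close> over \<open>0 \<le> s \<le> 1\<close>, that is, half of the value of the beta
  function at \<open>i + 1/2\<close> and \<open>3/2\<close>.
\<close>

primrec halfbeta :: "nat \<Rightarrow> real" where
  "halfbeta 0 = pi / 4"
| "halfbeta (Suc i) = (2 * real i + 1) / (2 * real i + 4) * halfbeta i"

lemma halfbeta_closed: "halfbeta i = pi / 4 * fact (2 * i) / (4 ^ i * fact i * fact (i + 1))"
proof (induction i)
  case (Suc i)
  define A B C where "A = (fact (2 * i) :: real)" and "B = (fact i :: real)" and "C = (4 ^ i :: real)"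
  have nz: "B \<noteq> 0" "C \<noteq> 0" by (simp_all add: B_def C_def)
  have e: "(fact (2 * Suc i) :: real) = (2 * real i + 2) * (2 * real i + 1) * A"
    "(fact (Suc i) :: real) = (real i + 1) * B" "(fact (i + 1) :: real) = (real i + 1) * B"
    "(fact (Suc i + 1) :: real) = (real i + 2) * ((real i + 1) * B)" "(4 ^ Suc i :: real) = 4 * C"
    by (simp_all add: A_def B_def C_def algebra_simps)
  have nz2: "real i + 1 \<noteq> 0" "real i + 2 \<noteq> 0" "2 * real i + 4 \<noteq> 0" by linarith+
  show ?case unfolding halfbeta.simps Suc.IH e A_def[symmetric] B_def[symmetric] C_def[symmetric]
    using nz nz2 by (simp add: divide_simps) (simp add: algebra_simps)
qed simp

text \<open>
  Substituting \<open>s = cos u / cos d\<close>. The derivative of \<open>(C\<^sup>2 - c\<^sup>2)\<^sup>3\<^sup>/\<^sup>2 c\<^sup>2\<^sup>i\<^sup>+\<^sup>1\<close> with respect to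
  \<open>c\<close> relates the integrals for \<open>i\<close> and \<open>i + 1\<close>.
\<close>

lemma halfbeta_integral:
  assumes d: "0 \<le> d" "d < pi / 2"
  shows "((\<lambda>u. sqrt ((cos d)\<^sup>2 - (cos u)\<^sup>2) * sin u * cos u ^ (2 * i)) has_integral
     (cos d) ^ (2 * i + 2) * halfbeta i) {d..pi / 2}"
proof -
  define C where "C = cos d"
  have C: "C > 0" unfolding C_def using d by (intro cos_gt_zero_pi) auto
  have cos_le: "0 \<le> cos u" "cos u \<le> C" if "u \<in> {d..pi/2}" for u
    using that d unfolding C_def by (auto intro!: cos_ge_zero cos_monotone_0_pi_le)
  have cos_lt: "0 \<le> cos u" "cos u < C" if "u \<in> {d<..<pi/2}" for u
    using that d unfolding C_def by (auto intro!: cos_ge_zero cos_monotone_0_pi)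
  have sq_pos: "(cos u)\<^sup>2 < C\<^sup>2" if "u \<in> {d<..<pi/2}" for u
    using cos_lt[OF that] by (intro power_strict_mono) auto
  have base: "((\<lambda>u. sqrt (C\<^sup>2 - (cos u)\<^sup>2) * sin u) has_integral C\<^sup>2 * (pi / 4)) {d..pi / 2}"
  proof -
    \<comment> \<open>The square root is not differentiable at the left end, but the antiderivative is continuous there.\<close>
    define A where "A u = - (1/2) * (cos u * sqrt (C\<^sup>2 - (cos u)\<^sup>2) + C\<^sup>2 * arcsin (cos u / C))" for u
    have "((\<lambda>u. sqrt (C\<^sup>2 - (cos u)\<^sup>2) * sin u) has_integral (A (pi / 2) - A d)) {d..pi / 2}"
    proof (rule fundamental_theorem_of_calculus_interior)
      show "continuous_on {d..pi / 2} A"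
      proof -
        have "- 1 \<le> cos u / C \<and> cos u / C \<le> 1" if "u \<in> {d..pi / 2}" for u
          using cos_le[OF that] C order_trans[of "-1" 0 "cos u / C"] by simp
        then show ?thesis unfolding A_def using C
          by (intro continuous_intros continuous_on_arcsin ballI) auto
      qed
      fix u assume u: "u \<in> {d<..<pi/2}"
      define s where "s = sqrt (C\<^sup>2 - (cos u)\<^sup>2)"
      have s: "s > 0" "s\<^sup>2 = C\<^sup>2 - (cos u)\<^sup>2" using sq_pos[OF u] by (simp_all add: s_def)
      have s1: "sqrt (1 - (cos u / C)\<^sup>2) = s / C"
      proof -
        have "1 - (cos u / C)\<^sup>2 = (C\<^sup>2 - (cos u)\<^sup>2) / C\<^sup>2"
          using C by (simp add: power_divide diff_divide_distrib)
        then show ?thesis using C by (simp add: s_def real_sqrt_divide)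
      qed
      have dS: "((\<lambda>u. sqrt (C\<^sup>2 - (cos u)\<^sup>2)) has_real_derivative inverse s / 2 * (2 * (cos u * sin u))) (at u)"
        unfolding s_def using sq_pos[OF u] by (auto intro!: derivative_eq_intros simp: divide_simps)
      have dA: "((\<lambda>u. arcsin (cos u / C)) has_real_derivative inverse (s / C) * (- sin u / C)) (at u)"
      proof (rule DERIV_cong[OF DERIV_chain2[OF DERIV_arcsin]])
        show "((\<lambda>u. cos u / C) has_real_derivative - sin u / C) (at u)"
          using C by (auto intro!: derivative_eq_intros)
        show "-1 < cos u / C" using cos_lt[OF u] C order_less_le_trans[of "-1" 0 "cos u / C"] by simp
        show "cos u / C < 1" using cos_lt[OF u] C by simp
      qed (simp add: s1)
      have "(A has_real_derivative - (1/2) * ((- sin u * s + inverse s / 2 * (2 * (cos u * sin u)) * cos u)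
           + C\<^sup>2 * (inverse (s / C) * (- sin u / C)))) (at u)"
        unfolding A_def s_def
        by (rule DERIV_cmult[OF DERIV_add[OF DERIV_mult[OF DERIV_cos dS[unfolded s_def]] DERIV_cmult[OF dA[unfolded s_def]]]])
      moreover have "- (1/2) * ((- sin u * s + inverse s / 2 * (2 * (cos u * sin u)) * cos u)
           + C\<^sup>2 * (inverse (s / C) * (- sin u / C))) = s * sin u"
      proof -
        have "- (1/2) * ((- sin u * s + inverse s / 2 * (2 * (cos u * sin u)) * cos u)
           + C\<^sup>2 * (inverse (s / C) * (- sin u / C))) = (1/2) * sin u * (s\<^sup>2 - (cos u)\<^sup>2 + C\<^sup>2) / s"
          using s(1) C by (simp add: field_simps power2_eq_square)
        also have "\<dots> = s * sin u" proof -
          have "s\<^sup>2 - (cos u)\<^sup>2 + C\<^sup>2 = 2 * s\<^sup>2" using s(2) by simp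
          then show ?thesis using s(1) by (simp only:) (simp add: power2_eq_square)
        qed
        finally show ?thesis .
      qed
      ultimately show "(A has_vector_derivative sqrt (C\<^sup>2 - (cos u)\<^sup>2) * sin u) (at u)"
        by (simp add: has_real_derivative_iff_has_vector_derivative s_def)
    qed (use d in auto)
    moreover have "A (pi / 2) - A d = C\<^sup>2 * (pi / 4)"
      using C by (simp add: A_def C_def[symmetric])
    ultimately show ?thesis by simp
  qed
  show ?thesis unfolding C_def[symmetric]
  proof (induction i)
    case 0
    then show ?case using base by (simp add: power2_eq_square)
  next
    case (Suc i)
    define f where "f i u = sqrt (C\<^sup>2 - (cos u)\<^sup>2) * sin u * cos u ^ (2 * i)" for i u
    define A where "A u = (C\<^sup>2 - (cos u)\<^sup>2) * sqrt (C\<^sup>2 - (cos u)\<^sup>2) * cos u ^ (2 * i + 1)" for u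
    have "((\<lambda>u. (2 * real i + 4) * f (Suc i) u - (2 * real i + 1) * C\<^sup>2 * f i u) has_integral (A (pi / 2) - A d)) {d..pi / 2}"
    proof (rule fundamental_theorem_of_calculus_interior)
      show "continuous_on {d..pi / 2} A"
        unfolding A_def by (intro continuous_intros)
      fix u assume u: "u \<in> {d<..<pi/2}"
      define s where "s = sqrt (C\<^sup>2 - (cos u)\<^sup>2)"
      have s: "s > 0" "s\<^sup>2 = C\<^sup>2 - (cos u)\<^sup>2" using sq_pos[OF u] by (simp_all add: s_def)
      have dS: "((\<lambda>u. sqrt (C\<^sup>2 - (cos u)\<^sup>2)) has_real_derivative cos u * sin u / s) (at u)"
        unfolding s_def using sq_pos[OF u] by (auto intro!: derivative_eq_intros simp: divide_simps)
      have d1: "((\<lambda>u. C\<^sup>2 - (cos u)\<^sup>2) has_real_derivative 2 * cos u * sin u) (at u)"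
        by (auto intro!: derivative_eq_intros)
      have d3: "((\<lambda>u. cos u ^ (2 * i + 1)) has_real_derivative (2 * real i + 1) * cos u ^ (2 * i) * (- sin u)) (at u)"
        by (rule DERIV_cong[OF DERIV_power[OF DERIV_cos]]) simp
      have "(A has_real_derivative
          ((2 * cos u * sin u) * s + cos u * sin u / s * (C\<^sup>2 - (cos u)\<^sup>2)) * cos u ^ (2 * i + 1) +
          (2 * real i + 1) * cos u ^ (2 * i) * (- sin u) * ((C\<^sup>2 - (cos u)\<^sup>2) * s)) (at u)"
        unfolding A_def s_def by (rule DERIV_mult[OF DERIV_mult[OF d1 dS[unfolded s_def]] d3])
      moreover have "((2 * cos u * sin u) * s + cos u * sin u / s * (C\<^sup>2 - (cos u)\<^sup>2)) * cos u ^ (2 * i + 1) +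
          (2 * real i + 1) * cos u ^ (2 * i) * (- sin u) * ((C\<^sup>2 - (cos u)\<^sup>2) * s)
        = (2 * real i + 4) * f (Suc i) u - (2 * real i + 1) * C\<^sup>2 * f i u"
      proof -
        have "cos u * sin u / s * (C\<^sup>2 - (cos u)\<^sup>2) = s * cos u * sin u"
          unfolding s(2)[symmetric] using s(1) by (simp add: power2_eq_square)
        then show ?thesis unfolding f_def s_def[symmetric]
          by (simp add: algebra_simps power2_eq_square)
      qed
      ultimately show "(A has_vector_derivative (2 * real i + 4) * f (Suc i) u - (2 * real i + 1) * C\<^sup>2 * f i u) (at u)"
        by (simp add: has_real_derivative_iff_has_vector_derivative)
    qed (use d in auto)
    moreover have "A (pi / 2) - A d = 0" by (simp add: A_def C_def)
    ultimately have "((\<lambda>u. (2 * real i + 4) * f (Suc i) u - (2 * real i + 1) * C\<^sup>2 * f i u) has_integral 0) {d..pi / 2}" by simp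
    from has_integral_add[OF this has_integral_mult_right[OF Suc.IH, of "(2 * real i + 1) * C\<^sup>2"]]
    have "((\<lambda>u. (2 * real i + 4) * f (Suc i) u) has_integral ((2 * real i + 1) * C\<^sup>2 * (C ^ (2 * i + 2) * halfbeta i))) {d..pi / 2}"
      by (simp add: f_def)
    from has_integral_mult_right[OF this, of "1 / (2 * real i + 4)"]
    moreover have "1 / (2 * real i + 4) * ((2 * real i + 4) * f (Suc i) u) = f (Suc i) u" for u
    proof -
      have "2 * real i + 4 \<noteq> 0" by linarith
      then show ?thesis by simp
    qed
    moreover have "1 / (2 * real i + 4) * ((2 * real i + 1) * C\<^sup>2 * (C ^ (2 * i + 2) * halfbeta i)) = C ^ (2 * Suc i + 2) * halfbeta (Suc i)"
      by (simp add: power2_eq_square)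
    ultimately have "(f (Suc i) has_integral C ^ (2 * Suc i + 2) * halfbeta (Suc i)) {d..pi / 2}" by (simp only:)
    then show ?case unfolding f_def .
  qed
qed

text \<open>
  Multiplication by \<open>halfbeta i\<close> transforms the recurrence \<open>cheb_deriv_rec\<close> of the coefficients of the
  differentiated Chebyshev polynomial into \<open>zonal_coeff_rec\<close>.
\<close>

lemma cheb_deriv_half_beta:
  assumes "i \<le> l"
  shows "coeff (cheb_deriv (2 * n + 1) (2 * l + 2 * n + 1)) (2 * i) * halfbeta i = 2 ^ (2 * n) * (pi / 4) * zonal_weight n l * zonal_coeff n l i"
proof -
  define K where "K = 2 ^ (2 * n) * (pi / 4) * zonal_weight n l"
  define q where "q i = coeff (cheb_deriv (2 * n + 1) (2 * l + 2 * n + 1)) (2 * i)" for i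
  have "q i * halfbeta i - K * zonal_coeff n l i = 0"
  proof (rule eigen_coeffs_unique[of l n "\<lambda>i. q i * halfbeta i - K * zonal_coeff n l i" i])
    fix i assume "i < l"
    have "(2 * real i + 1) * (2 * real i + 2) * q (Suc i) = - (eigval n l - eigval n i) * q i"
      using cheb_deriv_rec[of "2 * i" "2 * n + 1" "2 * l + 2 * n + 1"] unfolding q_def
      by (simp add: eigval_def algebra_simps power2_eq_square)
    then have e: "(eigval n l - eigval n i) * q i = - ((2 * real i + 1) * (2 * real i + 2) * q (Suc i))" by (simp add: algebra_simps)
    have nz: "2 * real i + 4 \<noteq> 0" by linarith
    have "(eigval n l - eigval n i) * (q i * halfbeta i) = - ((2 * real i + 1) * (2 * real i + 2) * q (Suc i)) * halfbeta i"
      unfolding e[symmetric] by simp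
    also have "\<dots> = - 4 * (real i + 1) * (real i + 2) * (q (Suc i) * halfbeta (Suc i))"
      using nz by (simp add: divide_simps) (simp add: algebra_simps)
    finally have "(eigval n l - eigval n i) * (q i * halfbeta i) + 4 * (real i + 1) * (real i + 2) * (q (Suc i) * halfbeta (Suc i)) = 0"
      by (simp only: mult_minus_left)
    moreover have "K * ((eigval n l - eigval n i) * zonal_coeff n l i + 4 * (real i + 1) * (real i + 2) * zonal_coeff n l (Suc i)) = 0"
      unfolding zonal_coeff_rec by simp
    moreover have "X * (a - K * b) + c * (a' - K * b') = (X * a + c * a') - K * (X * b + c * b')" for X a b c a' b' :: real
      by (simp add: algebra_simps)
    ultimately show "(eigval n l - eigval n i) * (q i * halfbeta i - K * zonal_coeff n l i) +
        4 * (real i + 1) * (real i + 2) * (q (Suc i) * halfbeta (Suc i) - K * zonal_coeff n l (Suc i)) = 0"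
      by (simp only: diff_zero)
  next
    define A B D E F :: real where "A = fact (2 * l)" and "B = fact l" and "D = fact (l + 1)"
      and "E = fact (2 * l + 2 * n + 1)" and "F = fact (l + 2 * n)"
    have nz: "A \<noteq> 0" "B \<noteq> 0" "D \<noteq> 0" "F \<noteq> 0" by (simp_all add: A_def B_def D_def F_def)
    have e: "2 * l + 2 * n + 1 = 2 * l + (2 * n + 1)" "1 + real (2 * l) = real (2 * l) + 1" by simp_all
    have "E = A * pochhammer (real (2 * l) + 1) (2 * n + 1)"
      unfolding A_def E_def pochhammer_fact e(1) pochhammer_product' e(2) of_nat_1 ..
    then have ph: "pochhammer (real (2 * l) + 1) (2 * n + 1) = E / A" using nz by simp
    have c: "coeff (cheb (2 * l + 2 * n + 1)) (2 * l + (2 * n + 1)) = 4 ^ l * 2 ^ (2 * n)"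
      using lead_coeff_cheb[of "2 * l + 2 * n"] by (simp add: power_add power_mult)
    have q: "q l = E / A * (4 ^ l * 2 ^ (2 * n))"
      unfolding q_def coeff_cheb_deriv ph c ..
    have h: "halfbeta l = pi / 4 * A / (4 ^ l * B * D)" unfolding halfbeta_closed A_def B_def D_def ..
    have E2: "E = real (2 * l + 2 * n + 1) * fact (l + l + 2 * n)"
    proof -
      have e: "2 * l + 2 * n + 1 = Suc (l + l + 2 * n)" by simp
      show ?thesis unfolding E_def e fact_Suc by simp
    qed
    have j: "K * zonal_coeff n l l = 2 ^ (2 * n) * (pi / 4) * (real (2 * l + 2 * n + 1) * (F / D)) * (D * fact (l + l + 2 * n) / (B * D * F))"
      unfolding K_def zonal_coeff_def zonal_weight_def B_def D_def F_def by (simp del: fact_Suc)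
    show "q l * halfbeta l - K * zonal_coeff n l l = 0"
      unfolding q h j E2 using nz by (simp add: divide_simps)
  qed (use assms in auto)
  then show ?thesis by (simp add: q_def K_def)
qed

text \<open>
  The polynomial \<open>T\<^sub>M\<close> has the parity of \<open>M = 2 l + 2 n + 1\<close>, so its derivative of order \<open>2 n + 1\<close> is even
  and has degree \<open>2 l\<close>.
\<close>

lemma poly_cheb_deriv_even:
  "poly (cheb_deriv (2 * n + 1) (2 * l + 2 * n + 1)) c = (\<Sum>i\<le>l. coeff (cheb_deriv (2 * n + 1) (2 * l + 2 * n + 1)) (2 * i) * c ^ (2 * i))"
proof -
  define P where "P = cheb_deriv (2 * n + 1) (2 * l + 2 * n + 1)"
  have z: "coeff P k = 0" if "k > 2 * l \<or> odd k" for k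
    using that unfolding P_def coeff_cheb_deriv by (subst coeff_cheb_eq_0) auto
  have "poly P c = (\<Sum>k\<in>{..2 * l}. coeff P k * c ^ k)"
    unfolding poly_altdef
    by (rule sum.mono_neutral_left) (use z in \<open>auto simp: coeff_eq_0 intro: degree_le\<close>)
  also have "\<dots> = (\<Sum>k\<in>(\<lambda>i. 2 * i) ` {..l}. coeff P k * c ^ k)"
  proof (rule sum.mono_neutral_right)
    show "\<forall>i\<in>{..2 * l} - (\<lambda>i. 2 * i) ` {..l}. coeff P i * c ^ i = 0"
    proof
      fix i assume i: "i \<in> {..2 * l} - (\<lambda>i. 2 * i) ` {..l}"
      have "odd i" proof
        assume "even i"
        then obtain j where "i = 2 * j" by (elim evenE)
        then show False using i by auto
      qed
      then show "coeff P i * c ^ i = 0" using z by simp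
    qed
  qed auto
  also have "\<dots> = (\<Sum>i\<le>l. coeff P (2 * i) * c ^ (2 * i))"
    by (subst sum.reindex) (auto simp: inj_on_def)
  finally show ?thesis unfolding P_def .
qed

lemma cheb_deriv_zonal_integral:
  assumes d: "0 \<le> d" "d < pi / 2"
  shows "((\<lambda>u. sqrt ((cos d)\<^sup>2 - (cos u)\<^sup>2) / (cos d)\<^sup>2 * (sin u * poly (cheb_deriv (2 * n + 1) (2 * l + 2 * n + 1)) (cos u)))
     has_integral 2 ^ (2 * n) * (pi / 4) * zonal_weight n l * zonal n l ((cos d)\<^sup>2)) {d..pi / 2}"
proof -
  define q where "q i = coeff (cheb_deriv (2 * n + 1) (2 * l + 2 * n + 1)) (2 * i)" for i
  have C: "cos d > 0" using d by (intro cos_gt_zero_pi) auto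
  have "((\<lambda>u. \<Sum>i\<le>l. q i / (cos d)\<^sup>2 * (sqrt ((cos d)\<^sup>2 - (cos u)\<^sup>2) * sin u * cos u ^ (2 * i)))
     has_integral (\<Sum>i\<le>l. q i / (cos d)\<^sup>2 * ((cos d) ^ (2 * i + 2) * halfbeta i))) {d..pi / 2}"
    by (intro has_integral_sum has_integral_mult_right halfbeta_integral d) simp
  moreover have "(\<Sum>i\<le>l. q i / (cos d)\<^sup>2 * (sqrt ((cos d)\<^sup>2 - (cos u)\<^sup>2) * sin u * cos u ^ (2 * i)))
    = sqrt ((cos d)\<^sup>2 - (cos u)\<^sup>2) / (cos d)\<^sup>2 * (sin u * poly (cheb_deriv (2 * n + 1) (2 * l + 2 * n + 1)) (cos u))" for u
    unfolding poly_cheb_deriv_even q_def sum_distrib_left by (intro sum.cong refl) (simp add: mult_ac)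
  moreover have "(\<Sum>i\<le>l. q i / (cos d)\<^sup>2 * ((cos d) ^ (2 * i + 2) * halfbeta i)) = 2 ^ (2 * n) * (pi / 4) * zonal_weight n l * zonal n l ((cos d)\<^sup>2)"
    unfolding zonal_def sum_distrib_left
  proof (intro sum.cong refl)
    fix i assume "i \<in> {..l}"
    then have "q i * halfbeta i = 2 ^ (2 * n) * (pi / 4) * zonal_weight n l * zonal_coeff n l i"
      unfolding q_def by (intro cheb_deriv_half_beta) simp
    moreover have "q i / (cos d)\<^sup>2 * ((cos d) ^ (2 * i + 2) * halfbeta i) = (q i * halfbeta i) * ((cos d)\<^sup>2) ^ i"
      using C by (simp add: power_add power_mult power2_eq_square[of "cos d"] power_mult_distrib)
    ultimately show "q i / (cos d)\<^sup>2 * ((cos d) ^ (2 * i + 2) * halfbeta i)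
       = 2 ^ (2 * n) * (pi / 4) * zonal_weight n l * (zonal_coeff n l i * ((cos d)\<^sup>2) ^ i)" by simp
  qed
  ultimately show ?thesis by (simp only:)
qed

section \<open>Termwise integration of the Chebyshev series\<close>

definition cheb_deriv_bound :: "nat \<Rightarrow> nat \<Rightarrow> real" where
  "cheb_deriv_bound m M = (real M + 1) * (real M + real m) ^ m * 3 ^ M"

lemma abs_poly_cheb_deriv_le:
  assumes "\<bar>c\<bar> \<le> 1"
  shows "\<bar>poly (cheb_deriv m M) c\<bar> \<le> cheb_deriv_bound m M"
proof -
  have z: "coeff (cheb_deriv m M) k = 0" if "k > M" for k
    using that unfolding coeff_cheb_deriv by (subst coeff_cheb_eq_0) auto
  have "poly (cheb_deriv m M) c = (\<Sum>k\<in>{..M}. coeff (cheb_deriv m M) k * c ^ k)"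
    unfolding poly_altdef
    by (rule sum.mono_neutral_left) (use z in \<open>auto simp: coeff_eq_0 intro: degree_le\<close>)
  also have "\<bar>\<dots>\<bar> \<le> (\<Sum>k\<in>{..M}. (real M + real m) ^ m * 3 ^ M)"
  proof (rule order_trans[OF sum_abs sum_mono])
    fix k assume k: "k \<in> {..M}"
    have "pochhammer (real k + 1) m \<le> (real M + real m) ^ m"
    proof -
      have "pochhammer (real k + 1) m = (\<Prod>i = 0..<m. real k + 1 + real i)" by (rule pochhammer_prod)
      also have "\<dots> \<le> (\<Prod>i = 0..<m. real M + real m)"
        using k by (intro prod_mono) auto
      finally show ?thesis by simp
    qed
    moreover have "0 \<le> pochhammer (real k + 1) m" by (intro pochhammer_nonneg) simp
    ultimately have "\<bar>coeff (cheb_deriv m M) k\<bar> \<le> (real M + real m) ^ m * 3 ^ M"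
      unfolding coeff_cheb_deriv abs_mult by (intro mult_mono abs_coeff_cheb_le) auto
    moreover have "\<bar>c ^ k\<bar> \<le> 1" unfolding power_abs using assms by (intro power_le_one) auto
    ultimately have "\<bar>coeff (cheb_deriv m M) k\<bar> * \<bar>c ^ k\<bar> \<le> (real M + real m) ^ m * 3 ^ M * 1"
      by (intro mult_mono) auto
    then show "\<bar>coeff (cheb_deriv m M) k * c ^ k\<bar> \<le> (real M + real m) ^ m * 3 ^ M" by (simp add: abs_mult)
  qed
  finally show ?thesis by (simp add: cheb_deriv_bound_def mult_ac add_ac)
qed

definition gauss_wt :: "nat \<Rightarrow> real \<Rightarrow> nat \<Rightarrow> real" where
  "gauss_wt n t l = exp (- 4 * t * (real l + real n + 1 / 2)\<^sup>2)"

lemma summable_gauss_cheb_deriv_bound: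
  assumes t: "t > 0"
  shows "summable (\<lambda>l. gauss_wt n t l * cheb_deriv_bound m (2 * l + 2 * n + 1))"
proof (rule summable_comparison_test_ev)
  show "summable (\<lambda>l. (1 / 2) ^ l :: real)" by (simp add: summable_geometric)
  have "((\<lambda>l. gauss_wt n t l * cheb_deriv_bound m (2 * l + 2 * n + 1) * 2 ^ l) \<longlongrightarrow> 0) sequentially"
  proof -
    have "((\<lambda>l::nat. exp (- 4 * t * (real l + real n + 1 / 2)\<^sup>2) *
       ((2 * real l + 2 * real n + 2) * (2 * real l + 2 * real n + 1 + real m) ^ m * 3 ^ (2 * l + 2 * n + 1)) * 2 ^ l) \<longlongrightarrow> 0) sequentially"
      using t by real_asymp
    then show ?thesis by (simp add: gauss_wt_def cheb_deriv_bound_def add_ac)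
  qed
  then have "eventually (\<lambda>l. gauss_wt n t l * cheb_deriv_bound m (2 * l + 2 * n + 1) * 2 ^ l < 1) sequentially"
    by (rule order_tendstoD) simp
  then show "eventually (\<lambda>l. norm (gauss_wt n t l * cheb_deriv_bound m (2 * l + 2 * n + 1)) \<le> (1 / 2) ^ l) sequentially"
  proof eventually_elim
    case (elim l)
    have "0 \<le> gauss_wt n t l * cheb_deriv_bound m (2 * l + 2 * n + 1)"
      unfolding gauss_wt_def cheb_deriv_bound_def by simp
    then show ?case using elim by (simp add: field_simps)
  qed
qed

text \<open>
  The series in the first representation, differentiated \<open>m\<close> times with respect to \<open>c = cos u\<close>.
\<close>

definition cheb_series :: "nat \<Rightarrow> real \<Rightarrow> nat \<Rightarrow> real \<Rightarrow> real" where
  "cheb_series n t m c = (\<Sum>l. gauss_wt n t l * poly (cheb_deriv m (2 * l + 2 * n + 1)) c)"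

lemma norm_cheb_term_le:
  "\<bar>c\<bar> \<le> 1 \<Longrightarrow> norm (gauss_wt n t l * poly (cheb_deriv m M) c) \<le> gauss_wt n t l * cheb_deriv_bound m M"
  using abs_poly_cheb_deriv_le[of c m M] by (simp add: abs_mult gauss_wt_def)

lemma DERIV_cheb_series:
  assumes t: "t > 0" and c: "\<bar>c\<bar> < 1"
  shows "(cheb_series n t m has_real_derivative cheb_series n t (Suc m) c) (at c)"
proof -
  have "((\<lambda>c. \<Sum>l. gauss_wt n t l * poly (cheb_deriv m (2 * l + 2 * n + 1)) c) has_real_derivative
     (\<Sum>l. gauss_wt n t l * poly (cheb_deriv (Suc m) (2 * l + 2 * n + 1)) c)) (at c)"
  proof (rule has_field_derivative_series'(2)[of "{-1<..<1}" _ _ 0])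
    show "((\<lambda>c. gauss_wt n t l * poly (cheb_deriv m (2 * l + 2 * n + 1)) c) has_real_derivative
        gauss_wt n t l * poly (cheb_deriv (Suc m) (2 * l + 2 * n + 1)) x) (at x within {-1<..<1})" for l x
      unfolding cheb_deriv_def funpow.simps comp_apply
      by (rule DERIV_cmult[OF has_field_derivative_at_within[OF poly_DERIV]])
    show "uniformly_convergent_on {-1<..<1} (\<lambda>k x. \<Sum>l<k. gauss_wt n t l * poly (cheb_deriv (Suc m) (2 * l + 2 * n + 1)) x)"
      by (rule Weierstrass_m_test'[OF _ summable_gauss_cheb_deriv_bound[OF t]]) (rule norm_cheb_term_le, auto)
    show "summable (\<lambda>l. gauss_wt n t l * poly (cheb_deriv m (2 * l + 2 * n + 1)) 0)"
      by (rule summable_comparison_test[OF _ summable_gauss_cheb_deriv_bound[OF t, of n m]]) (intro exI allI impI norm_cheb_term_le, simp)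
  qed (use c in \<open>auto simp: interior_open\<close>)
  then show ?thesis unfolding cheb_series_def[abs_def] .
qed

text \<open>
  For \<open>c = cos u\<close> the operator \<open>- (1 / sin u) d/du\<close> is differentiation with respect to \<open>c\<close>.
\<close>

lemma neg_csc_deriv_iterate:
  assumes t: "t > 0" and "0 < u" "u < pi"
  shows "(neg_csc_deriv ^^ m) (\<lambda>v. \<Sum>l. gauss_wt n t l * cos (real (2 * l + 2 * n + 1) * v)) u = cheb_series n t m (cos u)"
  using assms(2,3)
proof (induction m arbitrary: u)
  case 0
  show ?case by (simp only: funpow.simps id_apply cheb_series_def cheb_deriv_def poly_cheb_cos)
next
  case (Suc m)
  define g where "g = (neg_csc_deriv ^^ m) (\<lambda>v. \<Sum>l. gauss_wt n t l * cos (real (2 * l + 2 * n + 1) * v))"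
  have su: "sin u > 0" using Suc.prems by (intro sin_gt_zero) auto
  then have cu: "\<bar>cos u\<bar> < 1"
  proof -
    have "(cos u)\<^sup>2 < 1" using su by (simp add: cos_squared_eq)
    then show ?thesis by (simp add: abs_square_less_1)
  qed
  have "eventually (\<lambda>v. v \<in> {0<..<pi}) (nhds u)"
    using Suc.prems by (intro eventually_nhds_in_open) auto
  then have ev: "eventually (\<lambda>v. g v = cheb_series n t m (cos v)) (nhds u)"
    by eventually_elim (unfold g_def, rule Suc.IH, auto)
  have "((\<lambda>v. cheb_series n t m (cos v)) has_real_derivative cheb_series n t (Suc m) (cos u) * (- sin u)) (at u)"
    by (rule DERIV_chain2[OF DERIV_cheb_series[OF t cu] DERIV_cos])
  then have "deriv (\<lambda>v. cheb_series n t m (cos v)) u = cheb_series n t (Suc m) (cos u) * (- sin u)"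
    by (rule DERIV_imp_deriv)
  then have "deriv g u = cheb_series n t (Suc m) (cos u) * (- sin u)"
    using deriv_cong_ev[OF ev refl] by simp
  then have "neg_csc_deriv g u = cheb_series n t (Suc m) (cos u)" using su by (simp add: neg_csc_deriv_def)
  then show ?case by (simp only: g_def funpow.simps comp_apply)
qed

text \<open>
  At \<open>u = 0\<close> the factor \<open>sin u\<close> makes both sides vanish, whatever value the limit in \<open>neg_csc_deriv\<close>
  has there.
\<close>

lemma hp_Psi_eq:
  assumes "t > 0" "0 \<le> u" "u < pi"
  shows "hp_Psi n t u = sin u * cheb_series n t (2 * n + 1) (cos u)"
proof (cases "u = 0")
  case False
  then show ?thesis
    unfolding hp_Psi_def gauss_wt_def[symmetric] using assms by (subst neg_csc_deriv_iterate) auto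
qed (simp add: hp_Psi_def)

text \<open>
  The weight \<open>sqrt (cos\<^sup>2 d - cos\<^sup>2 u) sin u / cos\<^sup>2 d\<close> is bounded by \<open>1 / cos d\<close>, so the series of
  integrands converges uniformly and may be integrated term by term.
\<close>

lemma hp_Psi_integral:
  assumes t: "t > 0" and d: "0 \<le> d" "d < pi / 2"
  shows "((\<lambda>u. sqrt ((cos d)\<^sup>2 - (cos u)\<^sup>2) / (cos d)\<^sup>2 * hp_Psi n t u) has_integral
     2 ^ (2 * n) * (pi / 4) * (\<Sum>l. zonal_weight n l * gauss_wt n t l * zonal n l ((cos d)\<^sup>2))) {d..pi / 2}"
proof -
  define w where "w u = sqrt ((cos d)\<^sup>2 - (cos u)\<^sup>2) / (cos d)\<^sup>2 * sin u" for u
  define p where "p l u = gauss_wt n t l * poly (cheb_deriv (2 * n + 1) (2 * l + 2 * n + 1)) (cos u)" for l u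
  define f where "f k u = (\<Sum>l<k. w u * p l u)" for k u
  have C: "cos d > 0" using d by (intro cos_gt_zero_pi) auto
  have w: "\<bar>w u\<bar> \<le> 1 / cos d" if u: "u \<in> {d..pi/2}" for u
  proof -
    have "0 \<le> cos u" "cos u \<le> cos d" using u d by (auto intro!: cos_ge_zero cos_monotone_0_pi_le)
    then have le: "(cos u)\<^sup>2 \<le> (cos d)\<^sup>2" by (intro power_mono)
    have "sqrt ((cos d)\<^sup>2 - (cos u)\<^sup>2) \<le> cos d" using C by (intro real_le_lsqrt) auto
    then have "sqrt ((cos d)\<^sup>2 - (cos u)\<^sup>2) * \<bar>sin u\<bar> \<le> cos d * 1"
      using C by (intro mult_mono) auto
    then have "sqrt ((cos d)\<^sup>2 - (cos u)\<^sup>2) * \<bar>sin u\<bar> / (cos d)\<^sup>2 \<le> cos d * 1 / (cos d)\<^sup>2"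
      by (intro divide_right_mono) auto
    then show ?thesis unfolding w_def using le C by (simp add: abs_mult power2_eq_square)
  qed
  have p: "\<bar>p l u\<bar> \<le> gauss_wt n t l * cheb_deriv_bound (2 * n + 1) (2 * l + 2 * n + 1)" for l u
    unfolding p_def using norm_cheb_term_le[of "cos u"] by simp
  have ul: "uniform_limit {d..pi/2} f (\<lambda>u. \<Sum>l. w u * p l u) sequentially"
    unfolding f_def
  proof (rule Weierstrass_m_test)
    show "summable (\<lambda>l. 1 / cos d * (gauss_wt n t l * cheb_deriv_bound (2 * n + 1) (2 * l + 2 * n + 1)))"
      by (intro summable_mult summable_gauss_cheb_deriv_bound t)
    show "norm (w u * p l u) \<le> 1 / cos d * (gauss_wt n t l * cheb_deriv_bound (2 * n + 1) (2 * l + 2 * n + 1))"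
      if "u \<in> {d..pi/2}" for l u
      unfolding norm_mult real_norm_def abs_mult using w[OF that] p C by (intro mult_mono) auto
  qed
  have cont: "continuous_on {d..pi/2} (f k)" for k
    unfolding f_def w_def p_def using C by (intro continuous_intros) auto
  obtain I J where I: "\<And>k. (f k has_integral I k) {d..pi/2}"
    and J: "((\<lambda>u. \<Sum>l. w u * p l u) has_integral J) {d..pi/2}" and IJ: "I \<longlonglongrightarrow> J"
    by (rule uniform_limit_integral[OF ul cont sequentially_bot]) (rule that)
  define z where "z l = 2 ^ (2 * n) * (pi / 4) * (zonal_weight n l * gauss_wt n t l * zonal n l ((cos d)\<^sup>2))" for l
  have Iz: "I k = (\<Sum>l<k. z l)" for k
  proof (rule has_integral_unique[OF I])
    have "((\<lambda>u. \<Sum>l<k. gauss_wt n t l * (sqrt ((cos d)\<^sup>2 - (cos u)\<^sup>2) / (cos d)\<^sup>2 * (sin u * poly (cheb_deriv (2 * n + 1) (2 * l + 2 * n + 1)) (cos u))))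
       has_integral (\<Sum>l<k. gauss_wt n t l * (2 ^ (2 * n) * (pi / 4) * zonal_weight n l * zonal n l ((cos d)\<^sup>2)))) {d..pi/2}"
      by (intro has_integral_sum has_integral_mult_right cheb_deriv_zonal_integral d) simp
    then show "(f k has_integral (\<Sum>l<k. z l)) {d..pi/2}"
      by (simp add: f_def[abs_def] w_def p_def z_def mult_ac)
  qed
  have zJ: "z sums J" using IJ unfolding Iz sums_def .
  have sm: "summable (\<lambda>l. zonal_weight n l * gauss_wt n t l * zonal n l ((cos d)\<^sup>2))"
    using summable_mult[OF sums_summable[OF zJ], of "1 / (2 ^ (2 * n) * (pi / 4))"] by (simp add: z_def mult.assoc)
  have J': "J = 2 ^ (2 * n) * (pi / 4) * (\<Sum>l. zonal_weight n l * gauss_wt n t l * zonal n l ((cos d)\<^sup>2))"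
    by (rule sums_unique2[OF zJ[unfolded z_def[abs_def]] sums_mult[OF summable_sums[OF sm]]])
  show ?thesis
  proof (rule has_integral_eq[OF _ J[unfolded J']])
    fix u assume u: "u \<in> {d..pi/2}"
    then have "u < pi" using pi_gt_zero by (simp only: atLeastAtMost_iff) linarith
    then have psi: "hp_Psi n t u = sin u * (\<Sum>l. p l u)"
      using u d hp_Psi_eq[OF t, of u n] by (simp add: cheb_series_def p_def)
    have "summable (\<lambda>l. p l u)"
      by (rule summable_comparison_test[OF _ summable_gauss_cheb_deriv_bound[OF t, of n "2 * n + 1"]]) (intro exI allI impI, unfold real_norm_def, rule p)
    then show "(\<Sum>l. w u * p l u) = sqrt ((cos d)\<^sup>2 - (cos u)\<^sup>2) / (cos d)\<^sup>2 * hp_Psi n t u"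
      unfolding psi by (subst suminf_mult) (simp_all add: w_def)
  qed
qed

section \<open>The Fubini-Study metric in affine coordinates\<close>

text \<open>
  The quaternion units and the coordinates with respect to them, indexed in the same way as the affine
  coordinates. In the type \<^typ>\<open>4\<close> the numerals \<open>0\<close> and \<open>4\<close> denote the same element.
\<close>

definition qe :: "4 \<Rightarrow> quat" where
  "qe c = Quat (if c = 0 then 1 else 0) (if c = 1 then 1 else 0) (if c = 2 then 1 else 0) (if c = 3 then 1 else 0)"

definition qc :: "4 \<Rightarrow> quat \<Rightarrow> real" where
  "qc c q = (if c = 0 then qRe q else if c = 1 then qI q else if c = 2 then qJ q else qK q)"

lemma four_eq_zero: "(4::4) = 0"
  by simp

lemma sum_four: "(\<Sum>c\<in>UNIV. f (c::4)) = f 0 + f 1 + f 2 + f 3"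
  unfolding sum_4 four_eq_zero by (simp add: ac_simps)

lemma all_four: "(\<forall>c::4. P c) \<longleftrightarrow> P 0 \<and> P 1 \<and> P 2 \<and> P 3"
  unfolding forall_4 four_eq_zero by auto

lemma four_cases: "c = 0 \<or> c = 1 \<or> c = 2 \<or> c = (3::4)"
  using all_four[of "\<lambda>c. c = 0 \<or> c = 1 \<or> c = 2 \<or> c = (3::4)"] by auto

lemma quat_eqI4: "(\<And>c. qc c p = qc c q) \<Longrightarrow> p = q"
  unfolding quat_eq_iff using all_four[of "\<lambda>c. qc c p = qc c q"] by (simp add: qc_def)

lemma qc_quat_coord [simp]: "qc c (quat_coord v k) = v $ (k, c)"
  using all_four[of "\<lambda>c. qc c (quat_coord v k) = v $ (k, c)"] by (simp add: qc_def quat_coord_def)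

lemma qc_qe: "qc c (qe d) = (if c = d then 1 else 0)"
  using four_cases[of c] four_cases[of d] by (elim disjE) (simp_all add: qc_def qe_def)

lemma qc_add [simp]: "qc c (p + q) = qc c p + qc c q"
  and qc_scaleR [simp]: "qc c (r *\<^sub>R p) = r * qc c p"
  and qc_minus [simp]: "qc c (- p) = - qc c p"
  and qc_0 [simp]: "qc c 0 = 0"
  by (simp_all add: qc_def plus_quat_def scaleR_quat_def uminus_quat_def zero_quat_def)

lemma qc_sum: "qc c (sum f A) = (\<Sum>x\<in>A. qc c (f x))"
  by (induction A rule: infinite_finite_induct) auto

lemma quat_coord_add: "quat_coord (v + w) k = quat_coord v k + quat_coord w k"
  and quat_coord_scaleR: "quat_coord (r *\<^sub>R v) k = r *\<^sub>R quat_coord v k"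
  and quat_coord_0: "quat_coord 0 k = 0"
  by (rule quat_eqI4, simp)+

lemma norm_quat_sq_qc: "(norm q)\<^sup>2 = (\<Sum>c\<in>UNIV. (qc c q)\<^sup>2)"
  by (simp add: norm_quat_sq sum_four qc_def)

lemma norm_qe: "norm (qe c) = 1"
proof -
  have "(norm (qe c))\<^sup>2 = 1" unfolding norm_quat_sq_qc qc_qe by (simp add: if_distrib[of "\<lambda>z. z\<^sup>2"] cong: if_cong)
  then show ?thesis by (simp add: power2_eq_1_iff) (metis norm_ge_zero neg_0_le_iff_le not_one_le_zero)
qed

lemma qe_0: "qe 0 = 1"
  by (simp add: qe_def one_quat_def)

lemma qRe_cnj_mult: "qRe (qcnj p * q) = (\<Sum>c\<in>UNIV. qc c p * qc c q)"
  by (simp add: sum_four qc_def qcnj_def times_quat_def)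

lemma sum_pairs: "(\<Sum>a\<in>UNIV. f a) = (\<Sum>k\<in>UNIV. \<Sum>c\<in>UNIV. f (k, c))"
  for f :: "'a::finite \<times> 'b::finite \<Rightarrow> 'c::comm_monoid_add"
  by (simp add: sum.cartesian_product UNIV_Times_UNIV[symmetric] del: UNIV_Times_UNIV)

lemma qcnj_qcnj: "qcnj (qcnj q) = q"
  by (simp add: qcnj_def)

lemma qcnj_0: "qcnj 0 = 0"
  by (simp add: quat_arith_defs)

lemma qcnj_sum: "qcnj (sum f S) = (\<Sum>x\<in>S. qcnj (f x))"
proof -
  have "qcnj (p + q) = qcnj p + qcnj q" for p q by (simp add: quat_arith_defs)
  then show ?thesis by (induction S rule: infinite_finite_induct) (simp_all add: qcnj_0)
qed

lemma qRe_eq_qc: "qRe q = qc 0 q"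
  by (simp add: qc_def)

lemma abs_qc_le: "\<bar>qc c q\<bar> \<le> norm q"
proof -
  have "(qc c q)\<^sup>2 \<le> (norm q)\<^sup>2" unfolding norm_quat_sq_qc by (intro member_le_sum) auto
  then show ?thesis using abs_le_square_iff[of "qc c q" "norm q"] by simp
qed

lemma norm_quat_vec_sq: "(norm z)\<^sup>2 = (\<Sum>i\<in>UNIV. (norm (z $ i))\<^sup>2)" for z :: "quat ^ 'm::finite"
  by (simp add: norm_vec_def L2_set_def sum_nonneg)

definition qpack :: "('n \<Rightarrow> quat) \<Rightarrow> real ^ ('n::finite \<times> 4)" where
  "qpack Q = (\<chi> a. qc (snd a) (Q (fst a)))"

lemma qpack_nth [simp]: "qpack Q $ (k, c) = qc c (Q k)"
  by (simp add: qpack_def)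

lemma quat_coord_qpack [simp]: "quat_coord (qpack Q) k = Q k"
  by (rule quat_eqI4) simp

text \<open>
  Right multiplication by a quaternion on the affine coordinates. For \<open>v \<noteq> 0\<close> the vectors \<open>JJ c v\<close>
  are an orthogonal basis of the quaternionic line through \<open>v\<close>. With \<open>R = 1 + |v|\<^sup>2\<close> the metric at \<open>v\<close>
  is \<open>R\<^sup>-\<^sup>2\<close> times the Euclidean one on this line and \<open>R\<^sup>-\<^sup>1\<close> times on its orthogonal complement.
\<close>

definition rmulq :: "quat \<Rightarrow> real ^ ('n::finite \<times> 4) \<Rightarrow> real ^ ('n \<times> 4)" where
  "rmulq p v = qpack (\<lambda>k. quat_coord v k * p)"

abbreviation JJ :: "4 \<Rightarrow> real ^ ('n::finite \<times> 4) \<Rightarrow> real ^ ('n \<times> 4)" where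
  "JJ c \<equiv> rmulq (qe c)"

lemma vec4_eqI: "(\<And>k c. v $ (k, c) = w $ (k, c)) \<Longrightarrow> v = (w :: real ^ ('n::finite \<times> 4))"
  by (auto simp: vec_eq_iff)

lemma linear_rmulq: "linear (rmulq p)"
  by (rule linearI; rule vec4_eqI) (simp_all add: rmulq_def quat_coord_add quat_coord_scaleR distrib_right)

lemma rmulq_rmulq: "rmulq q (rmulq p v) = rmulq (p * q) v"
  by (simp add: rmulq_def mult.assoc)

lemma rmulq_one: "rmulq 1 v = v"
  by (rule vec4_eqI) (simp add: rmulq_def)

lemma rmulq_minus_one: "rmulq (- 1) v = - v"
  by (rule vec4_eqI) (simp add: rmulq_def)

lemma JJ_0 [simp]: "JJ 0 v = v"
  by (simp add: qe_0 rmulq_one)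

lemma inner_vec4: "v \<bullet> w = (\<Sum>k\<in>UNIV. \<Sum>c\<in>UNIV. v $ (k, c) * w $ (k, c))"
  for v w :: "real ^ ('n::finite \<times> 4)"
  by (simp add: inner_vec_def sum_pairs)

lemma qe_sq: "qe c * qe c = (if c = 0 then 1 else - 1)"
  using all_four[of "\<lambda>c. qe c * qe c = (if c = 0 then 1 else - 1)"]
  by (simp add: qe_def quat_arith_defs)

lemma JJ_JJ: "JJ c (JJ c v) = (if c = 0 then v else - v)"
  by (simp add: rmulq_rmulq qe_sq rmulq_one rmulq_minus_one)

lemma inner_JJ: "JJ c v \<bullet> JJ d v = (if c = d then v \<bullet> v else 0)"
proof -
  have "(\<Sum>e\<in>UNIV. qc e (q * qe c) * qc e (q * qe d)) = (if c = d then (\<Sum>e\<in>UNIV. qc e q * qc e q) else 0)" for q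
    using four_cases[of c] four_cases[of d] by (elim disjE) (simp_all add: sum_four qc_def qe_def times_quat_def)
  from this[of "quat_coord v k" for k] show ?thesis
    by (auto simp: inner_vec4 rmulq_def)
qed

lemma card_affine_coords: "card (UNIV :: ('n::finite \<times> 4) set) = CARD('n) * 4"
  by (simp add: card_cartesian_product UNIV_Times_UNIV[symmetric] del: UNIV_Times_UNIV)

lemma trace_JJ: "(\<Sum>a\<in>(UNIV :: ('n::finite \<times> 4) set). JJ c (axis a 1) $ a) = (if c = 0 then 4 * real CARD('n) else 0)"
proof -
  have q: "quat_coord (axis (k, e) 1) k = qe e" for k :: 'n and e
    by (rule quat_eqI4) (auto simp: axis_def qc_qe)
  have "(\<Sum>a\<in>(UNIV :: ('n \<times> 4) set). JJ c (axis a 1) $ a) = (\<Sum>k\<in>(UNIV :: 'n set). \<Sum>e\<in>UNIV. qc e (qe e * qe c))"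
    by (simp add: sum_pairs rmulq_def q)
  also have "(\<Sum>e\<in>UNIV. qc e (qe e * qe c)) = (if c = 0 then 4 else 0)"
    using all_four[of "\<lambda>c. (\<Sum>e\<in>UNIV. qc e (qe e * qe c)) = (if c = 0 then 4 else 0)"]
    by (simp add: sum_four qc_def qe_def times_quat_def)
  finally show ?thesis by simp
qed

text \<open>
  The squared norm of the homogeneous coordinates of the point with affine coordinates \<open>v\<close>; see
  \<open>norm_affine_lift_sq\<close>.
\<close>

definition rr :: "'a::real_inner \<Rightarrow> real" where
  "rr v = 1 + v \<bullet> v"

lemma rr_ge_1: "rr v \<ge> 1" by (simp add: rr_def)
lemma rr_pos: "rr v > 0" using rr_ge_1[of v] by simp

text \<open>
  The position among the homogeneous coordinates of the affine coordinate \<open>k\<close> of the chart \<open>j\<close>.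
\<close>

definition affine_idx :: "'n option \<Rightarrow> 'n \<Rightarrow> 'n option" where
  "affine_idx j k = (if j = Some k then None else Some k)"

lemma affine_idx_neq [simp]: "affine_idx j k \<noteq> j" "j \<noteq> affine_idx j k"
  by (auto simp: affine_idx_def)

lemma inj_affine_idx: "inj (affine_idx j)"
  by (auto simp: inj_def affine_idx_def split: if_splits)

lemma UNIV_affine_idx: "UNIV = insert j (range (affine_idx j))"
proof -
  have "i = j \<or> i \<in> range (affine_idx j)" for i
  proof (cases i)
    case None
    then show ?thesis by (cases j) (auto simp: affine_idx_def intro!: image_eqI)
  next
    case (Some k)
    then show ?thesis by (cases "j = Some k") (auto simp: affine_idx_def intro!: image_eqI[of _ _ k])
  qed
  then show ?thesis by auto
qed

lemma affine_idx_cases: obtains "i = j" | k where "i = affine_idx j k"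
  using UNIV_affine_idx[of j] by auto

lemma sum_option: "(\<Sum>i\<in>UNIV. f i) = f j + (\<Sum>k\<in>UNIV. f (affine_idx j k))"
  for f :: "'n::finite option \<Rightarrow> 'b::comm_monoid_add"
proof -
  have "(\<Sum>i\<in>UNIV. f i) = (\<Sum>i\<in>insert j (range (affine_idx j)). f i)" using UNIV_affine_idx[of j] by simp
  also have "\<dots> = f j + (\<Sum>i\<in>range (affine_idx j). f i)" by (rule sum.insert) auto
  finally show ?thesis by (simp add: sum.reindex[OF inj_affine_idx])
qed

lemma affine_lift_nth [simp]: "affine_lift j v $ j = 1" "affine_lift j v $ affine_idx j k = quat_coord v k"
  by (auto simp: affine_lift_def affine_idx_def split: option.split)

definition lin_lift :: "'n option \<Rightarrow> real ^ ('n::finite \<times> 4) \<Rightarrow> quat ^ 'n option" where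
  "lin_lift j h = affine_lift j h - affine_lift j 0"

lemma lin_lift_nth [simp]: "lin_lift j v $ j = 0" "lin_lift j v $ affine_idx j k = quat_coord v k"
  by (simp_all add: lin_lift_def quat_coord_0)

lemma vec_affine_idx_eqI: "x $ j = y $ j \<Longrightarrow> (\<And>k. x $ affine_idx j k = y $ affine_idx j k) \<Longrightarrow> x = y"
  unfolding vec_eq_iff by (metis affine_idx_cases)

lemma affine_lift_add: "affine_lift j (v + h) = affine_lift j v + lin_lift j h"
  by (rule vec_affine_idx_eqI[of _ j]) (simp_all add: quat_coord_add)

lemma linear_lin_lift: "linear (lin_lift j)"
  by (rule linearI; rule vec_affine_idx_eqI[of _ j]) (simp_all add: quat_coord_add quat_coord_scaleR)

lemma affine_lift_has_derivative: "(affine_lift j has_derivative lin_lift j) (at v)"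
proof -
  have "((\<lambda>v. affine_lift j 0 + lin_lift j v) has_derivative (\<lambda>h. 0 + lin_lift j h)) (at v)"
    by (intro has_derivative_add has_derivative_const linear_imp_has_derivative linear_lin_lift)
  moreover have "affine_lift j 0 + lin_lift j v = affine_lift j v" for v
    by (simp add: lin_lift_def)
  ultimately show ?thesis by simp
qed

lemma frechet_affine_lift: "frechet_derivative (affine_lift j) (at v) = lin_lift j"
  using frechet_derivative_at[OF affine_lift_has_derivative] by metis

lemma norm_affine_lift_sq: "(norm (affine_lift j v))\<^sup>2 = rr v"
proof -
  have "(norm (affine_lift j v))\<^sup>2 = (\<Sum>i\<in>UNIV. (norm (affine_lift j v $ i))\<^sup>2)" by (rule norm_quat_vec_sq)
  also have "\<dots> = rr v"
    unfolding sum_option[of _ j] affine_lift_nth norm_one unfolding norm_quat_sq_qc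
    by (simp add: rr_def inner_vec4 power2_eq_square)
  finally show ?thesis .
qed

text \<open>
  The components of the quaternion \<open>hinner (affine_lift j v) (lin_lift j h)\<close> are the Euclidean inner
  products of \<open>h\<close> with the vectors \<open>JJ c v\<close>.
\<close>

lemma fs_tensor_lin_lift:
  "fs_tensor (affine_lift j v) (lin_lift j h) (lin_lift j h') =
     (rr v * (h \<bullet> h') - (\<Sum>c\<in>UNIV. (h \<bullet> JJ c v) * (h' \<bullet> JJ c v))) / (rr v)\<^sup>2"
proof -
  define A where "A h = (\<Sum>k\<in>UNIV. qcnj (quat_coord v k) * quat_coord h k)" for h
  have re_sum: "qRe (sum f S) = (\<Sum>x\<in>S. qRe (f x))" for f :: "'n \<Rightarrow> quat" and S
    by (simp add: qRe_eq_qc qc_sum)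
  have 1: "qRe (hinner (lin_lift j h) (lin_lift j h')) = h \<bullet> h'"
    by (simp add: hinner_def sum_option[of _ j] re_sum qRe_cnj_mult inner_vec4)
  have 2: "hinner (affine_lift j v) (lin_lift j h) = A h" for h
    by (simp add: hinner_def sum_option[of _ j] A_def)
  have 3: "hinner (lin_lift j h) (affine_lift j v) = qcnj (A h)" for h
    by (simp add: hinner_def sum_option[of _ j] A_def qcnj_0 qcnj_sum qcnj_mult qcnj_qcnj)
  have 4: "qc c (A h) = h \<bullet> JJ c v" for c h
  proof -
    have q: "qc c (qcnj p * q) = (\<Sum>e\<in>UNIV. qc e q * qc e (p * qe c))" for p q
      using all_four[of "\<lambda>c. qc c (qcnj p * q) = (\<Sum>e\<in>UNIV. qc e q * qc e (p * qe c))"]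
      by (simp add: sum_four qc_def qe_def times_quat_def qcnj_def algebra_simps)
    show ?thesis unfolding A_def qc_sum inner_vec4 rmulq_def by (simp add: q)
  qed
  have 5: "(norm (affine_lift j v)) ^ 4 = (rr v)\<^sup>2"
    unfolding norm_affine_lift_sq[of j v, symmetric] by (simp add: power_mult[symmetric])
  show ?thesis unfolding fs_tensor_def 1 2 3 qRe_cnj_mult 4 5 norm_affine_lift_sq
    by (simp add: mult.commute)
qed

text \<open>
  The entries of \<open>M = \<Sum>\<^sub>c m\<^sub>c m\<^sub>c\<^sup>T\<close> with \<open>m\<^sub>c = JJ c v\<close>, which is \<open>|v|\<^sup>2\<close> times the orthogonal projection
  to the quaternionic line through \<open>v\<close>.
\<close>

definition quat_outer :: "real ^ ('n::finite \<times> 4) \<Rightarrow> 'n \<times> 4 \<Rightarrow> 'n \<times> 4 \<Rightarrow> real" where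
  "quat_outer v a b = (\<Sum>c\<in>UNIV. JJ c v $ a * JJ c v $ b)"

lemma quat_outer_sym: "quat_outer v a b = quat_outer v b a"
  by (simp add: quat_outer_def mult.commute)

lemma fs_metric_nth: "fs_metric j v $ a $ b = (rr v * (if a = b then 1 else 0) - quat_outer v a b) / (rr v)\<^sup>2"
  by (simp add: fs_metric_def frechet_affine_lift fs_tensor_lin_lift inner_axis_axis inner_axis' quat_outer_def) (simp add: axis_def)

lemma quat_outer_mult: "(\<Sum>b\<in>UNIV. quat_outer v a b * quat_outer v b c) = (v \<bullet> v) * quat_outer v a c"
proof -
  have sw: "(\<Sum>b\<in>UNIV. \<Sum>d\<in>UNIV. \<Sum>e\<in>UNIV. F b d e) = (\<Sum>d\<in>UNIV. \<Sum>e\<in>UNIV. \<Sum>b\<in>UNIV. F b d e)"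
    for F :: "'b::finite \<Rightarrow> 'c::finite \<Rightarrow> 'd::finite \<Rightarrow> real"
    by (subst sum.swap, intro sum.cong refl, rule sum.swap)
  have "(\<Sum>b\<in>UNIV. quat_outer v a b * quat_outer v b c)
      = (\<Sum>b\<in>UNIV. \<Sum>d\<in>UNIV. \<Sum>e\<in>UNIV. JJ d v $ a * JJ e v $ c * (JJ d v $ b * JJ e v $ b))"
    by (simp add: quat_outer_def sum_product mult_ac)
  also have "\<dots> = (\<Sum>d\<in>UNIV. \<Sum>e\<in>UNIV. JJ d v $ a * JJ e v $ c * (\<Sum>b\<in>UNIV. JJ d v $ b * JJ e v $ b))"
    by (subst sw) (simp add: sum_distrib_left)
  also have "\<dots> = (\<Sum>d\<in>UNIV. \<Sum>e\<in>UNIV. JJ d v $ a * JJ e v $ c * (if d = e then v \<bullet> v else 0))"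
    unfolding inner_JJ[symmetric] by (simp add: inner_vec_def)
  also have "\<dots> = (v \<bullet> v) * quat_outer v a c"
    by (simp add: quat_outer_def sum_distrib_left mult_ac if_distrib cong: if_cong)
  finally show ?thesis .
qed

text \<open>
  Since \<open>M\<^sup>2 = |v|\<^sup>2 M\<close> and \<open>R = 1 + |v|\<^sup>2\<close>, the inverse of \<open>(R - M) / R\<^sup>2\<close> is \<open>R (1 + M)\<close>.
\<close>

lemma fs_metric_inverse:
  "matrix_inv (fs_metric j v) = (\<chi> a b. rr v * ((if a = b then 1 else 0) + quat_outer v a b))" (is "_ = ?B")
proof -
  have R: "rr v \<noteq> 0" using rr_pos[of v] by simp
  have "(\<Sum>b\<in>UNIV. fs_metric j v $ a $ b * (rr v * ((if b = c then 1 else 0) + quat_outer v b c))) = (if a = c then 1 else 0)" for a c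
  proof -
    define dl :: "'a \<times> 4 \<Rightarrow> 'a \<times> 4 \<Rightarrow> real" where "dl a b = (if a = b then 1 else 0)" for a b
    have dl1: "(\<Sum>b\<in>UNIV. dl a b * f b) = f a" for f a
      by (simp add: dl_def if_distrib[of "\<lambda>z. z * _"] cong: if_cong)
    have dl2: "(\<Sum>b\<in>UNIV. f b * dl b a) = f a" for f a
      by (simp add: dl_def if_distrib[of "\<lambda>z. _ * z"] cong: if_cong)
    have "(\<Sum>b\<in>UNIV. fs_metric j v $ a $ b * (rr v * (dl b c + quat_outer v b c)))
       = (\<Sum>b\<in>UNIV. (rr v * dl a b - quat_outer v a b) * (dl b c + quat_outer v b c)) / rr v"
      unfolding fs_metric_nth dl_def[symmetric] sum_divide_distrib using R
      by (intro sum.cong refl) (simp add: power2_eq_square)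
    also have "(\<Sum>b\<in>UNIV. (rr v * dl a b - quat_outer v a b) * (dl b c + quat_outer v b c))
       = rr v * (\<Sum>b\<in>UNIV. dl a b * (dl b c + quat_outer v b c)) - (\<Sum>b\<in>UNIV. quat_outer v a b * dl b c) - (\<Sum>b\<in>UNIV. quat_outer v a b * quat_outer v b c)"
      unfolding sum_distrib_left sum_subtractf[symmetric] by (intro sum.cong refl) (simp add: algebra_simps)
    also have "\<dots> = rr v * dl a c" unfolding dl1 dl2 quat_outer_mult by (simp add: rr_def algebra_simps)
    finally show ?thesis using R by (simp add: dl_def)
  qed
  then have 1: "fs_metric j v ** ?B = mat 1"
    by (simp add: matrix_matrix_mult_def mat_def vec_eq_iff)
  then have 2: "?B ** fs_metric j v = mat 1" by (simp add: matrix_left_right_inverse)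
  show ?thesis unfolding matrix_inv_def
  proof (rule some_equality)
    fix B assume "fs_metric j v ** B = mat 1 \<and> B ** fs_metric j v = mat 1"
    then have "B ** (fs_metric j v ** ?B) = ?B" by (simp add: matrix_mul_assoc)
    then show "B = ?B" unfolding 1 by simp
  qed (use 1 2 in blast)
qed

lemma id_minus_outer_mult_vec:
  fixes m :: "'c \<Rightarrow> real ^ 'm::finite"
  shows "(\<chi> i j. (if i = j then 1 else 0) - t * (\<Sum>c\<in>C. m c $ i * m c $ j)) *v y = y - t *\<^sub>R (\<Sum>c\<in>C. (m c \<bullet> y) *\<^sub>R m c)"
    (is "?P *v y = _")
proof -
  have "(?P *v y) $ i = y $ i - t * (\<Sum>j\<in>UNIV. (\<Sum>c\<in>C. m c $ i * m c $ j) * y $ j)" for i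
  proof -
    have "(?P *v y) $ i = (\<Sum>j\<in>UNIV. (if i = j then 1 else 0) * y $ j) - (\<Sum>j\<in>UNIV. t * (\<Sum>c\<in>C. m c $ i * m c $ j) * y $ j)"
      unfolding matrix_vector_mult_def by (simp add: left_diff_distrib sum_subtractf)
    also have "(\<Sum>j\<in>UNIV. (if i = j then 1 else 0) * y $ j) = y $ i"
      by (simp add: if_distrib[of "\<lambda>z. z * _"] cong: if_cong)
    also have "(\<Sum>j\<in>UNIV. t * (\<Sum>c\<in>C. m c $ i * m c $ j) * y $ j) = t * (\<Sum>j\<in>UNIV. (\<Sum>c\<in>C. m c $ i * m c $ j) * y $ j)"
      by (subst sum_distrib_left) (simp add: mult.assoc)
    finally show ?thesis .
  qed
  also have "\<dots> i = y $ i - t * (\<Sum>c\<in>C. (m c \<bullet> y) * m c $ i)" for i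
    unfolding sum_distrib_right by (subst sum.swap) (simp add: inner_vec_def sum_distrib_left sum_distrib_right mult_ac)
  finally show ?thesis by (simp add: vec_eq_iff)
qed

text \<open>
  A rotation that takes \<open>w\<close> to a coordinate axis makes the matrix diagonal.
\<close>

lemma det_one_minus_rank_one:
  fixes w :: "real ^ 'm::finite"
  shows "det (\<chi> i j. (if i = j then 1 else 0) - t * (w $ i * w $ j)) = 1 - t * (w \<bullet> w)"
proof -
  fix k :: 'm
  define P where "P w = (\<chi> i j. (if i = j then 1 else 0) - t * (w $ i * w $ j))" for w :: "real ^ 'm"
  obtain f :: "real ^ 'm \<Rightarrow> real ^ 'm" where f: "orthogonal_transformation f" "f w = norm w *\<^sub>R axis k 1"
  proof (rule orthogonal_transformation_exists)
    show "norm w = norm (norm w *\<^sub>R (axis k (1::real) :: real ^ 'm))" by (simp add: norm_axis_1)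
  qed auto
  define A where "A = matrix f"
  have oA: "orthogonal_matrix A" using f(1) unfolding A_def orthogonal_transformation_matrix by simp
  have Aw: "A *v w = norm w *\<^sub>R axis k 1"
    using f unfolding A_def by (simp add: matrix_works orthogonal_transformation_linear)
  have PM: "P w *v x = x - (t * (w \<bullet> x)) *\<^sub>R w" for w x
    using id_minus_outer_mult_vec[where t = t and C = "{()}" and m = "\<lambda>_. w" and y = x] by (simp add: P_def)
  have "A ** P w = P (A *v w) ** A"
  proof (rule matrix_eq[THEN iffD2], rule allI)
    fix x
    have "(A *v w) \<bullet> (A *v x) = w \<bullet> x"
      using f(1) unfolding A_def orthogonal_transformation_def by (simp add: matrix_works)
    then show "A ** P w *v x = P (A *v w) ** A *v x"
      unfolding matrix_vector_mul_assoc[symmetric] PM matrix_vector_mult_diff_distrib matrix_vector_mult_scaleR by simp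
  qed
  then have "det (A ** P w) = det (P (A *v w) ** A)" by (rule arg_cong)
  then have "det A * det (P w) = det (P (A *v w)) * det A" unfolding det_mul .
  moreover have "det A \<noteq> 0" using det_orthogonal_matrix[OF oA] by auto
  ultimately have "det (P w) = det (P (A *v w))" by simp
  also have "\<dots> = (\<Prod>i\<in>UNIV. if i = k then 1 - t * (norm w)\<^sup>2 else 1)"
  proof -
    have "det (P (A *v w)) = (\<Prod>i\<in>UNIV. P (A *v w) $ i $ i)"
      unfolding Aw P_def by (rule det_diagonal) (auto simp: axis_def)
    also have "\<dots> = (\<Prod>i\<in>UNIV. if i = k then 1 - t * (norm w)\<^sup>2 else 1)"
      unfolding Aw P_def by (rule prod.cong) (simp_all add: axis_def power2_eq_square)
    finally show ?thesis .
  qed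
  also have "\<dots> = 1 - t * (w \<bullet> w)" by (simp add: prod.delta power2_norm_eq_inner)
  finally show ?thesis unfolding P_def .
qed

text \<open>
  By orthogonality the matrix is the product of the rank one perturbations for the single vectors.
\<close>

lemma det_one_minus_orthogonal:
  fixes m :: "'c \<Rightarrow> real ^ 'm::finite"
  assumes "finite C" and "\<And>c d. c \<in> C \<Longrightarrow> d \<in> C \<Longrightarrow> c \<noteq> d \<Longrightarrow> m c \<bullet> m d = 0" and "\<And>c. c \<in> C \<Longrightarrow> m c \<bullet> m c = s"
  shows "det (\<chi> i j. (if i = j then 1 else 0) - t * (\<Sum>c\<in>C. m c $ i * m c $ j)) = (1 - t * s) ^ card C"
  using assms
proof (induction C rule: finite_induct)
  case empty
  show ?case by (simp add: det_I[unfolded mat_def])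
next
  case (insert x C)
  define P where "P C = (\<chi> i j. (if i = j then 1 else 0) - t * (\<Sum>c\<in>C. m c $ i * m c $ j))" for C
  have PM: "P C *v y = y - t *\<^sub>R (\<Sum>c\<in>C. (m c \<bullet> y) *\<^sub>R m c)" for C y
    unfolding P_def by (rule id_minus_outer_mult_vec)
  have "P (insert x C) = P {x} ** P C"
  proof (rule matrix_eq[THEN iffD2], rule allI)
    fix y
    have "(\<Sum>c\<in>C. (m c \<bullet> y) * (m x \<bullet> m c)) = 0"
      using insert by (intro sum.neutral) auto
    then show "P (insert x C) *v y = P {x} ** P C *v y"
      using insert(1,2) by (simp add: matrix_vector_mul_assoc[symmetric] PM inner_diff_right inner_sum_right algebra_simps)
  qed
  then have "det (P (insert x C)) = det (P {x}) * det (P C)" by (simp add: det_mul)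
  also have "det (P {x}) = 1 - t * s"
    using det_one_minus_rank_one[of t "m x"] insert.prems by (simp add: P_def)
  also have "det (P C) = (1 - t * s) ^ card C" using insert by (simp add: P_def)
  finally show ?case using insert by (simp add: P_def)
qed

lemma det_fs_metric: "sqrt (det (fs_metric j v)) = inverse (rr v) ^ (2 * CARD('n) + 2)"
  for v :: "real ^ ('n::finite \<times> 4)"
proof -
  have R: "rr v > 0" by (rule rr_pos)
  define A where "A = (\<chi> a b. (if a = b then 1 else 0) - inverse (rr v) * quat_outer v a b)"
  have "fs_metric j v = (\<chi> a. inverse (rr v) *s A $ a)"
    using R by (auto simp: vec_eq_iff fs_metric_nth A_def power2_eq_square field_simps)
  then have "det (fs_metric j v) = (\<Prod>a\<in>(UNIV :: ('n \<times> 4) set). inverse (rr v)) * det (\<chi> a. A $ a)"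
    using det_rows_mul[of "\<lambda>_. inverse (rr v)" "\<lambda>a. A $ a"] by simp
  also have "(\<chi> a. A $ a) = A" by (simp add: vec_eq_iff)
  also have "det A = (1 - inverse (rr v) * (v \<bullet> v)) ^ card (UNIV :: 4 set)"
    unfolding A_def quat_outer_def by (rule det_one_minus_orthogonal) (auto simp: inner_JJ)
  also have "1 - inverse (rr v) * (v \<bullet> v) = inverse (rr v)" using R by (simp add: rr_def field_simps)
  also have "(\<Prod>a\<in>(UNIV :: ('n \<times> 4) set). inverse (rr v)) * inverse (rr v) ^ card (UNIV :: 4 set) = (inverse (rr v) ^ (2 * CARD('n) + 2))\<^sup>2"
  proof -
    have "(\<Prod>a\<in>(UNIV :: ('n \<times> 4) set). inverse (rr v)) * inverse (rr v) ^ card (UNIV :: 4 set) = inverse (rr v) ^ (CARD('n) * 4 + 4)"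
      by (simp only: prod_constant card_affine_coords power_add) simp
    also have "\<dots> = inverse (rr v) ^ ((2 * CARD('n) + 2) * 2)" by (rule arg_cong[of _ _ "power _"]) simp
    finally show ?thesis by (simp only: power_mult)
  qed
  finally show ?thesis using R by simp
qed

section \<open>The Laplacian in affine coordinates\<close>

lemma partial_deriv_eq: "(f has_derivative D) (at v) \<Longrightarrow> partial_deriv a f v = D (axis a 1)"
  unfolding partial_deriv_def using frechet_derivative_at by metis

lemma vec_basis_sum: "h = (\<Sum>a\<in>UNIV. h $ a *\<^sub>R axis a (1::real))"
  by (simp add: vec_eq_iff axis_def if_distrib[of "\<lambda>z. _ * z"] cong: if_cong)

lemma linear_JJ_nth: "linear (\<lambda>w. rmulq p w $ a)"
  by (rule linearI) (simp_all add: linear_add[OF linear_rmulq] linear_scale[OF linear_rmulq])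

lemma frechet_eq_sum_partial:
  assumes "f differentiable at v"
  shows "frechet_derivative f (at v) h = (\<Sum>a\<in>UNIV. h $ a * partial_deriv a f v)"
proof -
  have lin: "linear (frechet_derivative f (at v))"
    using assms by (rule linear_frechet_derivative)
  have "frechet_derivative f (at v) h = frechet_derivative f (at v) (\<Sum>a\<in>UNIV. h $ a *\<^sub>R axis a 1)"
    using vec_basis_sum[of h] by simp
  also have "\<dots> = (\<Sum>a\<in>UNIV. h $ a * partial_deriv a f v)"
    by (simp add: linear_sum[OF lin] linear_scale[OF lin] partial_deriv_def)
  finally show ?thesis .
qed

lemma has_derivative_partials:
  assumes "f differentiable at v"
  shows "(f has_derivative (\<lambda>h. \<Sum>a\<in>UNIV. h $ a * partial_deriv a f v)) (at v)"
proof -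
  have "frechet_derivative f (at v) = (\<lambda>h. \<Sum>a\<in>UNIV. h $ a * partial_deriv a f v)"
    using frechet_eq_sum_partial[OF assms] by blast
  then show ?thesis using assms frechet_derivative_works[of f "at v"] by simp
qed

text \<open>
  The cutoff functions in Green's identity are twice continuously differentiable, but not smooth.
\<close>

definition C2 :: "(real ^ 'm::finite \<Rightarrow> real) \<Rightarrow> bool" where
  "C2 f \<longleftrightarrow> (\<forall>v. f differentiable at v) \<and> (\<forall>a v. partial_deriv a f differentiable at v) \<and>
     (\<forall>a b. continuous_on UNIV (partial_deriv a (partial_deriv b f)))"

lemma C2_D: "C2 f \<Longrightarrow> f differentiable at v" "C2 f \<Longrightarrow> partial_deriv a f differentiable at v"
  "C2 f \<Longrightarrow> continuous_on UNIV (partial_deriv a (partial_deriv b f))"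
  by (auto simp: C2_def)

lemma differentiable_UNIV_continuous: "(\<And>v. f differentiable at v) \<Longrightarrow> continuous_on UNIV f"
  by (simp add: continuous_on_eq_continuous_at differentiable_imp_continuous_within)

lemma C2_continuous: "C2 f \<Longrightarrow> continuous_on UNIV f" "C2 f \<Longrightarrow> continuous_on UNIV (partial_deriv a f)"
  by (rule differentiable_UNIV_continuous, simp add: C2_D)+

text \<open>
  The Laplace-Beltrami operator in affine coordinates, after all coefficients have been
  differentiated. The coefficients are the same in all charts.
\<close>

definition chart_lap :: "(real ^ ('n::finite \<times> 4) \<Rightarrow> real) \<Rightarrow> real ^ ('n \<times> 4) \<Rightarrow> real" where
  "chart_lap f v = rr v * ((\<Sum>a\<in>UNIV. partial_deriv a (partial_deriv a f) v)
     + (\<Sum>a\<in>UNIV. \<Sum>b\<in>UNIV. quat_outer v a b * partial_deriv a (partial_deriv b f) v)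
     - 4 * (\<Sum>b\<in>UNIV. v $ b * partial_deriv b f v))"

text \<open>
  The coefficients \<open>sqrt (det g) g\<^sup>a\<^sup>b\<close> of the vector field whose divergence defines the Laplacian.
\<close>

definition flux_coeff :: "real ^ ('n::finite \<times> 4) \<Rightarrow> 'n \<times> 4 \<Rightarrow> 'n \<times> 4 \<Rightarrow> real" where
  "flux_coeff v a b = inverse (rr v) ^ (2 * CARD('n) + 1) * ((if a = b then 1 else 0) + quat_outer v a b)"

lemma sqrt_det_times_inverse:
  "sqrt (det (fs_metric j v)) * matrix_inv (fs_metric j v) $ a $ b = flux_coeff v a b"
proof -
  have "inverse (rr v) ^ (2 * CARD('a) + 2) * rr v = inverse (rr v) ^ (2 * CARD('a) + 1)"
    using rr_pos[of v] by simp
  then show ?thesis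
    unfolding det_fs_metric fs_metric_inverse flux_coeff_def vec_lambda_beta mult.assoc[symmetric] by simp
qed

lemma JJ_nth_has_derivative: "((\<lambda>w. JJ c w $ a) has_derivative (\<lambda>h. JJ c h $ a)) (at v)"
  by (rule linear_imp_has_derivative[OF linear_JJ_nth])

lemma rr_has_derivative: "(rr has_derivative (\<lambda>h. 2 * (v \<bullet> h))) (at v)"
  unfolding rr_def[abs_def] by (auto intro!: derivative_eq_intros simp: inner_commute)

lemma quat_outer_has_derivative:
  "((\<lambda>w. quat_outer w a b) has_derivative (\<lambda>h. \<Sum>c\<in>UNIV. JJ c v $ a * JJ c h $ b + JJ c h $ a * JJ c v $ b)) (at v)"
  unfolding quat_outer_def by (intro has_derivative_sum has_derivative_mult JJ_nth_has_derivative)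

lemma flux_coeff_has_derivative:
  fixes v :: "real ^ ('n::finite \<times> 4)"
  shows "((\<lambda>w. flux_coeff w a b) has_derivative (\<lambda>h.
     inverse (rr v) ^ (2 * CARD('n) + 1) * (\<Sum>c\<in>UNIV. JJ c v $ a * JJ c h $ b + JJ c h $ a * JJ c v $ b)
     - 2 * real (2 * CARD('n) + 1) * inverse (rr v) ^ (2 * CARD('n) + 2) * (v \<bullet> h) * ((if a = b then 1 else 0) + quat_outer v a b))) (at v)"
proof -
  have R: "rr v \<noteq> 0" using rr_pos[of v] by simp
  have d0: "((\<lambda>r::real. inverse r ^ (2 * CARD('n) + 1)) has_real_derivative
      - real (2 * CARD('n) + 1) * inverse (rr v) ^ (2 * CARD('n) + 2)) (at (rr v))"
    by (rule DERIV_cong[OF DERIV_power[OF DERIV_inverse[OF R]]]) (simp add: algebra_simps)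
  have d1: "((\<lambda>w. inverse (rr w) ^ (2 * CARD('n) + 1)) has_derivative
     (\<lambda>h. 2 * (v \<bullet> h) * (- real (2 * CARD('n) + 1) * inverse (rr v) ^ (2 * CARD('n) + 2)))) (at v)"
    using has_derivative_compose[OF rr_has_derivative d0[unfolded has_field_derivative_def]] by (simp add: mult_ac)
  have d2: "((\<lambda>w. (if a = b then 1 else 0) + quat_outer w a b) has_derivative
      (\<lambda>h. 0 + (\<Sum>c\<in>UNIV. JJ c v $ a * JJ c h $ b + JJ c h $ a * JJ c v $ b))) (at v)"
    by (intro has_derivative_add has_derivative_const quat_outer_has_derivative)
  show ?thesis unfolding flux_coeff_def
    by (rule has_derivative_eq_rhs[OF has_derivative_mult[OF d1 d2]]) (simp add: fun_eq_iff algebra_simps)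
qed

lemma sum_quat_outer_v: "(\<Sum>a\<in>UNIV. v $ a * quat_outer v a b) = (v \<bullet> v) * v $ b"
proof -
  have "(\<Sum>a\<in>UNIV. v $ a * quat_outer v a b) = (\<Sum>c\<in>UNIV. (JJ 0 v \<bullet> JJ c v) * JJ c v $ b)"
    unfolding quat_outer_def sum_distrib_left by (subst sum.swap) (simp add: inner_vec_def sum_distrib_left mult_ac)
  then show ?thesis unfolding inner_JJ by (simp add: sum_four)
qed

lemma divergence_flux_coeff:
  fixes v :: "real ^ ('n::finite \<times> 4)"
  shows "(\<Sum>a\<in>UNIV. partial_deriv a (\<lambda>w. flux_coeff w a b) v) = - 4 * inverse (rr v) ^ (2 * CARD('n) + 1) * v $ b"
proof -
  define r m where "r = inverse (rr v)" and "m = 2 * CARD('n) + 1"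
  have R: "rr v \<noteq> 0" using rr_pos[of v] by simp
  have ax: "v \<bullet> axis a 1 = v $ a" for a by (simp add: inner_axis)
  have s1: "(\<Sum>a\<in>UNIV. JJ c v $ a * JJ c (axis a 1) $ b) = JJ c (JJ c v) $ b" for c
  proof -
    have lin: "linear (\<lambda>w. JJ c w $ b)" by (rule linear_JJ_nth)
    have "JJ c (JJ c v) $ b = JJ c (\<Sum>a\<in>UNIV. JJ c v $ a *\<^sub>R axis a 1) $ b"
      using vec_basis_sum[of "JJ c v"] by simp
    also have "\<dots> = (\<Sum>a\<in>UNIV. JJ c v $ a * JJ c (axis a 1) $ b)"
      using linear_sum[OF lin, of "\<lambda>a. JJ c v $ a *\<^sub>R axis a 1" UNIV] linear_scale[OF lin] by simp
    finally show ?thesis ..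
  qed
  have s2: "(\<Sum>a\<in>(UNIV :: ('n \<times> 4) set). JJ c (axis a 1) $ a * JJ c v $ b) = (if c = 0 then 4 * real CARD('n) else 0) * JJ c v $ b" for c
    unfolding sum_distrib_right[symmetric] trace_JJ ..
  have s4: "(\<Sum>a\<in>UNIV. v $ a * ((if a = b then 1 else 0) + quat_outer v a b)) = rr v * v $ b"
    unfolding distrib_left sum.distrib sum_quat_outer_v by (simp add: rr_def distrib_right if_distrib[of "\<lambda>z. _ * z"] cong: if_cong)
  have "(\<Sum>a\<in>UNIV. partial_deriv a (\<lambda>w. flux_coeff w a b) v)
    = (\<Sum>a\<in>UNIV. r ^ m * (\<Sum>c\<in>UNIV. JJ c v $ a * JJ c (axis a 1) $ b + JJ c (axis a 1) $ a * JJ c v $ b)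
       - 2 * real m * r ^ (m + 1) * (v $ a * ((if a = b then 1 else 0) + quat_outer v a b)))"
    unfolding partial_deriv_eq[OF flux_coeff_has_derivative] ax r_def m_def by (intro sum.cong refl) (simp add: mult_ac)
  also have "\<dots> = r ^ m * (\<Sum>c\<in>UNIV. (\<Sum>a\<in>UNIV. JJ c v $ a * JJ c (axis a 1) $ b) + (\<Sum>a\<in>(UNIV :: ('n \<times> 4) set). JJ c (axis a 1) $ a * JJ c v $ b))
      - 2 * real m * r ^ (m + 1) * (\<Sum>a\<in>UNIV. v $ a * ((if a = b then 1 else 0) + quat_outer v a b))"
    unfolding sum_subtractf sum_distrib_left[symmetric] by (subst sum.swap) (simp add: sum.distrib)
  also have "\<dots> = r ^ m * ((4 * real CARD('n) - 2) * v $ b) - 2 * real m * (r ^ (m + 1) * rr v) * v $ b"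
    unfolding s1 s2 s4 JJ_JJ by (simp add: sum_four algebra_simps)
  also have "r ^ (m + 1) * rr v = r ^ m" using R by (simp add: r_def)
  finally show ?thesis by (simp add: r_def m_def algebra_simps)
qed

lemma laplace_beltrami_eq_chart_lap:
  fixes v :: "real ^ ('n::finite \<times> 4)"
  assumes f: "C2 f"
  shows "laplace_beltrami (fs_metric j) f v = chart_lap f v"
    and "laplace_beltrami (fs_metric j) f v = rr v ^ (2 * CARD('n) + 2) *
      (\<Sum>a\<in>UNIV. \<Sum>b\<in>UNIV. partial_deriv a (\<lambda>w. flux_coeff w a b * partial_deriv b f w) v)"
proof -
  have R: "rr v > 0" by (rule rr_pos)
  have LB: "laplace_beltrami (fs_metric j) f v = (\<Sum>a\<in>UNIV. \<Sum>b\<in>UNIV. partial_deriv a (\<lambda>w. flux_coeff w a b * partial_deriv b f w) v) / inverse (rr v) ^ (2 * CARD('n) + 2)"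
    unfolding laplace_beltrami_def unfolding sqrt_det_times_inverse unfolding det_fs_metric ..
  then show 2: "laplace_beltrami (fs_metric j) f v = rr v ^ (2 * CARD('n) + 2) *
      (\<Sum>a\<in>UNIV. \<Sum>b\<in>UNIV. partial_deriv a (\<lambda>w. flux_coeff w a b * partial_deriv b f w) v)"
    using R by (simp add: divide_inverse power_inverse mult.commute del: power_Suc)
  have pd: "partial_deriv a (\<lambda>w. flux_coeff w a b * partial_deriv b f w) v
     = flux_coeff v a b * partial_deriv a (partial_deriv b f) v + partial_deriv a (\<lambda>w. flux_coeff w a b) v * partial_deriv b f v" for a b
  proof -
    obtain DA where DA: "((\<lambda>w. flux_coeff w a b) has_derivative DA) (at v)" using flux_coeff_has_derivative by blast
    obtain DP where DP: "(partial_deriv b f has_derivative DP) (at v)"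
      using C2_D(2)[OF f] unfolding differentiable_def by blast
    show ?thesis
      unfolding partial_deriv_eq[OF has_derivative_mult[OF DA DP]] partial_deriv_eq[OF DA] partial_deriv_eq[OF DP] ..
  qed
  have 3: "(\<Sum>a\<in>UNIV. \<Sum>b\<in>UNIV. partial_deriv a (\<lambda>w. flux_coeff w a b * partial_deriv b f w) v)
     = (\<Sum>a\<in>UNIV. \<Sum>b\<in>UNIV. flux_coeff v a b * partial_deriv a (partial_deriv b f) v)
       + (\<Sum>b\<in>UNIV. (\<Sum>a\<in>UNIV. partial_deriv a (\<lambda>w. flux_coeff w a b) v) * partial_deriv b f v)"
    unfolding pd sum.distrib sum_distrib_right
    by (rule arg_cong2[where f = "(+)", OF refl]) (rule sum.swap)
  have 4: "(\<Sum>a\<in>UNIV. \<Sum>b\<in>UNIV. flux_coeff v a b * partial_deriv a (partial_deriv b f) v)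
     = inverse (rr v) ^ (2 * CARD('n) + 1) * ((\<Sum>a\<in>UNIV. partial_deriv a (partial_deriv a f) v)
     + (\<Sum>a\<in>UNIV. \<Sum>b\<in>UNIV. quat_outer v a b * partial_deriv a (partial_deriv b f) v))"
  proof -
    have "(\<Sum>b\<in>UNIV. flux_coeff v a b * partial_deriv a (partial_deriv b f) v) = inverse (rr v) ^ (2 * CARD('n) + 1) *
       (partial_deriv a (partial_deriv a f) v + (\<Sum>b\<in>UNIV. quat_outer v a b * partial_deriv a (partial_deriv b f) v))" for a
    proof -
      have "(\<Sum>b\<in>UNIV. (if a = b then 1 else 0) * partial_deriv a (partial_deriv b f) v) = partial_deriv a (partial_deriv a f) v"
        by (simp add: if_distrib[of "\<lambda>z. z * _"] cong: if_cong)
      then show ?thesis unfolding flux_coeff_def mult.assoc sum_distrib_left[symmetric] distrib_right sum.distrib by simp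
    qed
    then show ?thesis unfolding sum_distrib_left[symmetric] sum.distrib[symmetric] by (simp add: sum_distrib_left)
  qed
  have 5: "(\<Sum>b\<in>UNIV. (\<Sum>a\<in>UNIV. partial_deriv a (\<lambda>w. flux_coeff w a b) v) * partial_deriv b f v)
     = inverse (rr v) ^ (2 * CARD('n) + 1) * (- 4 * (\<Sum>b\<in>UNIV. v $ b * partial_deriv b f v))"
    unfolding divergence_flux_coeff sum_distrib_left by (intro sum.cong refl) simp
  have 6: "rr v ^ (2 * CARD('n) + 2) * (inverse (rr v) ^ (2 * CARD('n) + 1) * X) = rr v * X" for X
  proof -
    have "rr v ^ (2 * CARD('n) + 1) * inverse (rr v) ^ (2 * CARD('n) + 1) = 1"
      using R by (simp only: power_mult_distrib[symmetric]) simp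
    then have "rr v * (rr v ^ (2 * CARD('n) + 1) * inverse (rr v) ^ (2 * CARD('n) + 1)) * X = rr v * X" by simp
    then show ?thesis by (simp add: mult.assoc)
  qed
  show "laplace_beltrami (fs_metric j) f v = chart_lap f v"
    unfolding 2 3 4 5 distrib_left[symmetric] 6 chart_lap_def by simp
qed

section \<open>Independence of the chart\<close>

lemma deriv2_along_curve:
  fixes f :: "real ^ 'm::finite \<Rightarrow> real"
  assumes f: "C2 f"
    and g: "eventually (\<lambda>s. (g has_vector_derivative g' s) (at s)) (nhds 0)"
    and g': "(g' has_vector_derivative g2) (at 0)"
  shows "deriv (deriv (\<lambda>s. f (g s))) 0 =
     (\<Sum>a\<in>UNIV. \<Sum>b\<in>UNIV. g' 0 $ a * g' 0 $ b * partial_deriv a (partial_deriv b f) (g 0))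
     + (\<Sum>b\<in>UNIV. g2 $ b * partial_deriv b f (g 0))"
proof -
  have chain: "((\<lambda>s. h (g s)) has_real_derivative (\<Sum>a\<in>UNIV. g' s $ a * partial_deriv a h (g s))) (at s)"
    if "(g has_vector_derivative g' s) (at s)" "h differentiable at (g s)" for h s
  proof -
    have "((\<lambda>s. h (g s)) has_derivative (\<lambda>x. \<Sum>a\<in>UNIV. (x *\<^sub>R g' s) $ a * partial_deriv a h (g s))) (at s)"
      using has_derivative_compose[OF that(1)[unfolded has_vector_derivative_def] has_derivative_partials[OF that(2)]] .
    then show ?thesis
      unfolding has_field_derivative_def
      by (rule has_derivative_eq_rhs) (simp add: fun_eq_iff sum_distrib_left mult_ac)
  qed
  have "eventually (\<lambda>s. deriv (\<lambda>s. f (g s)) s = (\<Sum>b\<in>UNIV. g' s $ b * partial_deriv b f (g s))) (nhds 0)"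
    using g by eventually_elim (intro DERIV_imp_deriv chain C2_D[OF f])
  then have "deriv (deriv (\<lambda>s. f (g s))) 0 = deriv (\<lambda>s. \<Sum>b\<in>UNIV. g' s $ b * partial_deriv b f (g s)) 0"
    by (rule deriv_cong_ev) simp
  also have "\<dots> = (\<Sum>b\<in>UNIV. g' 0 $ b * (\<Sum>a\<in>UNIV. g' 0 $ a * partial_deriv a (partial_deriv b f) (g 0)) + g2 $ b * partial_deriv b f (g 0))"
  proof (rule DERIV_imp_deriv, intro DERIV_sum)
    fix b
    have "((\<lambda>s. g' s $ b) has_real_derivative g2 $ b) (at 0)"
      using bounded_linear.has_vector_derivative[OF bounded_linear_vec_nth g']
      by (simp add: has_real_derivative_iff_has_vector_derivative)
    moreover have "((\<lambda>s. partial_deriv b f (g s)) has_real_derivative (\<Sum>a\<in>UNIV. g' 0 $ a * partial_deriv a (partial_deriv b f) (g 0))) (at 0)"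
      by (rule chain[OF eventually_nhds_x_imp_x[OF g] C2_D(2)[OF f]])
    ultimately show "((\<lambda>s. g' s $ b * partial_deriv b f (g s)) has_real_derivative
      g' 0 $ b * (\<Sum>a\<in>UNIV. g' 0 $ a * partial_deriv a (partial_deriv b f) (g 0)) + g2 $ b * partial_deriv b f (g 0)) (at 0)"
      by (rule DERIV_mult')
  qed
  also have "(\<Sum>b\<in>UNIV. g' 0 $ b * (\<Sum>a\<in>UNIV. g' 0 $ a * partial_deriv a (partial_deriv b f) (g 0)) + g2 $ b * partial_deriv b f (g 0))
    = (\<Sum>b\<in>UNIV. \<Sum>a\<in>UNIV. g' 0 $ a * g' 0 $ b * partial_deriv a (partial_deriv b f) (g 0)) + (\<Sum>b\<in>UNIV. g2 $ b * partial_deriv b f (g 0))"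
    unfolding sum.distrib sum_distrib_left by (simp add: mult_ac)
  finally show ?thesis by (subst sum.swap)
qed

lemma abs_hproj_cong: "same_line x y \<Longrightarrow> abs_hproj x = abs_hproj y"
  using Quotient_rel_abs[OF Quotient_hproj] .

lemma same_line_refl: "x \<noteq> 0 \<Longrightarrow> same_line x x"
  unfolding same_line_def by (intro conjI exI[of _ 1]) (auto simp: hscale_one)

lemma abs_hproj_eqD: "abs_hproj x = abs_hproj y \<Longrightarrow> x \<noteq> 0 \<Longrightarrow> y \<noteq> 0 \<Longrightarrow> same_line x y"
  using Quotient_rel[OF Quotient_hproj] same_line_refl by metis

lemma abs_hproj_hscale: "q \<noteq> 0 \<Longrightarrow> abs_hproj (hscale x q) = abs_hproj x"
proof (cases "x = 0")
  case True
  then have "hscale x q = x" by (simp add: hscale_eq_zero)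
  then show ?thesis by simp
qed (auto intro!: abs_hproj_cong[symmetric] simp: same_line_def)

lemma affine_lift_nonzero: "affine_lift j v \<noteq> 0"
proof
  assume "affine_lift j v = 0"
  then have "affine_lift j v $ j = 0" by simp
  then show False by simp
qed

text \<open>
  Up to the factor \<open>|x|\<^sup>2\<close>, \<open>hom_lap f x\<close> is the Euclidean Laplacian of \<open>f\<close> as a function of the
  homogeneous coordinates \<open>x\<close>. No chart occurs in it, so it serves to compare the operators
  \<open>chart_lap\<close> in different charts.
\<close>

definition line_deriv2 :: "('n::finite hproj \<Rightarrow> real) \<Rightarrow> quat ^ 'n option \<Rightarrow> quat ^ 'n option \<Rightarrow> real" where
  "line_deriv2 f x b = deriv (deriv (\<lambda>s. f (abs_hproj (x + s *\<^sub>R b)))) 0"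

definition hom_lap :: "('n::finite hproj \<Rightarrow> real) \<Rightarrow> quat ^ 'n option \<Rightarrow> real" where
  "hom_lap f x = (norm x)\<^sup>2 * (\<Sum>i\<in>UNIV. \<Sum>c\<in>UNIV. line_deriv2 f x (axis i (qe c)))"

lemma hscale_nth [simp]: "hscale x q $ i = x $ i * q" by (simp add: hscale_def)

text \<open>
  A change of a homogeneous coordinate other than the one normalized to \<open>1\<close> moves the point along a
  straight line in the chart.
\<close>

lemma line_deriv2_affine_idx:
  fixes f :: "'n::finite hproj \<Rightarrow> real"
  assumes f: "C2 (\<lambda>v. f (hchart j v))"
  shows "line_deriv2 f (affine_lift j v) (axis (affine_idx j k) p) =
    (\<Sum>c\<in>UNIV. \<Sum>d\<in>UNIV. qc c p * qc d p * partial_deriv (k, c) (partial_deriv (k, d) (\<lambda>v. f (hchart j v))) v)"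
proof -
  define w where "w = qpack (\<lambda>k'. if k' = k then p else 0)"
  define g where "g s = v + s *\<^sub>R w" for s
  have l: "hchart j (g s) = abs_hproj (affine_lift j v + s *\<^sub>R axis (affine_idx j k) p)" for s
  proof -
    have "affine_lift j (g s) = affine_lift j v + s *\<^sub>R axis (affine_idx j k) p"
      by (rule vec_affine_idx_eqI[of _ j])
        (auto simp: g_def w_def axis_def quat_coord_add quat_coord_scaleR dest: injD[OF inj_affine_idx])
    then show ?thesis by (simp add: hchart_def)
  qed
  have g: "(g has_vector_derivative w) (at s)" for s
    unfolding g_def by (auto intro!: derivative_eq_intros)
  have "line_deriv2 f (affine_lift j v) (axis (affine_idx j k) p) = deriv (deriv (\<lambda>s. f (hchart j (g s)))) 0"
    by (simp add: line_deriv2_def l)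
  also have "\<dots> = (\<Sum>a\<in>UNIV. \<Sum>b\<in>UNIV. w $ a * w $ b * partial_deriv a (partial_deriv b (\<lambda>v. f (hchart j v))) (g 0))
     + (\<Sum>b\<in>UNIV. 0 $ b * partial_deriv b (\<lambda>v. f (hchart j v)) (g 0))"
    by (rule deriv2_along_curve[OF f, of g "\<lambda>_. w"]) (use g in auto)
  also have "\<dots> = (\<Sum>k1\<in>UNIV. \<Sum>c\<in>UNIV. \<Sum>k2\<in>UNIV. \<Sum>d\<in>UNIV. w $ (k1, c) * w $ (k2, d) * partial_deriv (k1, c) (partial_deriv (k2, d) (\<lambda>v. f (hchart j v))) v)"
    by (simp add: sum_pairs g_def)
  also have "\<dots> = (\<Sum>c\<in>UNIV. \<Sum>d\<in>UNIV. qc c p * qc d p * partial_deriv (k, c) (partial_deriv (k, d) (\<lambda>v. f (hchart j v))) v)"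
  proof -
    have one: "(\<Sum>k2\<in>UNIV. G k2) = G k" if "\<And>k2. k2 \<noteq> k \<Longrightarrow> G k2 = 0" for G :: "'n \<Rightarrow> real"
      using sum.mono_neutral_right[of UNIV "{k}" G] that by simp
    have "(\<Sum>k2\<in>UNIV. \<Sum>d\<in>UNIV. w $ (k1, c) * w $ (k2, d) * partial_deriv (k1, c) (partial_deriv (k2, d) (\<lambda>v. f (hchart j v))) v)
       = (\<Sum>d\<in>UNIV. w $ (k1, c) * qc d p * partial_deriv (k1, c) (partial_deriv (k, d) (\<lambda>v. f (hchart j v))) v)" for k1 c
      by (subst one) (auto simp: w_def intro!: sum.neutral)
    then show ?thesis by (simp only:) (subst one, auto simp: w_def intro!: sum.neutral)
  qed
  finally show ?thesis .
qed

lemma quat_expand: "p = (\<Sum>c\<in>UNIV. qc c p *\<^sub>R qe c)"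
  by (rule quat_eqI4) (simp add: qc_sum qc_qe if_distrib[of "\<lambda>z. _ * z"] cong: if_cong)

lemma rmulq_expand: "rmulq p v = (\<Sum>c\<in>UNIV. qc c p *\<^sub>R JJ c v)"
proof (rule vec4_eqI)
  fix k c
  have "rmulq p v $ (k, c) = qc c (quat_coord v k * (\<Sum>d\<in>UNIV. qc d p *\<^sub>R qe d))"
    using quat_expand[of p] by (simp add: rmulq_def)
  then show "rmulq p v $ (k, c) = (\<Sum>c\<in>UNIV. qc c p *\<^sub>R JJ c v) $ (k, c)"
    by (simp add: sum_distrib_left qc_sum rmulq_def)
qed

lemma bounded_linear_rmulq_left: "bounded_linear (\<lambda>p. rmulq p v)"
proof (rule bounded_linear_intro)
  show "rmulq (p + q) v = rmulq p v + rmulq q v" for p q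
    by (rule vec4_eqI) (simp add: rmulq_def distrib_left)
  show "rmulq (r *\<^sub>R p) v = r *\<^sub>R rmulq p v" for r p
    by (rule vec4_eqI) (simp add: rmulq_def)
  show "norm (rmulq p v) \<le> norm p * (\<Sum>c\<in>UNIV. norm (JJ c v))" for p
  proof -
    have "norm (rmulq p v) \<le> (\<Sum>c\<in>UNIV. norm (qc c p *\<^sub>R JJ c v))"
      unfolding rmulq_expand[of p] by (rule norm_sum)
    also have "\<dots> \<le> (\<Sum>c\<in>UNIV. norm p * norm (JJ c v))"
      by (intro sum_mono) (simp add: abs_qc_le mult_right_mono)
    finally show ?thesis by (simp add: sum_distrib_left)
  qed
qed

text \<open>
  A change of the normalized coordinate from \<open>1\<close> to \<open>1 + s p\<close> moves the point along the curve
  \<open>v (1 + s p)\<^sup>-\<^sup>1\<close> in the chart, with velocity \<open>- v p\<close> and acceleration \<open>2 v p p\<close> at \<open>s = 0\<close>.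
\<close>

lemma line_deriv2_j:
  fixes f :: "'n::finite hproj \<Rightarrow> real"
  assumes f: "C2 (\<lambda>v. f (hchart j v))"
  shows "line_deriv2 f (affine_lift j v) (axis j p) =
    (\<Sum>a\<in>UNIV. \<Sum>b\<in>UNIV. rmulq p v $ a * rmulq p v $ b * partial_deriv a (partial_deriv b (\<lambda>v. f (hchart j v))) v)
    + (\<Sum>b\<in>UNIV. 2 * rmulq (p * p) v $ b * partial_deriv b (\<lambda>v. f (hchart j v)) v)"
proof -
  define u where "u s = 1 + s *\<^sub>R p" for s :: real
  define g where "g s = rmulq (inverse (u s)) v" for s
  define g' where "g' s = rmulq (- (inverse (u s) * p * inverse (u s))) v" for s
  have u0: "u 0 = 1" by (simp add: u_def)
  have du: "(u has_vector_derivative p) (at s)" for s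
    unfolding u_def by (auto intro!: derivative_eq_intros)
  have cu: "continuous (at 0) u" using du by (rule has_vector_derivative_continuous)
  then have ne: "eventually (\<lambda>s. u s \<noteq> 0) (nhds 0)"
  proof -
    have "(u \<longlongrightarrow> u 0) (nhds 0)" using cu by (simp add: continuous_at tendsto_nhds_iff)
    then show ?thesis by (rule tendsto_imp_eventually_ne) (simp add: u0)
  qed
  have dinv: "((\<lambda>s. inverse (u s)) has_vector_derivative - (inverse (u s) * p * inverse (u s))) (at s)" if "u s \<noteq> 0" for s
    using Deriv.has_derivative_inverse[OF that du[unfolded has_vector_derivative_def]]
    unfolding has_vector_derivative_def by simp
  have l: "hchart j (g s) = abs_hproj (affine_lift j v + s *\<^sub>R axis j p)" if "u s \<noteq> 0" for s
  proof -
    have "hscale (affine_lift j v + s *\<^sub>R axis j p) (inverse (u s)) = affine_lift j (g s)"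
      using that
      by (intro vec_affine_idx_eqI[of _ j]) (simp_all add: g_def rmulq_def axis_def u_def)
    then show ?thesis using abs_hproj_hscale[of "inverse (u s)" "affine_lift j v + s *\<^sub>R axis j p"] that
      by (simp add: hchart_def)
  qed
  have dg: "(g has_vector_derivative g' s) (at s)" if "u s \<noteq> 0" for s
    unfolding g_def g'_def using bounded_linear.has_vector_derivative[OF bounded_linear_rmulq_left dinv[OF that]] .
  have dg2: "(g' has_vector_derivative rmulq (2 *\<^sub>R (p * p)) v) (at 0)"
  proof -
    have d0: "((\<lambda>s. inverse (u s)) has_vector_derivative - p) (at 0)" using dinv[of 0] by (simp add: u0)
    have "((\<lambda>s. inverse (u s) * p * inverse (u s)) has_vector_derivative inverse (u 0) * p * (- p) + (- p * p) * inverse (u 0)) (at 0)"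
      by (intro has_vector_derivative_mult has_vector_derivative_mult_left d0)
    then have "((\<lambda>s. - (inverse (u s) * p * inverse (u s))) has_vector_derivative - (inverse (u 0) * p * (- p) + (- p * p) * inverse (u 0))) (at 0)"
      by (rule has_vector_derivative_minus)
    moreover have "- (inverse (u 0) * p * (- p) + (- p * p) * inverse (u 0)) = 2 *\<^sub>R (p * p)"
      by (simp add: u0 scaleR_2)
    ultimately show ?thesis
      unfolding g'_def by (intro bounded_linear.has_vector_derivative[OF bounded_linear_rmulq_left]) (simp only:)
  qed
  have "line_deriv2 f (affine_lift j v) (axis j p) = deriv (deriv (\<lambda>s. f (hchart j (g s)))) 0"
    unfolding line_deriv2_def
  proof (rule deriv_cong_ev)
    have "eventually (\<lambda>s. f (abs_hproj (affine_lift j v + s *\<^sub>R axis j p)) = f (hchart j (g s))) (nhds 0)"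
      using ne by eventually_elim (simp add: l)
    then have "eventually (\<lambda>t. eventually (\<lambda>s. f (abs_hproj (affine_lift j v + s *\<^sub>R axis j p)) = f (hchart j (g s))) (nhds t)) (nhds 0)"
      by (simp add: eventually_eventually)
    then show "eventually (\<lambda>t. deriv (\<lambda>s. f (abs_hproj (affine_lift j v + s *\<^sub>R axis j p))) t = deriv (\<lambda>s. f (hchart j (g s))) t) (nhds 0)"
      by eventually_elim (rule deriv_cong_ev, auto)
  qed simp
  also have "\<dots> = (\<Sum>a\<in>UNIV. \<Sum>b\<in>UNIV. g' 0 $ a * g' 0 $ b * partial_deriv a (partial_deriv b (\<lambda>v. f (hchart j v))) (g 0))
     + (\<Sum>b\<in>UNIV. rmulq (2 *\<^sub>R (p * p)) v $ b * partial_deriv b (\<lambda>v. f (hchart j v)) (g 0))"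
    by (rule deriv2_along_curve[OF f eventually_mono[OF ne dg] dg2])
  also have "g 0 = v" by (simp add: g_def u0 rmulq_one)
  also have "g' 0 = - rmulq p v"
    using linear_neg[OF bounded_linear.linear[OF bounded_linear_rmulq_left], of p v] by (simp add: g'_def u0)
  also have "rmulq (2 *\<^sub>R (p * p)) v = 2 *\<^sub>R rmulq (p * p) v"
    by (rule linear_scale[OF bounded_linear.linear[OF bounded_linear_rmulq_left]])
  finally show ?thesis by simp
qed

text \<open>
  The directions of \<open>line_deriv2_affine_idx\<close> yield the Euclidean Laplacian of the chart. The four
  remaining ones yield the term with \<open>quat_outer\<close> and, since the squares of the quaternion units add
  up to \<open>-2\<close>, the term of first order.
\<close>

lemma hom_lap_eq_chart_lap:
  fixes f :: "'n::finite hproj \<Rightarrow> real"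
  assumes f: "C2 (\<lambda>v. f (hchart j v))"
  shows "hom_lap f (affine_lift j v) = chart_lap (\<lambda>v. f (hchart j v)) v"
proof -
  define F where "F = (\<lambda>v. f (hchart j v))"
  have ld: "line_deriv2 f (affine_lift j v) (axis j p) =
    (\<Sum>a\<in>UNIV. \<Sum>b\<in>UNIV. rmulq p v $ a * rmulq p v $ b * partial_deriv a (partial_deriv b F) v)
    + (\<Sum>b\<in>UNIV. 2 * rmulq (p * p) v $ b * partial_deriv b F v)" for p
    using line_deriv2_j[OF f] by (simp add: F_def)
  have k: "(\<Sum>k\<in>UNIV. \<Sum>c\<in>UNIV. line_deriv2 f (affine_lift j v) (axis (affine_idx j k) (qe c)))
     = (\<Sum>a\<in>UNIV. partial_deriv a (partial_deriv a F) v)"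
  proof -
    have "(\<Sum>d\<in>UNIV. \<Sum>e\<in>UNIV. qc d (qe c) * qc e (qe c) * P d e) = P c c" for c and P :: "4 \<Rightarrow> 4 \<Rightarrow> real"
      unfolding qc_qe using four_cases[of c] by (elim disjE) (simp_all add: sum_four)
    then show ?thesis
      unfolding sum_pairs line_deriv2_affine_idx[OF f] F_def by simp
  qed
  have "(\<Sum>c\<in>UNIV. line_deriv2 f (affine_lift j v) (axis j (qe c)))
     = (\<Sum>a\<in>UNIV. \<Sum>b\<in>UNIV. quat_outer v a b * partial_deriv a (partial_deriv b F) v)
      + (\<Sum>b\<in>UNIV. 2 * (\<Sum>c\<in>UNIV. rmulq (qe c * qe c) v $ b) * partial_deriv b F v)"
  proof -
    have sw: "(\<Sum>c\<in>UNIV. \<Sum>a\<in>UNIV. \<Sum>b\<in>UNIV. G c a b) = (\<Sum>a\<in>UNIV. \<Sum>b\<in>UNIV. \<Sum>c\<in>UNIV. G c a b)"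
      for G :: "4 \<Rightarrow> 'n \<times> 4 \<Rightarrow> 'n \<times> 4 \<Rightarrow> real"
      by (subst sum.swap, intro sum.cong refl, rule sum.swap)
    have 1: "(\<Sum>c\<in>UNIV. \<Sum>a\<in>UNIV. \<Sum>b\<in>UNIV. JJ c v $ a * JJ c v $ b * partial_deriv a (partial_deriv b F) v)
      = (\<Sum>a\<in>UNIV. \<Sum>b\<in>UNIV. quat_outer v a b * partial_deriv a (partial_deriv b F) v)"
      unfolding sw quat_outer_def sum_distrib_right ..
    have 2: "(\<Sum>c\<in>UNIV. \<Sum>b\<in>UNIV. 2 * rmulq (qe c * qe c) v $ b * partial_deriv b F v)
      = (\<Sum>b\<in>UNIV. 2 * (\<Sum>c\<in>UNIV. rmulq (qe c * qe c) v $ b) * partial_deriv b F v)"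
      unfolding sum_distrib_left sum_distrib_right by (rule sum.swap)
    show ?thesis unfolding ld sum.distrib 1 2 ..
  qed
  also have "(\<Sum>b\<in>UNIV. 2 * (\<Sum>c\<in>UNIV. rmulq (qe c * qe c) v $ b) * partial_deriv b F v)
     = - 4 * (\<Sum>b\<in>UNIV. v $ b * partial_deriv b F v)"
  proof -
    have "(\<Sum>c\<in>UNIV. rmulq (qe c * qe c) v $ b) = - 2 * v $ b" for b
      by (simp add: sum_four qe_sq rmulq_minus_one rmulq_one)
    then have "(\<Sum>b\<in>UNIV. 2 * (\<Sum>c\<in>UNIV. rmulq (qe c * qe c) v $ b) * partial_deriv b F v) = (\<Sum>b\<in>UNIV. - 4 * (v $ b * partial_deriv b F v))"
      by (simp add: mult.assoc)
    then show ?thesis by (simp only: sum_distrib_left)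
  qed
  finally show ?thesis
    unfolding hom_lap_def sum_option[of _ j] k chart_lap_def norm_affine_lift_sq F_def by simp
qed

text \<open>
  The second derivative along a line is a quadratic form in the direction, although the lines with
  direction in the normalized coordinate are curved in the chart.
\<close>

lemma line_deriv2_quadratic:
  fixes f :: "'n::finite hproj \<Rightarrow> real"
  assumes f: "C2 (\<lambda>v. f (hchart j v))"
  shows "\<exists>B. \<forall>p. line_deriv2 f (affine_lift j v) (axis i p) = (\<Sum>d\<in>UNIV. \<Sum>e\<in>UNIV. qc d p * qc e p * B d e)"
proof (cases i rule: affine_idx_cases[of _ j])
  case (2 k)
  show ?thesis unfolding 2
    by (intro exI[of _ "\<lambda>d e. partial_deriv (k, d) (partial_deriv (k, e) (\<lambda>v. f (hchart j v))) v"] allI line_deriv2_affine_idx[OF f])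
next
  case 1
  define F where "F = (\<lambda>v. f (hchart j v))"
  define B where "B d e = (\<Sum>a\<in>UNIV. \<Sum>b\<in>UNIV. JJ d v $ a * JJ e v $ b * partial_deriv a (partial_deriv b F) v)
    + (\<Sum>b\<in>UNIV. 2 * rmulq (qe d * qe e) v $ b * partial_deriv b F v)" for d e
  have "line_deriv2 f (affine_lift j v) (axis j p) = (\<Sum>d\<in>UNIV. \<Sum>e\<in>UNIV. qc d p * qc e p * B d e)" for p
  proof -
    have r1: "rmulq p v $ a = (\<Sum>d\<in>UNIV. qc d p * JJ d v $ a)" for a
      unfolding rmulq_expand[of p] by simp
    have r2: "rmulq (p * p) v $ b = (\<Sum>d\<in>UNIV. \<Sum>e\<in>UNIV. qc d p * qc e p * rmulq (qe d * qe e) v $ b)" for b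
    proof -
      have "rmulq (p * p) v = rmulq p (rmulq p v)" by (simp add: rmulq_rmulq)
      also have "\<dots> = (\<Sum>e\<in>UNIV. qc e p *\<^sub>R JJ e (\<Sum>d\<in>UNIV. qc d p *\<^sub>R JJ d v))"
        unfolding rmulq_expand[of p, of "rmulq p v"] unfolding rmulq_expand[of p v] ..
      also have "\<dots> = (\<Sum>e\<in>UNIV. \<Sum>d\<in>UNIV. (qc d p * qc e p) *\<^sub>R rmulq (qe d * qe e) v)"
        by (simp add: linear_sum[OF linear_rmulq] linear_scale[OF linear_rmulq] rmulq_rmulq scaleR_sum_right mult.commute)
      finally show ?thesis by (subst sum.swap) simp
    qed
    have "(\<Sum>a\<in>UNIV. \<Sum>b\<in>UNIV. rmulq p v $ a * rmulq p v $ b * partial_deriv a (partial_deriv b F) v)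
       = (\<Sum>a\<in>UNIV. \<Sum>b\<in>UNIV. \<Sum>d\<in>UNIV. \<Sum>e\<in>UNIV. qc d p * qc e p * (JJ d v $ a * JJ e v $ b * partial_deriv a (partial_deriv b F) v))"
      unfolding r1 by (simp only: sum_product, simp only: sum_distrib_right, intro sum.cong refl, simp add: mult_ac)
    also have "\<dots> = (\<Sum>d\<in>UNIV. \<Sum>e\<in>UNIV. \<Sum>a\<in>UNIV. \<Sum>b\<in>UNIV. qc d p * qc e p * (JJ d v $ a * JJ e v $ b * partial_deriv a (partial_deriv b F) v))"
    proof -
      have "(\<Sum>a\<in>UNIV. \<Sum>b\<in>UNIV. \<Sum>d\<in>UNIV. \<Sum>e\<in>UNIV. G a b d e) = (\<Sum>d\<in>UNIV. \<Sum>e\<in>UNIV. \<Sum>a\<in>UNIV. \<Sum>b\<in>UNIV. G a b d e)"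
        for G :: "'n \<times> 4 \<Rightarrow> 'n \<times> 4 \<Rightarrow> 4 \<Rightarrow> 4 \<Rightarrow> real"
      proof -
        have "(\<Sum>a\<in>UNIV. \<Sum>b\<in>UNIV. \<Sum>d\<in>UNIV. \<Sum>e\<in>UNIV. G a b d e) = (\<Sum>x\<in>UNIV. \<Sum>y\<in>UNIV. G (fst x) (snd x) (fst y) (snd y))"
          by (simp add: sum_pairs)
        also have "\<dots> = (\<Sum>y\<in>UNIV. \<Sum>x\<in>UNIV. G (fst x) (snd x) (fst y) (snd y))" by (rule sum.swap)
        finally show ?thesis by (simp add: sum_pairs)
      qed
      then show ?thesis .
    qed
    finally have 1: "(\<Sum>a\<in>UNIV. \<Sum>b\<in>UNIV. rmulq p v $ a * rmulq p v $ b * partial_deriv a (partial_deriv b F) v)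
       = (\<Sum>d\<in>UNIV. \<Sum>e\<in>UNIV. qc d p * qc e p * (\<Sum>a\<in>UNIV. \<Sum>b\<in>UNIV. JJ d v $ a * JJ e v $ b * partial_deriv a (partial_deriv b F) v))"
      by (simp add: sum_distrib_left)
    have sw: "(\<Sum>b\<in>UNIV. \<Sum>d\<in>UNIV. \<Sum>e\<in>UNIV. G b d e) = (\<Sum>d\<in>UNIV. \<Sum>e\<in>UNIV. \<Sum>b\<in>UNIV. G b d e)"
      for G :: "'n \<times> 4 \<Rightarrow> 4 \<Rightarrow> 4 \<Rightarrow> real"
      by (subst sum.swap, intro sum.cong refl, rule sum.swap)
    have 2: "(\<Sum>b\<in>UNIV. 2 * rmulq (p * p) v $ b * partial_deriv b F v)
       = (\<Sum>d\<in>UNIV. \<Sum>e\<in>UNIV. qc d p * qc e p * (\<Sum>b\<in>UNIV. 2 * rmulq (qe d * qe e) v $ b * partial_deriv b F v))"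
      unfolding r2 sum_distrib_left sum_distrib_right sw by (intro sum.cong refl) (simp add: mult_ac)
    show ?thesis
      using line_deriv2_j[OF f, of v p] 1 2
      by (simp add: F_def[symmetric] B_def distrib_left sum.distrib)
  qed
  then show ?thesis unfolding 1 by blast
qed

text \<open>
  The quaternions \<open>qe c * q\<close> are orthogonal and have the length of \<open>q\<close>, so they can replace the units
  in the computation of the trace of a quadratic form.
\<close>

lemma trace_quat_scale:
  "(\<Sum>c\<in>UNIV. \<Sum>d\<in>UNIV. \<Sum>e\<in>UNIV. qc d (qe c * q) * qc e (qe c * q) * B d e) = (norm q)\<^sup>2 * (\<Sum>d\<in>UNIV. B d d)"
proof -
  have o: "(\<Sum>c\<in>UNIV. qc d (qe c * q) * qc e (qe c * q)) = (if d = e then (norm q)\<^sup>2 else 0)" for d e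
    using four_cases[of d] four_cases[of e] unfolding norm_quat_sq
    by (elim disjE) (simp_all add: sum_four qc_def qe_def times_quat_def power2_eq_square)
  have sw: "(\<Sum>c\<in>UNIV. \<Sum>d\<in>UNIV. \<Sum>e\<in>UNIV. G c d e) = (\<Sum>d\<in>UNIV. \<Sum>e\<in>UNIV. \<Sum>c\<in>UNIV. G c d e)"
    for G :: "4 \<Rightarrow> 4 \<Rightarrow> 4 \<Rightarrow> real"
  proof -
    have "(\<Sum>c\<in>UNIV. \<Sum>d\<in>UNIV. \<Sum>e\<in>UNIV. G c d e) = (\<Sum>d\<in>UNIV. \<Sum>c\<in>UNIV. \<Sum>e\<in>UNIV. G c d e)" by (rule sum.swap)
    also have "\<dots> = (\<Sum>d\<in>UNIV. \<Sum>e\<in>UNIV. \<Sum>c\<in>UNIV. G c d e)" by (rule sum.cong[OF refl], rule sum.swap)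
    finally show ?thesis .
  qed
  have "(\<Sum>c\<in>UNIV. \<Sum>d\<in>UNIV. \<Sum>e\<in>UNIV. qc d (qe c * q) * qc e (qe c * q) * B d e)
     = (\<Sum>d\<in>UNIV. \<Sum>e\<in>UNIV. (\<Sum>c\<in>UNIV. qc d (qe c * q) * qc e (qe c * q)) * B d e)"
    unfolding sum_distrib_right by (rule sw)
  also have "\<dots> = (\<Sum>d\<in>UNIV. \<Sum>e\<in>UNIV. if d = e then (norm q)\<^sup>2 * B d e else 0)"
    unfolding o by (intro sum.cong refl) simp
  finally show ?thesis by (simp add: sum_distrib_left)
qed

text \<open>
  Scaling the representative by \<open>q\<close> multiplies the directions by \<open>q\<^sup>-\<^sup>1\<close> from the right; by
  \<open>trace_quat_scale\<close> this is compensated by the factor \<open>|x|\<^sup>2\<close>.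
\<close>

lemma hom_lap_hscale:
  fixes f :: "'n::finite hproj \<Rightarrow> real"
  assumes f: "C2 (\<lambda>v. f (hchart j v))" and q: "q \<noteq> 0"
  shows "hom_lap f (hscale (affine_lift j v) q) = hom_lap f (affine_lift j v)"
proof -
  define x where "x = affine_lift j v"
  have l: "line_deriv2 f (hscale x q) (axis i p) = line_deriv2 f x (axis i (p * inverse q))" for i p
  proof -
    have "hscale x q + s *\<^sub>R axis i p = hscale (x + s *\<^sub>R axis i (p * inverse q)) q" for s
      using q by (simp add: vec_eq_iff axis_def distrib_right mult.assoc)
    then show ?thesis using q by (simp add: line_deriv2_def abs_hproj_hscale)
  qed
  have t: "(\<Sum>c\<in>UNIV. line_deriv2 f x (axis i (qe c * inverse q))) = (norm (inverse q))\<^sup>2 * (\<Sum>c\<in>UNIV. line_deriv2 f x (axis i (qe c)))" for i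
  proof -
    obtain B where B: "\<And>p. line_deriv2 f x (axis i p) = (\<Sum>d\<in>UNIV. \<Sum>e\<in>UNIV. qc d p * qc e p * B d e)"
      using line_deriv2_quadratic[OF f] unfolding x_def by blast
    have one: "(\<Sum>c\<in>UNIV. line_deriv2 f x (axis i (qe c))) = (\<Sum>d\<in>UNIV. B d d)"
      using trace_quat_scale[of 1 B] unfolding B by simp
    show ?thesis unfolding one unfolding B trace_quat_scale ..
  qed
  have "(norm q)\<^sup>2 * (norm (inverse q))\<^sup>2 = 1"
    using q by (simp add: power_mult_distrib[symmetric] norm_mult[symmetric])
  then have "(norm x * norm q)\<^sup>2 * ((norm (inverse q))\<^sup>2 * X) = (norm x)\<^sup>2 * X" for X
    by (simp add: power_mult_distrib mult.assoc[symmetric])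
  then show ?thesis
    unfolding x_def[symmetric] hom_lap_def l t norm_hscale sum_distrib_left[symmetric] .
qed

text \<open>
  Whichever chart the choice in the definition of \<open>fs_laplacian\<close> selects, the value is \<open>hom_lap\<close> at
  some representative of the point.
\<close>

lemma fs_laplacian_hchart:
  fixes f :: "'n::finite hproj \<Rightarrow> real"
  assumes f: "\<And>j. C2 (\<lambda>v. f (hchart j v))"
  shows "fs_laplacian f (hchart j v) = chart_lap (\<lambda>w. f (hchart j w)) v"
proof -
  define p where "p = hchart j v"
  obtain k w where kw: "(SOME (j, v). hchart j v = p) = (k, w)" by fastforce
  have "case (SOME (j, v). hchart j v = p) of (j, v) \<Rightarrow> hchart j v = p"
    by (rule someI[of _ "(j, v)"]) (simp add: p_def)
  then have e: "hchart k w = p" by (simp add: kw)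
  have "fs_laplacian f p = laplace_beltrami (fs_metric k) (\<lambda>w. f (hchart k w)) w"
    by (simp add: fs_laplacian_def kw)
  also have "\<dots> = hom_lap f (affine_lift k w)"
    using laplace_beltrami_eq_chart_lap(1)[OF f] hom_lap_eq_chart_lap[OF f] by simp
  also have "\<dots> = hom_lap f (affine_lift j v)"
  proof -
    have "same_line (affine_lift j v) (affine_lift k w)"
      using e by (intro abs_hproj_eqD affine_lift_nonzero) (simp add: p_def hchart_def)
    then obtain q where "q \<noteq> 0" "affine_lift k w = hscale (affine_lift j v) q"
      by (auto simp: same_line_def)
    then show ?thesis using hom_lap_hscale[OF f] by simp
  qed
  also have "\<dots> = chart_lap (\<lambda>w. f (hchart j w)) v" by (rule hom_lap_eq_chart_lap[OF f])
  finally show ?thesis by (simp add: p_def)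
qed

section \<open>Rational functions in a chart\<close>

lemma C2_if_Ck_on: "Ck_on 2 UNIV f \<Longrightarrow> C2 f"
  for f :: "real ^ 'm::finite \<Rightarrow> real"
proof -
  assume "Ck_on 2 UNIV f"
  then have 1: "\<forall>x. f differentiable at x" and 2: "\<forall>b\<in>Basis. Ck_on 1 UNIV (\<lambda>x. frechet_derivative f (at x) b)"
    by (simp_all add: numeral_2_eq_2)
  have ax: "axis a (1::real) \<in> Basis" for a :: 'm by (auto simp: Basis_vec_def)
  have 3: "Ck_on 1 UNIV (partial_deriv a f)" for a
    using bspec[OF 2 ax, of a] unfolding partial_deriv_def[abs_def] .
  have "partial_deriv a f differentiable at x" for a x using 3[of a] by simp
  moreover have "continuous_on UNIV (partial_deriv a (partial_deriv b f))" for a b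
  proof -
    have "\<forall>c\<in>Basis. Ck_on 0 UNIV (\<lambda>x. frechet_derivative (partial_deriv b f) (at x) c)" using 3[of b] by simp
    then show ?thesis using ax unfolding partial_deriv_def[of a, abs_def] by simp
  qed
  ultimately show "C2 f" using 1 by (simp add: C2_def)
qed

lemma partial_deriv_mult:
  assumes "f differentiable at v" "g differentiable at v"
  shows "partial_deriv a (\<lambda>w. f w * g w) v = f v * partial_deriv a g v + partial_deriv a f v * g v"
proof -
  obtain F G where F: "(f has_derivative F) (at v)" and G: "(g has_derivative G) (at v)"
    using assms unfolding differentiable_def by blast
  show ?thesis unfolding partial_deriv_eq[OF has_derivative_mult[OF F G]] partial_deriv_eq[OF F] partial_deriv_eq[OF G] ..
qed

lemma partial_deriv_add:
  assumes "f differentiable at v" "g differentiable at v"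
  shows "partial_deriv a (\<lambda>w. f w + g w) v = partial_deriv a f v + partial_deriv a g v"
proof -
  obtain F G where F: "(f has_derivative F) (at v)" and G: "(g has_derivative G) (at v)"
    using assms unfolding differentiable_def by blast
  show ?thesis unfolding partial_deriv_eq[OF has_derivative_add[OF F G]] partial_deriv_eq[OF F] partial_deriv_eq[OF G] ..
qed

lemma C2_mult:
  assumes f: "C2 f" and g: "C2 g"
  shows "C2 (\<lambda>v. f v * g v)"
    and "partial_deriv a (partial_deriv b (\<lambda>v. f v * g v)) v =
      f v * partial_deriv a (partial_deriv b g) v + partial_deriv a f v * partial_deriv b g v
      + (partial_deriv b f v * partial_deriv a g v + partial_deriv a (partial_deriv b f) v * g v)"
proof -
  note df = C2_D(1,2)[OF f] and dg = C2_D(1,2)[OF g]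
  have 1: "partial_deriv b (\<lambda>v. f v * g v) = (\<lambda>v. f v * partial_deriv b g v + partial_deriv b f v * g v)" for b
    using partial_deriv_mult[OF df(1) dg(1)] by blast
  have 2: "partial_deriv a (partial_deriv b (\<lambda>v. f v * g v)) v =
      f v * partial_deriv a (partial_deriv b g) v + partial_deriv a f v * partial_deriv b g v
      + (partial_deriv b f v * partial_deriv a g v + partial_deriv a (partial_deriv b f) v * g v)" for a b v
    unfolding 1
    by (subst partial_deriv_add, (intro differentiable_mult df dg)+, simp add: partial_deriv_mult df dg)
  then show "partial_deriv a (partial_deriv b (\<lambda>v. f v * g v)) v =
      f v * partial_deriv a (partial_deriv b g) v + partial_deriv a f v * partial_deriv b g v
      + (partial_deriv b f v * partial_deriv a g v + partial_deriv a (partial_deriv b f) v * g v)" .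
  have 3: "partial_deriv a (partial_deriv b (\<lambda>v. f v * g v)) = (\<lambda>v.
      f v * partial_deriv a (partial_deriv b g) v + partial_deriv a f v * partial_deriv b g v
      + (partial_deriv b f v * partial_deriv a g v + partial_deriv a (partial_deriv b f) v * g v))" for a b
    using 2 by blast
  show "C2 (\<lambda>v. f v * g v)"
    unfolding C2_def
  proof (intro conjI allI)
    show "(\<lambda>v. f v * g v) differentiable at v" for v by (intro differentiable_mult df dg)
    show "partial_deriv b (\<lambda>v. f v * g v) differentiable at v" for b v
      unfolding 1 by (intro differentiable_add differentiable_mult df dg)
    show "continuous_on UNIV (partial_deriv a (partial_deriv b (\<lambda>v. f v * g v)))" for a b
      unfolding 3 by (intro continuous_intros C2_continuous C2_D f g)
  qed
qed

lemma coord_derivative: "((\<lambda>v. v $ b) has_derivative (\<lambda>h. h $ b)) (at v)" for v :: "real ^ 'm::finite"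
  by (rule linear_imp_has_derivative) (simp add: linear_iff)

text \<open>
  A class of rational functions that is closed under partial derivatives and contains all coefficients
  and test functions; membership implies smoothness.
\<close>

inductive ratf :: "(real ^ ('n::finite \<times> 4) \<Rightarrow> real) \<Rightarrow> bool" where
  ratf_const: "ratf (\<lambda>_. c)"
| ratf_coord: "ratf (\<lambda>v. v $ a)"
| ratf_add: "ratf f \<Longrightarrow> ratf g \<Longrightarrow> ratf (\<lambda>v. f v + g v)"
| ratf_mult: "ratf f \<Longrightarrow> ratf g \<Longrightarrow> ratf (\<lambda>v. f v * g v)"
| ratf_inverse: "ratf (\<lambda>v. inverse (rr v))"

lemma ratf_power: "ratf f \<Longrightarrow> ratf (\<lambda>v. f v ^ k)"
  by (induction k) (auto intro: ratf.intros)

lemma ratf_sum: "(\<And>x. x \<in> A \<Longrightarrow> ratf (f x)) \<Longrightarrow> ratf (\<lambda>v. \<Sum>x\<in>A. f x v)"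
  by (induction A rule: infinite_finite_induct) (auto intro: ratf.intros)

lemma ratf_derivative:
  "ratf f \<Longrightarrow> (\<forall>v. f differentiable at v) \<and> (\<forall>a. ratf (partial_deriv a f))"
proof (induction rule: ratf.induct)
  case (ratf_const c)
  have "partial_deriv a (\<lambda>_. c) = (\<lambda>_::real ^ ('a \<times> 4). 0)" for a
    using partial_deriv_eq[OF has_derivative_const] by blast
  then show ?case by (auto intro: ratf.intros)
next
  case (ratf_coord b)
  have "partial_deriv a (\<lambda>v. v $ b) = (\<lambda>_::real ^ ('a \<times> 4). axis a 1 $ b)" for a
    using partial_deriv_eq[OF coord_derivative] by blast
  then show ?case using differentiableI[OF coord_derivative] by (auto intro: ratf.intros simp: differentiable_def)
next
  case (ratf_add f g)
  then have "partial_deriv a (\<lambda>v. f v + g v) = (\<lambda>v. partial_deriv a f v + partial_deriv a g v)" for a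
    using partial_deriv_add by blast
  then show ?case using ratf_add by (auto intro: ratf.intros)
next
  case (ratf_mult f g)
  then have "partial_deriv a (\<lambda>v. f v * g v) = (\<lambda>v. f v * partial_deriv a g v + partial_deriv a f v * g v)" for a
    using partial_deriv_mult by blast
  then show ?case using ratf_mult by (auto intro!: ratf.intros differentiable_mult)
next
  case ratf_inverse
  have d: "((\<lambda>v. inverse (rr v)) has_derivative (\<lambda>h. - (inverse (rr v) * (2 * (v \<bullet> h)) * inverse (rr v)))) (at v)" for v :: "real ^ ('a \<times> 4)"
    using Deriv.has_derivative_inverse[OF _ rr_has_derivative[of v]] rr_pos[of v] by simp
  have "partial_deriv a (\<lambda>v. inverse (rr v)) = (\<lambda>v::real ^ ('a \<times> 4). (- 2) * (v $ a * (inverse (rr v) * inverse (rr v))))" for a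
    using partial_deriv_eq[OF d] by (auto simp: fun_eq_iff inner_axis)
  moreover have "ratf (\<lambda>v::real ^ ('a \<times> 4). (- 2) * (v $ a * (inverse (rr v) * inverse (rr v))))" for a
    by (intro ratf.intros)
  ultimately have "ratf (partial_deriv a (\<lambda>v::real ^ ('a \<times> 4). inverse (rr v)))" for a by metis
  then show ?case using d by (auto simp: differentiable_def)
qed

lemma ratf_smooth: "ratf f \<Longrightarrow> smooth_on UNIV f"
  unfolding smooth_on_def
proof
  fix k show "ratf f \<Longrightarrow> Ck_on k UNIV f"
  proof (induction k arbitrary: f)
    case 0
    then show ?case using ratf_derivative[OF 0] by (auto intro!: differentiable_UNIV_continuous)
  next
    case (Suc k)
    have "Ck_on k UNIV (\<lambda>x. frechet_derivative f (at x) b)" if bB: "b \<in> Basis" for b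
    proof -
      obtain a u where "u \<in> Basis" "b = axis a (u :: real)" using bB unfolding Basis_vec_def by blast
      then have "b = axis a 1" by simp
      then have "(\<lambda>x. frechet_derivative f (at x) b) = partial_deriv a f" by (auto simp: partial_deriv_def)
      moreover have "ratf (partial_deriv a f)" using ratf_derivative[OF Suc.prems] by blast
      ultimately show ?thesis using Suc.IH by simp
    qed
    then show ?case using ratf_derivative[OF Suc.prems] by simp
  qed
qed

lemma ratf_C2: "ratf f \<Longrightarrow> C2 f"
  using ratf_smooth C2_if_Ck_on unfolding smooth_on_def by blast

section \<open>Powers of the squared cosine of the distance\<close>

text \<open>
  The squared cosine of the distance between the points represented by \<open>X\<close> and by the unit vector
  \<open>Y\<close>.
\<close>

definition cossq_rep :: "quat ^ 'm::finite \<Rightarrow> quat ^ 'm \<Rightarrow> real" where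
  "cossq_rep Y X = (norm (hinner Y X))\<^sup>2 / (norm X)\<^sup>2"

lemma hproj_rep: obtains X :: "quat ^ ('n::finite) option" where "X \<noteq> 0" "abs_hproj X = p" "norm X = 1"
proof -
  define Z where "Z = rep_hproj p"
  have Z: "abs_hproj Z = p" unfolding Z_def by (rule Quotient_abs_rep[OF Quotient_hproj])
  have "same_line Z Z" unfolding Z_def by (rule Quotient_rep_reflp[OF Quotient_hproj])
  then have Z0: "Z \<noteq> 0" by (simp add: same_line_def)
  define X where "X = hscale Z (inverse (norm Z) *\<^sub>R 1)"
  have "norm X = 1" using Z0 by (simp add: X_def norm_hscale)
  moreover have "abs_hproj X = p" unfolding X_def using Z Z0 by (subst abs_hproj_hscale) auto
  ultimately show ?thesis using that[of X] by force
qed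

lemma qcnj_hinner: "qcnj (hinner x y) = hinner y x"
  by (simp add: hinner_def qcnj_sum qcnj_mult qcnj_qcnj)

lemma norm_hinner_sym: "norm (hinner x y) = norm (hinner y x)"
  using norm_qcnj[of "hinner x y"] by (simp add: qcnj_hinner)

lemma norm_hinner_le: "norm (hinner x y) \<le> norm x * norm y"
proof -
  have "norm (hinner x y) \<le> (\<Sum>i\<in>UNIV. norm (x $ i) * norm (y $ i))"
    unfolding hinner_def by (rule order_trans[OF norm_sum]) (simp add: norm_mult norm_qcnj)
  also have "\<dots> \<le> norm x * norm y"
    unfolding norm_vec_def by (rule order_trans[OF sum_mono L2_set_mult_ineq]) simp
  finally show ?thesis .
qed

lemma cos_fs_dist_sq:
  assumes "X \<noteq> 0" "norm Y = 1"
  shows "(cos (fs_dist (abs_hproj X) (abs_hproj Y)))\<^sup>2 = cossq_rep Y X"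
    and "0 \<le> cossq_rep Y X" "cossq_rep Y X \<le> 1"
proof -
  have Y: "Y \<noteq> 0" using assms by auto
  have 1: "norm (hinner X Y) / (norm X * norm Y) \<le> 1"
    using norm_hinner_le[of X Y] assms by (simp add: divide_le_eq)
  have 2: "0 \<le> norm (hinner X Y) / (norm X * norm Y)" by simp
  have 3: "fs_dist (abs_hproj X) (abs_hproj Y) = arccos (norm (hinner X Y) / (norm X * norm Y))"
    by (rule fs_dist.abs_eq) (use assms Y same_line_refl in auto)
  have "cos (fs_dist (abs_hproj X) (abs_hproj Y)) = norm (hinner X Y) / (norm X * norm Y)"
    unfolding 3 using 1 order_trans[OF _ 2, of "-1"] by (intro cos_arccos) auto
  moreover have "(norm (hinner X Y) / (norm X * norm Y))\<^sup>2 = cossq_rep Y X"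
    unfolding cossq_rep_def norm_hinner_sym[of X Y] using assms by (simp add: power_divide)
  ultimately show 4: "(cos (fs_dist (abs_hproj X) (abs_hproj Y)))\<^sup>2 = cossq_rep Y X" by simp
  show "0 \<le> cossq_rep Y X" "cossq_rep Y X \<le> 1" unfolding 4[symmetric] by (simp_all add: abs_square_le_1)
qed

lemma hinner_add_right: "hinner Y (x + z) = hinner Y x + hinner Y z"
  by (simp add: hinner_def distrib_left sum.distrib)

lemma hinner_scaleR_right: "hinner Y (r *\<^sub>R x) = r *\<^sub>R hinner Y x"
  by (simp add: hinner_def scaleR_sum_right)

lemma hinner_axis: "hinner Y (axis i p) = qcnj (Y $ i) * p"
proof -
  have "hinner Y (axis i p) = (\<Sum>k\<in>UNIV. if k = i then qcnj (Y $ i) * p else 0)"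
    unfolding hinner_def by (intro sum.cong) (auto simp: axis_def)
  then show ?thesis by simp
qed

lemma cossq_rep_affine_ratf: "ratf (\<lambda>v. cossq_rep Y (affine_lift j v))"
proof -
  have q: "qc c (qcnj p * q) = (\<Sum>d\<in>UNIV. qc c (qcnj p * qe d) * qc d q)" for c p q
  proof -
    have "qc c (qcnj p * q) = qc c (qcnj p * (\<Sum>d\<in>UNIV. qc d q *\<^sub>R qe d))" using quat_expand[of q] by simp
    then show ?thesis by (simp add: sum_distrib_left qc_sum mult.commute)
  qed
  have h: "qc c (hinner Y (affine_lift j v)) = qc c (qcnj (Y $ j)) +
     (\<Sum>k\<in>UNIV. \<Sum>d\<in>UNIV. qc c (qcnj (Y $ affine_idx j k) * qe d) * v $ (k, d))" for c v
    by (simp add: hinner_def sum_option[of _ j] qc_sum q[of _ _ "quat_coord _ _"])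
  have "cossq_rep Y (affine_lift j v) = (\<Sum>c\<in>UNIV. (qc c (hinner Y (affine_lift j v)))\<^sup>2) * inverse (rr v)" for v
    unfolding cossq_rep_def norm_affine_lift_sq norm_quat_sq_qc divide_inverse ..
  then have e: "(\<lambda>v. cossq_rep Y (affine_lift j v)) = (\<lambda>v. (\<Sum>c\<in>UNIV. (qc c (qcnj (Y $ j)) +
     (\<Sum>k\<in>UNIV. \<Sum>d\<in>UNIV. qc c (qcnj (Y $ affine_idx j k) * qe d) * v $ (k, d)))\<^sup>2) * inverse (rr v))"
    unfolding h by blast
  show ?thesis unfolding e
    by (intro ratf_mult ratf_inverse ratf_sum ratf_power ratf_add ratf_const ratf_coord)
qed

text \<open>
  Along a line in homogeneous coordinates the numerator and the denominator of \<open>cossq_rep\<close> are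
  quadratic polynomials (\<open>cossq_rep_line\<close>).
\<close>

lemma deriv2_power_quotient:
  fixes p0 p1 p2 q0 q1 q2 :: real
  assumes q0: "q0 \<noteq> 0"
  defines "U0 \<equiv> p0 / q0" and "U1 \<equiv> (p1 * q0 - p0 * q1) / q0\<^sup>2"
    and "U2 \<equiv> 2 * p2 / q0 - 2 * p1 * q1 / q0\<^sup>2 - 2 * p0 * q2 / q0\<^sup>2 + 2 * p0 * q1\<^sup>2 / q0 ^ 3"
  shows "deriv (deriv (\<lambda>s. ((p0 + p1 * s + p2 * s\<^sup>2) / (q0 + q1 * s + q2 * s\<^sup>2)) ^ N)) 0
      = real N * U0 ^ (N - 1) * U2 + real N * real (N - 1) * U0 ^ (N - 2) * U1\<^sup>2"
    and "((\<lambda>s. (p0 + p1 * s + p2 * s\<^sup>2) / (q0 + q1 * s + q2 * s\<^sup>2)) has_real_derivative U1) (at 0)"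
proof -
  define p q where "p s = p0 + p1 * s + p2 * s\<^sup>2" and "q s = q0 + q1 * s + q2 * s\<^sup>2" for s
  define U' where "U' s = ((p1 + 2 * p2 * s) * q s - p s * (q1 + 2 * q2 * s)) / (q s * q s)" for s
  have z: "p 0 = p0" "q 0 = q0" by (simp_all add: p_def q_def)
  have dp: "(p has_real_derivative p1 + 2 * p2 * s) (at s)" for s
    unfolding p_def by (auto intro!: derivative_eq_intros)
  have dq: "(q has_real_derivative q1 + 2 * q2 * s) (at s)" for s
    unfolding q_def by (auto intro!: derivative_eq_intros)
  have dU: "((\<lambda>s. p s / q s) has_real_derivative U' s) (at s)" if "q s \<noteq> 0" for s
    unfolding U'_def by (rule DERIV_divide[OF dp dq that])
  have "isCont q 0" using dq by (rule DERIV_isCont)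
  then have "(q \<longlongrightarrow> q 0) (nhds 0)" by (simp add: isCont_def tendsto_nhds_iff)
  then have ne: "eventually (\<lambda>s. q s \<noteq> 0) (nhds 0)"
    by (rule tendsto_imp_eventually_ne) (simp add: z q0)
  have U'0: "U' 0 = U1" by (simp add: U'_def U1_def z power2_eq_square)
  show "((\<lambda>s. (p0 + p1 * s + p2 * s\<^sup>2) / (q0 + q1 * s + q2 * s\<^sup>2)) has_real_derivative U1) (at 0)"
    using dU[of 0] q0 unfolding U'0 by (simp add: p_def q_def)
  have "eventually (\<lambda>s. deriv (\<lambda>s. (p s / q s) ^ N) s = real N * (p s / q s) ^ (N - 1) * U' s) (nhds 0)"
    using ne by eventually_elim (rule DERIV_imp_deriv, rule DERIV_cong[OF DERIV_power[OF dU]], auto)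
  then have "deriv (deriv (\<lambda>s. (p s / q s) ^ N)) 0 = deriv (\<lambda>s. real N * (p s / q s) ^ (N - 1) * U' s) 0"
    by (rule deriv_cong_ev) simp
  also have "\<dots> = real N * U0 ^ (N - 1) * U2 + real N * real (N - 1) * U0 ^ (N - 2) * U1\<^sup>2"
  proof (rule DERIV_imp_deriv)
    have d1: "((\<lambda>s. (p1 + 2 * p2 * s) * q s - p s * (q1 + 2 * q2 * s)) has_real_derivative 2 * p2 * q0 - 2 * p0 * q2) (at 0)"
      by (auto intro!: derivative_eq_intros dp dq simp: z)
    have d2: "((\<lambda>s. q s * q s) has_real_derivative 2 * q0 * q1) (at 0)"
      by (auto intro!: derivative_eq_intros dq simp: z)
    have "(U' has_real_derivative ((2 * p2 * q0 - 2 * p0 * q2) * (q 0 * q 0) - ((p1 + 2 * p2 * 0) * q 0 - p 0 * (q1 + 2 * q2 * 0)) * (2 * q0 * q1)) / ((q 0 * q 0) * (q 0 * q 0))) (at 0)"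
      unfolding U'_def by (rule DERIV_divide[OF d1 d2]) (use q0 z in auto)
    moreover have "((2 * p2 * q0 - 2 * p0 * q2) * (q 0 * q 0) - ((p1 + 2 * p2 * 0) * q 0 - p 0 * (q1 + 2 * q2 * 0)) * (2 * q0 * q1)) / ((q 0 * q 0) * (q 0 * q 0)) = U2"
      unfolding z U2_def using q0 by (simp add: divide_simps power2_eq_square power3_eq_cube) (simp add: algebra_simps)
    ultimately have d3: "(U' has_real_derivative U2) (at 0)" by simp
    have d4: "((\<lambda>s. (p s / q s) ^ (N - 1)) has_real_derivative real (N - 1) * (U' 0 * (p 0 / q 0) ^ (N - 1 - Suc 0))) (at 0)"
      by (rule DERIV_power[OF dU]) (simp add: z q0)
    show "((\<lambda>s. real N * (p s / q s) ^ (N - 1) * U' s) has_real_derivative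
       real N * U0 ^ (N - 1) * U2 + real N * real (N - 1) * U0 ^ (N - 2) * U1\<^sup>2) (at 0)"
      by (rule DERIV_cong[OF DERIV_mult[OF DERIV_cmult[OF d4, of "real N"] d3]])
         (simp add: U'0 z U0_def numeral_2_eq_2 mult_ac)
  qed
  finally show "deriv (deriv (\<lambda>s. ((p0 + p1 * s + p2 * s\<^sup>2) / (q0 + q1 * s + q2 * s\<^sup>2)) ^ N)) 0
      = real N * U0 ^ (N - 1) * U2 + real N * real (N - 1) * U0 ^ (N - 2) * U1\<^sup>2"
    unfolding p_def q_def .
qed

definition qdot :: "quat \<Rightarrow> quat \<Rightarrow> real" where
  "qdot p q = (\<Sum>c\<in>UNIV. qc c p * qc c q)"

lemma norm_add_sq_quat: "(norm (a + s *\<^sub>R b))\<^sup>2 = (norm a)\<^sup>2 + 2 * qdot a b * s + (norm b)\<^sup>2 * s\<^sup>2" for a b :: quat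
  unfolding norm_quat_sq_qc qdot_def sum_distrib_left sum_distrib_right sum.distrib[symmetric]
  by (intro sum.cong refl) (simp add: power2_eq_square algebra_simps)

lemma norm_add_sq_vec: "(norm (x + s *\<^sub>R b))\<^sup>2 = (norm x)\<^sup>2 + 2 * (\<Sum>i\<in>UNIV. qdot (x $ i) (b $ i)) * s + (norm b)\<^sup>2 * s\<^sup>2"
  for x b :: "quat ^ 'm::finite"
  unfolding norm_quat_vec_sq by (simp add: norm_add_sq_quat sum.distrib sum_distrib_left sum_distrib_right)

lemma cossq_rep_line:
  "cossq_rep Y (x + s *\<^sub>R b) = ((norm (hinner Y x))\<^sup>2 + (2 * qdot (hinner Y x) (hinner Y b)) * s + (norm (hinner Y b))\<^sup>2 * s\<^sup>2) /
     ((norm x)\<^sup>2 + (2 * (\<Sum>i\<in>UNIV. qdot (x $ i) (b $ i))) * s + (norm b)\<^sup>2 * s\<^sup>2)"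
  unfolding cossq_rep_def hinner_add_right hinner_scaleR_right norm_add_sq_quat norm_add_sq_vec ..

text \<open>
  Summed over all directions, the coefficients of the quadratic polynomials become squared norms and
  inner products of \<open>x\<close>, \<open>Y\<close> and the projection \<open>hscale Y (hinner Y x)\<close> of \<open>x\<close>.
\<close>

lemma sum_cossq_rep_second_derivs:
  fixes x Y :: "quat ^ 'm::finite"
  assumes x: "x \<noteq> 0" and Y: "norm Y = 1"
  shows "(norm x)\<^sup>2 * (\<Sum>i\<in>UNIV. \<Sum>c\<in>UNIV. deriv (deriv (\<lambda>s. cossq_rep Y (x + s *\<^sub>R axis i (qe c)) ^ N)) 0)
    = 4 * real N * (real N + 1) * cossq_rep Y x ^ (N - 1) - 4 * real N * (real N + 2 * real CARD('m) - 1) * cossq_rep Y x ^ N"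
proof -
  define A q0 G where "A = hinner Y x" and "q0 = (norm x)\<^sup>2" and "G = (norm A)\<^sup>2"
  define a b where "a i c = qc c (Y $ i * A)" and "b i c = qc c (x $ i)" for i c
  have q0: "q0 \<noteq> 0" "q0 > 0" using x by (simp_all add: q0_def)
  have l1: "qdot A (hinner Y (axis i (qe c))) = a i c" for i c
  proof -
    have "qdot A (qcnj y * qe c) = qc c (y * A)" for y
      using four_cases[of c] by (elim disjE) (simp_all add: qdot_def sum_four qc_def qe_def times_quat_def qcnj_def algebra_simps)
    then show ?thesis by (simp add: hinner_axis a_def)
  qed
  have l2: "(\<Sum>k\<in>UNIV. qdot (x $ k) (axis i (qe c) $ k)) = b i c" for i c
  proof -
    have "qdot q (qe c) = qc c q" for q
      unfolding qdot_def qc_qe by (simp add: if_distrib[of "\<lambda>z. _ * z"] cong: if_cong)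
    moreover have "qdot q 0 = 0" for q by (simp add: qdot_def)
    ultimately have "qdot (x $ k) (axis i (qe c) $ k) = (if k = i then qc c (x $ i) else 0)" for k
      by (simp add: axis_def)
    then show ?thesis by (simp add: b_def)
  qed
  have l3: "norm (hinner Y (axis i (qe c))) = norm (Y $ i)" for i c
    by (simp add: hinner_axis norm_mult norm_qcnj norm_qe)
  have l4: "norm (axis i (qe c) :: quat ^ 'm) = 1" for i c
  proof -
    have "(norm (axis i (qe c) :: quat ^ 'm))\<^sup>2 = (\<Sum>k\<in>UNIV. (norm ((axis i (qe c) :: quat ^ 'm) $ k))\<^sup>2)"
      by (rule norm_quat_vec_sq)
    also have "\<dots> = (\<Sum>k\<in>UNIV. if k = i then 1 else 0)" by (rule sum.cong) (auto simp: axis_def norm_qe)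
    finally have "(norm (axis i (qe c) :: quat ^ 'm))\<^sup>2 = 1" by simp
    then show ?thesis by (simp add: power2_eq_1_iff) (metis norm_ge_zero not_one_le_zero le_minus_iff minus_zero order_trans zero_le_one)
  qed
  note n = norm_quat_vec_sq
  have s1: "(\<Sum>i\<in>UNIV. \<Sum>c\<in>UNIV. (a i c)\<^sup>2) = G"
    unfolding a_def norm_quat_sq_qc[symmetric] norm_mult power_mult_distrib sum_distrib_right[symmetric] n[symmetric]
    by (simp add: Y G_def)
  have s2: "(\<Sum>i\<in>UNIV. \<Sum>c\<in>UNIV. (b i c)\<^sup>2) = q0"
    unfolding b_def norm_quat_sq_qc[symmetric] n[symmetric] q0_def ..
  have s3: "(\<Sum>i\<in>(UNIV :: 'm set). \<Sum>c\<in>(UNIV :: 4 set). (norm (Y $ i))\<^sup>2) = 4"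
    by (simp add: sum_distrib_left[symmetric] n[symmetric] Y)
  have s4: "(\<Sum>i\<in>UNIV. \<Sum>c\<in>UNIV. a i c * b i c) = G"
  proof -
    have "(\<Sum>c\<in>UNIV. a i c * b i c) = qRe (qcnj (x $ i) * (Y $ i * A))" for i
      unfolding qRe_cnj_mult a_def b_def by (simp add: mult.commute)
    then have "(\<Sum>i\<in>UNIV. \<Sum>c\<in>UNIV. a i c * b i c) = qc 0 (hinner x Y * A)"
      unfolding hinner_def sum_distrib_right qc_sum by (simp add: qc_def mult.assoc)
    also have "hinner x Y = qcnj A" by (simp add: A_def qcnj_hinner)
    also have "qc 0 (qcnj A * A) = G"
    proof -
      have "qc 0 q = qRe q" for q by (simp add: qc_def)
      then show ?thesis unfolding G_def norm_quat_sq_qc by (simp add: qRe_cnj_mult power2_eq_square)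
    qed
    finally show ?thesis .
  qed
  define U0 where "U0 = G / q0"
  have U0: "cossq_rep Y x = U0" by (simp add: cossq_rep_def U0_def G_def A_def q0_def)
  have d: "deriv (deriv (\<lambda>s. cossq_rep Y (x + s *\<^sub>R axis i (qe c)) ^ N)) 0 =
      real N * U0 ^ (N - 1) * (2 * (norm (Y $ i))\<^sup>2 / q0 - 8 * (a i c * b i c) / q0\<^sup>2 - 2 * G / q0\<^sup>2 + 8 * G * (b i c)\<^sup>2 / q0 ^ 3)
      + real N * real (N - 1) * U0 ^ (N - 2) * (4 * ((a i c)\<^sup>2 * q0\<^sup>2 - 2 * G * q0 * (a i c * b i c) + G\<^sup>2 * (b i c)\<^sup>2) / q0 ^ 4)" for i c
  proof -
    have e: "((2 * a i c * q0 - G * (2 * b i c)) / q0\<^sup>2)\<^sup>2 = 4 * ((a i c)\<^sup>2 * q0\<^sup>2 - 2 * G * q0 * (a i c * b i c) + G\<^sup>2 * (b i c)\<^sup>2) / q0 ^ 4"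
      unfolding power_divide by (simp add: power2_eq_square algebra_simps power4_eq_xxxx)
    show ?thesis
      unfolding cossq_rep_line A_def[symmetric] l1 l2 l3 l4 G_def[symmetric] q0_def[symmetric]
      unfolding deriv2_power_quotient(1)[OF q0(1)] e U0_def[symmetric]
      by (simp add: power_mult_distrib algebra_simps)
  qed
  have 1: "(\<Sum>i\<in>UNIV. \<Sum>c\<in>UNIV. (2 * (norm (Y $ i))\<^sup>2 / q0 - 8 * (a i c * b i c) / q0\<^sup>2 - 2 * G / q0\<^sup>2 + 8 * G * (b i c)\<^sup>2 / q0 ^ 3))
     = 8 / q0 - 8 * G / q0\<^sup>2 - 8 * real CARD('m) * G / q0\<^sup>2 + 8 * G * q0 / q0 ^ 3"
  proof -
    have "(\<Sum>i\<in>UNIV. \<Sum>c\<in>UNIV. (2 * (norm (Y $ i))\<^sup>2 / q0 - 8 * (a i c * b i c) / q0\<^sup>2 - 2 * G / q0\<^sup>2 + 8 * G * (b i c)\<^sup>2 / q0 ^ 3))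
       = 2 / q0 * (\<Sum>i\<in>(UNIV :: 'm set). \<Sum>c\<in>(UNIV :: 4 set). (norm (Y $ i))\<^sup>2) - 8 / q0\<^sup>2 * (\<Sum>i\<in>UNIV. \<Sum>c\<in>UNIV. a i c * b i c)
        - (\<Sum>i\<in>(UNIV :: 'm set). \<Sum>c\<in>(UNIV :: 4 set). 2 * G / q0\<^sup>2) + 8 * G / q0 ^ 3 * (\<Sum>i\<in>UNIV. \<Sum>c\<in>UNIV. (b i c)\<^sup>2)"
      unfolding sum_distrib_left sum_subtractf[symmetric] sum.distrib[symmetric] by (intro sum.cong refl) simp
    then show ?thesis unfolding s2 s3 s4 by simp
  qed
  have 2: "(\<Sum>i\<in>UNIV. \<Sum>c\<in>UNIV. (4 * ((a i c)\<^sup>2 * q0\<^sup>2 - 2 * G * q0 * (a i c * b i c) + G\<^sup>2 * (b i c)\<^sup>2) / q0 ^ 4))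
     = 4 * (G * q0\<^sup>2 - 2 * G * q0 * G + G\<^sup>2 * q0) / q0 ^ 4"
  proof -
    have "(\<Sum>i\<in>UNIV. \<Sum>c\<in>UNIV. (4 * ((a i c)\<^sup>2 * q0\<^sup>2 - 2 * G * q0 * (a i c * b i c) + G\<^sup>2 * (b i c)\<^sup>2) / q0 ^ 4))
      = 4 / q0 ^ 4 * (q0\<^sup>2 * (\<Sum>i\<in>UNIV. \<Sum>c\<in>UNIV. (a i c)\<^sup>2) - 2 * G * q0 * (\<Sum>i\<in>UNIV. \<Sum>c\<in>UNIV. a i c * b i c) + G\<^sup>2 * (\<Sum>i\<in>UNIV. \<Sum>c\<in>UNIV. (b i c)\<^sup>2))"
      unfolding sum_distrib_left sum_subtractf[symmetric] sum.distrib[symmetric] by (intro sum.cong refl) (simp add: algebra_simps add_divide_distrib diff_divide_distrib)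
    then show ?thesis unfolding s1 s2 s4 by (simp add: algebra_simps add_divide_distrib diff_divide_distrib)
  qed
  have "q0 * (\<Sum>i\<in>UNIV. \<Sum>c\<in>UNIV. deriv (deriv (\<lambda>s. cossq_rep Y (x + s *\<^sub>R axis i (qe c)) ^ N)) 0)
    = real N * U0 ^ (N - 1) * (q0 * (8 / q0 - 8 * G / q0\<^sup>2 - 8 * real CARD('m) * G / q0\<^sup>2 + 8 * G * q0 / q0 ^ 3))
     + real N * real (N - 1) * U0 ^ (N - 2) * (q0 * (4 * (G * q0\<^sup>2 - 2 * G * q0 * G + G\<^sup>2 * q0) / q0 ^ 4))"
  proof -
    have lin: "(\<Sum>i\<in>UNIV. \<Sum>c\<in>UNIV. K * T i c + L * S i c) = K * (\<Sum>i\<in>UNIV. \<Sum>c\<in>UNIV. T i c) + L * (\<Sum>i\<in>UNIV. \<Sum>c\<in>UNIV. S i c)"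
      for K L :: real and T S :: "'m \<Rightarrow> 4 \<Rightarrow> real"
      by (simp add: sum.distrib sum_distrib_left)
    have al: "q * (K * t + L * s) = K * (q * t) + L * (q * s)" for q K L t s :: real by (simp add: algebra_simps)
    show ?thesis unfolding d lin 1 2 by (rule al)
  qed
  also have "q0 * (8 / q0 - 8 * G / q0\<^sup>2 - 8 * real CARD('m) * G / q0\<^sup>2 + 8 * G * q0 / q0 ^ 3) = 8 - 8 * real CARD('m) * U0"
    using q0 by (simp add: U0_def field_simps power2_eq_square power3_eq_cube)
  also have "q0 * (4 * (G * q0\<^sup>2 - 2 * G * q0 * G + G\<^sup>2 * q0) / q0 ^ 4) = 4 * U0 - 4 * U0 * U0"
    using q0 by (simp add: U0_def field_simps power2_eq_square power4_eq_xxxx)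
  finally have "q0 * (\<Sum>i\<in>UNIV. \<Sum>c\<in>UNIV. deriv (deriv (\<lambda>s. cossq_rep Y (x + s *\<^sub>R axis i (qe c)) ^ N)) 0)
    = real N * U0 ^ (N - 1) * (8 - 8 * real CARD('m) * U0) + real N * real (N - 1) * U0 ^ (N - 2) * (4 * U0 - 4 * U0 * U0)" .
  also have "\<dots> = 4 * real N * (real N + 1) * U0 ^ (N - 1) - 4 * real N * (real N + 2 * real CARD('m) - 1) * U0 ^ N"
  proof -
    consider "N = 0" | "N = 1" | M where "N = Suc (Suc M)" by (metis One_nat_def not0_implies_Suc)
    then show ?thesis by cases (simp_all add: algebra_simps)
  qed
  finally show ?thesis by (simp add: U0 q0_def)
qed

definition cossq :: "'n::finite hproj \<Rightarrow> 'n hproj \<Rightarrow> real" where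
  "cossq y z = (cos (fs_dist z y))\<^sup>2"

lemma cossq_abs: "X \<noteq> 0 \<Longrightarrow> norm Y = 1 \<Longrightarrow> cossq (abs_hproj Y) (abs_hproj X) = cossq_rep Y X"
  unfolding cossq_def by (rule cos_fs_dist_sq)

lemma cossq_hchart: "norm Y = 1 \<Longrightarrow> cossq (abs_hproj Y) (hchart j v) = cossq_rep Y (affine_lift j v)"
  unfolding hchart_def by (rule cossq_abs[OF affine_lift_nonzero])

lemma cossq_bounds: "0 \<le> cossq y z" "cossq y z \<le> 1"
  unfolding cossq_def by (simp_all add: abs_square_le_1)

lemma cossq_power_ratf: "ratf (\<lambda>v. cossq y (hchart j v) ^ N)"
proof -
  obtain Y where Y: "abs_hproj Y = y" "norm Y = 1" using hproj_rep by metis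
  have "(\<lambda>v. cossq y (hchart j v) ^ N) = (\<lambda>v. cossq_rep Y (affine_lift j v) ^ N)"
    using cossq_hchart[OF Y(2)] Y(1) by auto
  then show ?thesis using ratf_power[OF cossq_rep_affine_ratf] by simp
qed

text \<open>
  Powers of the squared cosine are admissible test functions in the initial condition.
\<close>

lemma cossq_power_smooth: "hproj_smooth (\<lambda>z. cossq y z ^ N)"
  unfolding hproj_smooth_def using ratf_smooth[OF cossq_power_ratf] by blast

lemma chart_lap_cossq_power:
  fixes y :: "'n::finite hproj"
  shows "chart_lap (\<lambda>v. cossq y (hchart j v) ^ N) v =
     4 * real N * (real N + 1) * cossq y (hchart j v) ^ (N - 1) - eigval CARD('n) N * cossq y (hchart j v) ^ N"
proof -
  obtain Y where Y: "abs_hproj Y = y" "norm Y = 1" using hproj_rep by metis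
  define x where "x = affine_lift j v"
  have x: "x \<noteq> 0" unfolding x_def by (rule affine_lift_nonzero)
  have ld: "line_deriv2 (\<lambda>z. cossq y z ^ N) x b = deriv (deriv (\<lambda>s. cossq_rep Y (x + s *\<^sub>R b) ^ N)) 0" for b
  proof -
    have "((\<lambda>s. x + s *\<^sub>R b) \<longlongrightarrow> x + 0 *\<^sub>R b) (nhds 0)"
      by (intro tendsto_intros filterlim_ident)
    then have ne: "eventually (\<lambda>s. x + s *\<^sub>R b \<noteq> 0) (nhds 0)"
      by (rule tendsto_imp_eventually_ne) (simp add: x)
    have "eventually (\<lambda>s. cossq y (abs_hproj (x + s *\<^sub>R b)) ^ N = cossq_rep Y (x + s *\<^sub>R b) ^ N) (nhds 0)"
      using ne by eventually_elim (simp add: cossq_abs[OF _ Y(2)] Y(1)[symmetric])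
    then have "eventually (\<lambda>t. eventually (\<lambda>s. cossq y (abs_hproj (x + s *\<^sub>R b)) ^ N = cossq_rep Y (x + s *\<^sub>R b) ^ N) (nhds t)) (nhds 0)"
      by (simp add: eventually_eventually)
    then have "eventually (\<lambda>t. deriv (\<lambda>s. cossq y (abs_hproj (x + s *\<^sub>R b)) ^ N) t = deriv (\<lambda>s. cossq_rep Y (x + s *\<^sub>R b) ^ N) t) (nhds 0)"
      by eventually_elim (rule deriv_cong_ev, auto)
    then show ?thesis unfolding line_deriv2_def by (rule deriv_cong_ev) simp
  qed
  have "chart_lap (\<lambda>v. cossq y (hchart j v) ^ N) v = hom_lap (\<lambda>z. cossq y z ^ N) x"
    unfolding x_def by (rule hom_lap_eq_chart_lap[symmetric, OF ratf_C2[OF cossq_power_ratf]])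
  also have "\<dots> = 4 * real N * (real N + 1) * cossq_rep Y x ^ (N - 1) - 4 * real N * (real N + 2 * real CARD('n option) - 1) * cossq_rep Y x ^ N"
    unfolding hom_lap_def ld by (rule sum_cossq_rep_second_derivs[OF x Y(2)])
  also have "cossq_rep Y x = cossq y (hchart j v)" using cossq_hchart[OF Y(2), of j v] Y(1) by (simp add: x_def)
  finally show ?thesis by (simp add: eigval_def algebra_simps)
qed

lemma abs_qdot_le: "\<bar>qdot a b\<bar> \<le> norm a * norm b"
proof -
  have "\<bar>qRe (qcnj a * b)\<bar> \<le> norm (qcnj a * b)" unfolding qRe_eq_qc by (rule abs_qc_le)
  then show ?thesis by (simp add: qRe_cnj_mult qdot_def norm_mult norm_qcnj)
qed

text \<open>
  With \<open>x = affine_lift j v\<close> and \<open>b = lin_lift j v\<close> the radial derivative is the derivative of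
  \<open>cossq_rep\<close> along \<open>x + s b\<close>. All coefficients of the numerator and the denominator are bounded by
  multiples of \<open>|x|\<^sup>2\<close> because \<open>|b| \<le> |x|\<close>.
\<close>

lemma radial_cossq_power_bound:
  "\<bar>\<Sum>a\<in>UNIV. v $ a * partial_deriv a (\<lambda>v. cossq y (hchart j v) ^ N) v\<bar> \<le> 4 * real N"
proof -
  obtain Y where Y: "abs_hproj Y = y" "norm Y = 1" using hproj_rep by metis
  define x b A B where "x = affine_lift j v" and "b = lin_lift j v" and "A = hinner Y x" and "B = hinner Y b"
  define p1 q1 U0 U1 where "p1 = 2 * qdot A B" and "q1 = 2 * (\<Sum>i\<in>UNIV. qdot (x $ i) (b $ i))"
    and "U0 = (norm A)\<^sup>2 / (norm x)\<^sup>2" and "U1 = (p1 * (norm x)\<^sup>2 - (norm A)\<^sup>2 * q1) / ((norm x)\<^sup>2)\<^sup>2"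
  have nx: "(norm x)\<^sup>2 = rr v" unfolding x_def by (rule norm_affine_lift_sq)
  have R: "rr v > 0" by (rule rr_pos)
  have l: "affine_lift j (v + s *\<^sub>R v) = x + s *\<^sub>R b" for s
    unfolding affine_lift_add x_def b_def by (simp add: linear_scale[OF linear_lin_lift])
  have dU: "((\<lambda>s. cossq_rep Y (x + s *\<^sub>R b)) has_real_derivative U1) (at 0)"
    unfolding cossq_rep_line U1_def p1_def q1_def A_def B_def by (rule deriv2_power_quotient(2)) (use nx R in simp)
  have uU: "cossq y (hchart j (v + s *\<^sub>R v)) = cossq_rep Y (x + s *\<^sub>R b)" for s
    using cossq_hchart[OF Y(2)] Y(1) l by simp
  define \<phi> where "\<phi> = (\<lambda>v. cossq y (hchart j v) ^ N)"
  have "((\<lambda>s. cossq_rep Y (x + s *\<^sub>R b) ^ N) has_real_derivative real N * (U1 * cossq_rep Y (x + 0 *\<^sub>R b) ^ (N - Suc 0))) (at 0)"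
    by (rule DERIV_power[OF dU])
  then have d1: "((\<lambda>s. \<phi> (v + s *\<^sub>R v)) has_real_derivative real N * (U1 * cossq_rep Y x ^ (N - 1))) (at 0)"
    by (simp add: \<phi>_def uU)
  have "\<phi> differentiable at (v + 0 *\<^sub>R v)" unfolding \<phi>_def using C2_D(1)[OF ratf_C2[OF cossq_power_ratf]] .
  then have "((\<lambda>s. \<phi> (v + s *\<^sub>R v)) has_derivative (\<lambda>h. \<Sum>a\<in>UNIV. (h *\<^sub>R v) $ a * partial_deriv a \<phi> (v + 0 *\<^sub>R v))) (at 0)"
    by (intro has_derivative_compose[OF _ has_derivative_partials]) (auto intro!: derivative_eq_intros)
  then have "((\<lambda>s. \<phi> (v + s *\<^sub>R v)) has_real_derivative (\<Sum>a\<in>UNIV. v $ a * partial_deriv a \<phi> v)) (at 0)"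
    unfolding has_field_derivative_def by (rule has_derivative_eq_rhs) (simp add: fun_eq_iff sum_distrib_left mult_ac)
  from DERIV_unique[OF this d1] have e: "(\<Sum>a\<in>UNIV. v $ a * partial_deriv a \<phi> v) = real N * (U1 * cossq_rep Y x ^ (N - 1))" .
  have A: "norm A \<le> norm x" unfolding A_def using norm_hinner_le[of Y x] Y(2) by simp
  have nb: "(norm b)\<^sup>2 = v \<bullet> v"
  proof -
    have "(norm b)\<^sup>2 = (\<Sum>i\<in>UNIV. (norm (b $ i))\<^sup>2)" by (rule norm_quat_vec_sq)
    then show ?thesis unfolding b_def sum_option[of _ j] lin_lift_nth norm_zero norm_quat_sq_qc
      by (simp add: inner_vec4 power2_eq_square)
  qed
  have bx: "norm b \<le> norm x"
    using nb nx power2_le_imp_le[of "norm b" "norm x"] by (simp add: rr_def)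
  have B: "norm B \<le> norm x" unfolding B_def using norm_hinner_le[of Y b] Y(2) bx by simp
  have p1: "\<bar>p1\<bar> \<le> 2 * rr v"
  proof -
    have "\<bar>qdot A B\<bar> \<le> norm A * norm B" by (rule abs_qdot_le)
    also have "\<dots> \<le> norm x * norm x" by (intro mult_mono A B) auto
    finally show ?thesis using nx by (simp add: p1_def power2_eq_square abs_mult)
  qed
  have q1: "q1 = 2 * (v \<bullet> v)"
    unfolding q1_def x_def b_def sum_option[of _ j] by (simp add: qdot_def inner_vec4)
  have A2: "(norm A)\<^sup>2 \<le> rr v" using A nx by (metis norm_ge_zero power_mono)
  have "\<bar>p1 * rr v - (norm A)\<^sup>2 * q1\<bar> \<le> \<bar>p1\<bar> * rr v + (norm A)\<^sup>2 * \<bar>q1\<bar>"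
    using R by (intro order_trans[OF abs_triangle_ineq4]) (simp add: abs_mult)
  also have "\<dots> \<le> (2 * rr v) * rr v + rr v * (2 * rr v)"
    using R by (intro add_mono mult_mono p1 A2) (auto simp: q1 rr_def)
  finally have "\<bar>U1\<bar> \<le> 4"
    unfolding U1_def nx using R by (simp add: abs_divide divide_le_eq power2_eq_square)
  moreover have "\<bar>cossq_rep Y x ^ (N - 1)\<bar> \<le> 1"
  proof -
    have "x \<noteq> 0" unfolding x_def by (rule affine_lift_nonzero)
    from cos_fs_dist_sq(2,3)[OF this Y(2)] show ?thesis by (simp add: power_le_one power_abs)
  qed
  ultimately have "\<bar>U1\<bar> * \<bar>cossq_rep Y x ^ (N - 1)\<bar> \<le> 4 * 1" by (intro mult_mono) auto
  then have "real N * (\<bar>U1\<bar> * \<bar>cossq_rep Y x ^ (N - 1)\<bar>) \<le> real N * (4 * 1)" by (rule mult_left_mono) simp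
  then show ?thesis using e unfolding \<phi>_def by (simp add: abs_mult mult.commute)
qed

section \<open>Gaussian integrals\<close>

lemma rr_prod_basis:
  fixes v :: "'a::euclidean_space"
  shows "exp (- (s * rr v)) = exp (- s) * (\<Prod>b\<in>Basis. exp (- (s * (v \<bullet> b)\<^sup>2)))"
proof -
  have "v \<bullet> v = (\<Sum>b\<in>Basis. (v \<bullet> b)\<^sup>2)"
    by (subst euclidean_inner) (simp add: power2_eq_square)
  then have "exp (- (s * rr v)) = exp (- s) * exp (\<Sum>b\<in>Basis. - (s * (v \<bullet> b)\<^sup>2))"
    by (simp add: rr_def exp_add[symmetric] algebra_simps sum_distrib_left sum_negf)
  then show ?thesis by (simp add: exp_sum)
qed

lemma nn_integral_gauss_real:
  assumes s: "s > 0"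
  shows "(\<integral>\<^sup>+x. ennreal (exp (- (s * x\<^sup>2))) \<partial>lborel) = ennreal (sqrt (pi / s))"
proof -
  define \<sigma> where "\<sigma> = sqrt (1 / (2 * s))"
  have \<sigma>: "\<sigma> > 0" "2 * \<sigma>\<^sup>2 = 1 / s" using s by (simp_all add: \<sigma>_def)
  interpret prob_space "density lborel (normal_density 0 \<sigma>)" by (rule prob_space_normal_density[OF \<sigma>(1)])
  have nd: "normal_density 0 \<sigma> x = 1 / sqrt (pi / s) * exp (- (s * x\<^sup>2))" for x
  proof -
    have "2 * pi * \<sigma>\<^sup>2 = pi / s" using \<sigma>(2) by (simp add: mult_ac)
    then show ?thesis unfolding normal_density_def \<sigma>(2) by (simp add: \<sigma>(2) mult.commute)
  qed
  have p: "sqrt (pi / s) > 0" using s by simp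
  have "1 = (\<integral>\<^sup>+x. ennreal (normal_density 0 \<sigma> x) \<partial>lborel)"
    using emeasure_space_1 by (simp add: emeasure_density)
  also have "\<dots> = ennreal (1 / sqrt (pi / s)) * (\<integral>\<^sup>+x. ennreal (exp (- (s * x\<^sup>2))) \<partial>lborel)"
    unfolding nd using p by (subst nn_integral_cmult[symmetric]) (auto simp: ennreal_mult'[symmetric])
  finally have e: "1 = ennreal (1 / sqrt (pi / s)) * (\<integral>\<^sup>+x. ennreal (exp (- (s * x\<^sup>2))) \<partial>lborel)" .
  have "ennreal (sqrt (pi / s)) = ennreal (sqrt (pi / s)) * (ennreal (1 / sqrt (pi / s)) * (\<integral>\<^sup>+x. ennreal (exp (- (s * x\<^sup>2))) \<partial>lborel))"
    unfolding e[symmetric] by simp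
  also have "\<dots> = ennreal (sqrt (pi / s) * (1 / sqrt (pi / s))) * (\<integral>\<^sup>+x. ennreal (exp (- (s * x\<^sup>2))) \<partial>lborel)"
    using p by (subst ennreal_mult) (auto simp: mult.assoc)
  also have "sqrt (pi / s) * (1 / sqrt (pi / s)) = 1" using p s by simp
  finally show ?thesis by simp
qed

lemma nn_integral_exp_rr:
  assumes s: "s > 0"
  shows "(\<integral>\<^sup>+v. ennreal (exp (- (s * rr (v :: real ^ ('n::finite \<times> 4))))) \<partial>lborel)
     = ennreal (exp (- s) * (pi / s) ^ (2 * CARD('n)))"
proof -
  have D: "card (Basis :: (real ^ ('n \<times> 4)) set) = 2 * CARD('n) * 2"
    using DIM_cart[where 'a = real and 'b = "'n \<times> 4"] card_affine_coords[where 'n = 'n] by simp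
  have "(\<integral>\<^sup>+v. ennreal (exp (- (s * rr (v :: real ^ ('n \<times> 4))))) \<partial>lborel)
     = (\<integral>\<^sup>+v. ennreal (exp (- s)) * (\<Prod>b\<in>Basis. ennreal (exp (- (s * ((v :: real ^ ('n \<times> 4)) \<bullet> b)\<^sup>2)))) \<partial>lborel)"
    unfolding rr_prod_basis by (simp add: ennreal_mult prod_ennreal prod_nonneg)
  also have "\<dots> = ennreal (exp (- s)) * (\<integral>\<^sup>+v. (\<Prod>b\<in>Basis. ennreal (exp (- (s * ((v :: real ^ ('n \<times> 4)) \<bullet> b)\<^sup>2)))) \<partial>lborel)"
    by (rule nn_integral_cmult) measurable
  also have "(\<integral>\<^sup>+v. (\<Prod>b\<in>Basis. ennreal (exp (- (s * ((v :: real ^ ('n \<times> 4)) \<bullet> b)\<^sup>2)))) \<partial>lborel)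
     = (\<Prod>b\<in>(Basis :: (real ^ ('n \<times> 4)) set). (\<integral>\<^sup>+x. ennreal (exp (- (s * x\<^sup>2))) \<partial>lborel))"
    by (rule nn_integral_lborel_prod[where f = "\<lambda>b x. ennreal (exp (- (s * x\<^sup>2)))"]) auto
  also have "\<dots> = ennreal (sqrt (pi / s) ^ (2 * CARD('n) * 2))"
    unfolding nn_integral_gauss_real[OF s] using s by (simp add: D ennreal_power mult.commute)
  also have "sqrt (pi / s) ^ (2 * CARD('n) * 2) = (pi / s) ^ (2 * CARD('n))"
  proof -
    have "sqrt (pi / s) ^ (2 * CARD('n) * 2) = ((sqrt (pi / s))\<^sup>2) ^ (2 * CARD('n))"
      unfolding power_mult[symmetric] by (simp only: mult.commute)
    also have "(sqrt (pi / s))\<^sup>2 = pi / s" using s by simp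
    finally show ?thesis .
  qed
  finally show ?thesis using s by (simp add: ennreal_mult)
qed

lemma nn_integral_erlang:
  assumes "0 < l"
  shows "(\<integral>\<^sup>+s. ennreal (indicator {0<..} s * (s ^ k * exp (- (s * l)))) \<partial>lborel) = ennreal (fact k / l ^ Suc k)"
proof -
  interpret prob_space "density lborel (erlang_density k l)" by (rule prob_space_erlang_density[OF assms])
  have "1 = (\<integral>\<^sup>+x. ennreal (erlang_density k l x) \<partial>lborel)"
    using emeasure_space_1 by (simp add: emeasure_density)
  also have "\<dots> = (\<integral>\<^sup>+s. ennreal (l ^ Suc k / fact k) * ennreal (indicator {0<..} s * (s ^ k * exp (- (s * l)))) \<partial>lborel)"
  proof (rule nn_integral_cong_AE)
    have "AE x in lborel. x \<noteq> (0::real)" by (rule AE_lborel_singleton)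
    then show "AE s in lborel. ennreal (erlang_density k l s) = ennreal (l ^ Suc k / fact k) * ennreal (indicator {0<..} s * (s ^ k * exp (- (s * l))))"
    proof eventually_elim
      case (elim s)
      then show ?case using assms
        by (auto simp: erlang_density_def ennreal_mult'[symmetric] mult_ac split: split_indicator)
    qed
  qed
  also have "\<dots> = ennreal (l ^ Suc k / fact k) * (\<integral>\<^sup>+s. ennreal (indicator {0<..} s * (s ^ k * exp (- (s * l)))) \<partial>lborel)"
    by (rule nn_integral_cmult) measurable
  finally have e: "1 = ennreal (l ^ Suc k / fact k) * (\<integral>\<^sup>+s. ennreal (indicator {0<..} s * (s ^ k * exp (- (s * l)))) \<partial>lborel)" .
  have "ennreal (fact k / l ^ Suc k) = ennreal (fact k / l ^ Suc k) * (ennreal (l ^ Suc k / fact k) * (\<integral>\<^sup>+s. ennreal (indicator {0<..} s * (s ^ k * exp (- (s * l)))) \<partial>lborel))"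
    unfolding e[symmetric] by simp
  also have "\<dots> = ennreal (fact k / l ^ Suc k * (l ^ Suc k / fact k)) * (\<integral>\<^sup>+s. ennreal (indicator {0<..} s * (s ^ k * exp (- (s * l)))) \<partial>lborel)"
    using assms by (subst ennreal_mult) (auto simp: mult.assoc)
  also have "fact k / l ^ Suc k * (l ^ Suc k / fact k) = 1" using assms by simp
  finally show ?thesis by simp
qed

lemma rr_measurable [measurable]: "rr \<in> borel_measurable (borel :: 'a::euclidean_space measure)"
  unfolding rr_def by measurable

text \<open>
  Write \<open>M! / R\<^sup>M\<^sup>+\<^sup>1\<close> as the integral of \<open>s\<^sup>M exp (- s R)\<close> over \<open>s > 0\<close>. After exchanging the
  integrals, the integral over \<open>v\<close> is a product of one-dimensional Gaussian integrals.
\<close>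

lemma nn_integral_rr_power:
  "(\<integral>\<^sup>+v. ennreal (inverse (rr (v :: real ^ ('n::finite \<times> 4))) ^ (2 * CARD('n) + k + 1)) \<partial>lborel)
     = ennreal (pi ^ (2 * CARD('n)) * fact k / fact (2 * CARD('n) + k))"
proof -
  define M where "M = 2 * CARD('n) + k"
  define g where "g s v = ennreal (indicator {0<..} s * (s ^ M * exp (- (s * rr v))))" for s and v :: "real ^ ('n \<times> 4)"
  have gm: "(\<lambda>(s, v). g s v) \<in> borel_measurable (lborel \<Otimes>\<^sub>M lborel)"
    unfolding g_def by measurable
  have 1: "(\<integral>\<^sup>+s. g s v \<partial>lborel) = ennreal (fact M) * ennreal (inverse (rr v) ^ (2 * CARD('n) + k + 1))" for v
    unfolding g_def nn_integral_erlang[OF rr_pos] M_def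
    by (subst ennreal_mult[symmetric]) (auto simp: divide_inverse power_inverse less_imp_le[OF rr_pos] intro!: mult_nonneg_nonneg)
  have 2: "(\<integral>\<^sup>+v. g s v \<partial>lborel) = ennreal (pi ^ (2 * CARD('n))) * ennreal (indicator {0<..} s * (s ^ k * exp (- (s * 1))))" for s
  proof (cases "s > 0")
    case True
    have "(\<integral>\<^sup>+v. g s v \<partial>lborel) = (\<integral>\<^sup>+v. ennreal (s ^ M) * ennreal (exp (- (s * rr (v :: real ^ ('n \<times> 4))))) \<partial>lborel)"
      unfolding g_def using True by (intro nn_integral_cong) (simp add: ennreal_mult)
    also have "\<dots> = ennreal (s ^ M) * ennreal (exp (- s) * (pi / s) ^ (2 * CARD('n)))"
      unfolding nn_integral_exp_rr[OF True, symmetric] by (rule nn_integral_cmult) measurable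
    also have "\<dots> = ennreal (s ^ M * (exp (- s) * (pi / s) ^ (2 * CARD('n))))"
      using True by (simp add: ennreal_mult)
    also have "s ^ M * (exp (- s) * (pi / s) ^ (2 * CARD('n))) = pi ^ (2 * CARD('n)) * (s ^ k * exp (- s))"
      using True by (simp add: M_def power_add power_divide)
    finally show ?thesis using True by (simp add: ennreal_mult)
  qed (simp add: g_def)
  have "ennreal (fact M) * (\<integral>\<^sup>+v. ennreal (inverse (rr (v :: real ^ ('n \<times> 4))) ^ (2 * CARD('n) + k + 1)) \<partial>lborel)
     = (\<integral>\<^sup>+v. ennreal (fact M) * ennreal (inverse (rr (v :: real ^ ('n \<times> 4))) ^ (2 * CARD('n) + k + 1)) \<partial>lborel)"
    by (rule nn_integral_cmult[symmetric]) measurable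
  also have "\<dots> = (\<integral>\<^sup>+v. (\<integral>\<^sup>+s. g s v \<partial>lborel) \<partial>lborel)" unfolding 1 ..
  also have "\<dots> = (\<integral>\<^sup>+s. (\<integral>\<^sup>+v. g s v \<partial>lborel) \<partial>lborel)" by (rule lborel_pair.Fubini'[OF gm])
  also have "\<dots> = ennreal (pi ^ (2 * CARD('n))) * (\<integral>\<^sup>+s. ennreal (indicator {0<..} s * (s ^ k * exp (- (s * 1)))) \<partial>lborel)"
    unfolding 2 by (rule nn_integral_cmult) measurable
  also have "\<dots> = ennreal (pi ^ (2 * CARD('n)) * fact k)"
    by (subst nn_integral_erlang) (simp_all add: ennreal_mult)
  finally have e: "ennreal (fact M) * (\<integral>\<^sup>+v. ennreal (inverse (rr (v :: real ^ ('n \<times> 4))) ^ (2 * CARD('n) + k + 1)) \<partial>lborel)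
     = ennreal (pi ^ (2 * CARD('n)) * fact k)" .
  have "ennreal (inverse (fact M)) * (ennreal (fact M) * X) = X" for X
    by (simp add: mult.assoc[symmetric] ennreal_mult[symmetric])
  from this[of "\<integral>\<^sup>+v. ennreal (inverse (rr (v :: real ^ ('n \<times> 4))) ^ (2 * CARD('n) + k + 1)) \<partial>lborel"]
  show ?thesis unfolding e by (simp add: ennreal_mult[symmetric] M_def divide_inverse mult.commute)
qed

lemma continuous_rr: "continuous_on UNIV (rr :: 'a::real_inner \<Rightarrow> real)"
  unfolding rr_def by (intro continuous_intros)

lemma integrable_rr_power: "integrable lborel (\<lambda>v :: real ^ ('n::finite \<times> 4). inverse (rr v) ^ (2 * CARD('n) + k + 1))"
proof (rule integrableI_nonneg)
  show "(\<lambda>v :: real ^ ('n \<times> 4). inverse (rr v) ^ (2 * CARD('n) + k + 1)) \<in> borel_measurable lborel" by measurable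
  show "AE v in lborel. 0 \<le> inverse (rr (v :: real ^ ('n \<times> 4))) ^ (2 * CARD('n) + k + 1)"
    by (intro AE_I2 zero_le_power) (simp add: less_imp_le[OF rr_pos])
qed (subst nn_integral_rr_power, simp)

lemma integral_rr_power: "(\<integral>v. inverse (rr (v :: real ^ ('n::finite \<times> 4))) ^ (2 * CARD('n) + k + 1) \<partial>lborel)
     = pi ^ (2 * CARD('n)) * fact k / fact (2 * CARD('n) + k)"
proof (rule integral_eq_nn_integral[THEN trans])
  show "(\<lambda>v :: real ^ ('n \<times> 4). inverse (rr v) ^ (2 * CARD('n) + k + 1)) \<in> borel_measurable lborel" by measurable
  show "AE v in lborel. 0 \<le> inverse (rr (v :: real ^ ('n \<times> 4))) ^ (2 * CARD('n) + k + 1)"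
    by (intro AE_I2 zero_le_power) (simp add: less_imp_le[OF rr_pos])
qed (subst nn_integral_rr_power, simp)

section \<open>Topology and integration on the projective space\<close>

definition affine_coords :: "'n::finite option \<Rightarrow> quat ^ 'n option \<Rightarrow> real ^ ('n \<times> 4)" where
  "affine_coords k X = qpack (\<lambda>i. X $ affine_idx k i * inverse (X $ k))"

lemma affine_lift_affine_coords: "X $ k \<noteq> 0 \<Longrightarrow> affine_lift k (affine_coords k X) = hscale X (inverse (X $ k))"
  by (rule vec_affine_idx_eqI[of _ k]) (simp_all add: affine_coords_def)

lemma hchart_affine_coords: "X $ k \<noteq> 0 \<Longrightarrow> hchart k (affine_coords k X) = abs_hproj X"
  unfolding hchart_def by (simp add: affine_lift_affine_coords abs_hproj_hscale)

lemma hchart_in_range_iff: "hchart j v \<in> range (hchart k) \<longleftrightarrow> affine_lift j v $ k \<noteq> 0"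
proof
  assume "hchart j v \<in> range (hchart k)"
  then obtain w where "abs_hproj (affine_lift k w) = abs_hproj (affine_lift j v)" by (auto simp: hchart_def)
  then have "same_line (affine_lift k w) (affine_lift j v)"
    by (rule abs_hproj_eqD[OF _ affine_lift_nonzero affine_lift_nonzero])
  then obtain q where "q \<noteq> 0" "affine_lift j v = hscale (affine_lift k w) q" by (auto simp: same_line_def)
  then show "affine_lift j v $ k \<noteq> 0" by simp
next
  assume "affine_lift j v $ k \<noteq> 0"
  from hchart_affine_coords[OF this] show "hchart j v \<in> range (hchart k)"
    unfolding hchart_def[of j v] by (metis rangeI)
qed

text \<open>
  Normalize a homogeneous coordinate of maximal norm. The compact balls obtained in this way, one in
  each of the finitely many charts, are the form in which compactness of the space is used.
\<close>

lemma hproj_chart_cover: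
  fixes z :: "'n::finite hproj"
  obtains j v where "z = hchart j v" "norm v \<le> sqrt (real CARD('n))"
proof -
  obtain X :: "quat ^ 'n option" where X: "X \<noteq> 0" "abs_hproj X = z" by (rule hproj_rep)
  define m where "m = Max (range (\<lambda>i. norm (X $ i)))"
  have "m \<in> range (\<lambda>i. norm (X $ i))" unfolding m_def by (rule Max_in) auto
  then obtain j where j: "m = norm (X $ j)" by auto
  have le: "norm (X $ i) \<le> norm (X $ j)" for i
    unfolding j[symmetric] m_def by (rule Max_ge) auto
  have X0: "X $ j \<noteq> 0"
  proof
    assume "X $ j = 0"
    then have "X = 0" using le by (simp add: vec_eq_iff)
    then show False using X by simp
  qed
  define v where "v = affine_coords j X"
  have "(norm v)\<^sup>2 = (\<Sum>k\<in>UNIV. (norm (X $ affine_idx j k * inverse (X $ j)))\<^sup>2)"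
    unfolding norm_quat_sq_qc power2_norm_eq_inner inner_vec4 v_def affine_coords_def by (simp add: power2_eq_square)
  also have "\<dots> \<le> (\<Sum>k\<in>(UNIV :: 'n set). 1)"
  proof (rule sum_mono)
    fix k
    have "norm (X $ affine_idx j k * inverse (X $ j)) \<le> 1"
      using le[of "affine_idx j k"] X0 unfolding norm_mult norm_inverse by (simp add: divide_inverse[symmetric] divide_le_eq_1)
    then show "(norm (X $ affine_idx j k * inverse (X $ j)))\<^sup>2 \<le> 1" by (simp add: power_le_one)
  qed
  finally have "norm v \<le> sqrt (real CARD('n))" by (simp add: real_le_rsqrt)
  moreover have "z = hchart j v" unfolding v_def hchart_affine_coords[OF X0] X(2) ..
  ultimately show ?thesis using that by blast
qed

definition chart_cont :: "('n::finite hproj \<Rightarrow> real) \<Rightarrow> bool" where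
  "chart_cont f \<longleftrightarrow> (\<forall>j. continuous_on UNIV (\<lambda>v. f (hchart j v)))"

lemma chart_cont_bounded:
  assumes "chart_cont f"
  obtains B where "B \<ge> 0" "\<And>z :: 'n::finite hproj. \<bar>f z\<bar> \<le> B"
proof -
  have "\<exists>B. \<forall>v\<in>cball 0 (sqrt (real CARD('n))). \<bar>f (hchart j v)\<bar> \<le> B" for j
  proof -
    have "compact ((\<lambda>v. f (hchart j v)) ` cball 0 (sqrt (real CARD('n))))"
      using assms unfolding chart_cont_def by (intro compact_continuous_image compact_cball continuous_on_subset[OF spec[of _ j]]) auto
    then have "bounded ((\<lambda>v. f (hchart j v)) ` cball 0 (sqrt (real CARD('n))))" by (rule compact_imp_bounded)
    then show ?thesis unfolding bounded_iff by auto
  qed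
  then obtain B where B: "\<And>j v. norm v \<le> sqrt (real CARD('n)) \<Longrightarrow> \<bar>f (hchart j v)\<bar> \<le> B j"
    unfolding Ball_def mem_cball_0 by metis
  have "\<bar>f z\<bar> \<le> (\<Sum>j\<in>UNIV. \<bar>B j\<bar>)" for z
  proof -
    obtain j v where z: "z = hchart j v" "norm v \<le> sqrt (real CARD('n))" by (rule hproj_chart_cover)
    have "\<bar>f z\<bar> \<le> \<bar>B j\<bar>" using B[OF z(2), of j] z(1) by simp
    also have "\<dots> \<le> (\<Sum>j\<in>UNIV. \<bar>B j\<bar>)" by (rule member_le_sum) auto
    finally show ?thesis .
  qed
  then show ?thesis using that[of "\<Sum>j\<in>UNIV. \<bar>B j\<bar>"] by (simp add: sum_nonneg)
qed

lemma bounded_linear_qc: "bounded_linear (qc c)"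
proof (rule bounded_linear_intro)
  show "norm (qc c q) \<le> norm q * 1" for q by (simp add: abs_qc_le)
qed simp_all

lemma continuous_on_affine_coords: "continuous_on {X. X $ k \<noteq> 0} (affine_coords k)"
  unfolding affine_coords_def qpack_def
  by (intro continuous_on_vec_lambda bounded_linear.continuous_on[OF bounded_linear_qc] continuous_intros) auto

lemma chart_cont_continuous: "chart_cont f \<Longrightarrow> continuous_on UNIV f"
proof -
  assume f: "chart_cont f"
  have "open (f -` U)" if U: "open U" for U
  proof -
    have "{X. X \<noteq> 0 \<and> abs_hproj X \<in> f -` U} = (\<Union>k. {X. X $ k \<noteq> 0} \<inter> (\<lambda>X. f (hchart k (affine_coords k X))) -` U)"
    proof -
      have "(\<exists>k. X $ k \<noteq> 0 \<and> f (hchart k (affine_coords k X)) \<in> U) \<longleftrightarrow> X \<noteq> 0 \<and> f (abs_hproj X) \<in> U" for X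
        using hchart_affine_coords[of X] by (auto simp: vec_eq_iff)
      then show ?thesis by auto
    qed
    moreover have "open ({X. X $ k \<noteq> 0} \<inter> (\<lambda>X. f (hchart k (affine_coords k X))) -` U)" for k
    proof (rule continuous_open_preimage[OF _ _ U])
      show "open {X :: quat ^ 'a option. X $ k \<noteq> 0}" by (intro open_Collect_neq continuous_intros)
      have "continuous_on UNIV (\<lambda>v. f (hchart k v))" using f by (simp add: chart_cont_def)
      then show "continuous_on {X. X $ k \<noteq> 0} (\<lambda>X. f (hchart k (affine_coords k X)))"
        by (rule continuous_on_compose2[OF _ continuous_on_affine_coords]) simp
    qed
    ultimately show ?thesis unfolding open_hproj_def by auto
  qed
  then show ?thesis by (simp add: continuous_on_open_vimage)
qed

lemma chart_cont_measurable: "chart_cont f \<Longrightarrow> f \<in> borel_measurable borel"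
  by (intro borel_measurable_continuous_onI chart_cont_continuous)

lemma continuous_affine_lift: "continuous_on UNIV (affine_lift j)"
  using affine_lift_has_derivative by (auto simp: continuous_on_eq_continuous_at intro!: has_derivative_continuous)

lemma hchart_measurable: "hchart j \<in> borel_measurable borel"
proof (rule borel_measurable_continuous_onI)
  have "open (hchart j -` U)" if "open U" for U
  proof -
    have "hchart j -` U = affine_lift j -` {X. X \<noteq> 0 \<and> abs_hproj X \<in> U}"
      by (auto simp: hchart_def affine_lift_nonzero)
    moreover have "open {X. X \<noteq> 0 \<and> abs_hproj X \<in> U}" using that by (simp add: open_hproj_def)
    ultimately show ?thesis by (simp only: open_vimage[OF _ continuous_affine_lift])
  qed
  then show "continuous_on UNIV (hchart j)" by (simp add: continuous_on_open_vimage)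
qed

definition chart_weight :: "'n::finite option \<Rightarrow> real ^ ('n \<times> 4) \<Rightarrow> real" where
  "chart_weight j v = inverse (rr v) ^ (2 * CARD('n) + 2) / card {k. affine_lift j v $ k \<noteq> 0}"

lemma chart_weight_measurable: "chart_weight j \<in> borel_measurable borel"
proof -
  have "open {v. affine_lift j v $ k \<noteq> 0}" for k
    by (intro open_Collect_neq continuous_intros continuous_affine_lift)
  then have s: "{v. affine_lift j v $ k \<noteq> 0} \<in> sets borel" for k by simp
  have c: "real (card {k. affine_lift j v $ k \<noteq> 0}) = (\<Sum>k\<in>UNIV. indicator {v. affine_lift j v $ k \<noteq> 0} v)" for v
    by (simp add: indicator_def sum.If_cases)
  show ?thesis unfolding chart_weight_def[abs_def] c using s by measurable
qed

text \<open>
  Almost every point lies in all \<open>n + 1\<close> charts, so the partition of unity is constant almost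
  everywhere.
\<close>

lemma chart_weight_AE: "AE v in lborel. chart_weight j v = inverse (rr v) ^ (2 * CARD('n) + 2) / (real CARD('n) + 1)"
  for j :: "'n::finite option"
proof -
  have a: "AE v in lborel. affine_lift j v $ k \<noteq> 0" for k
  proof (cases k rule: affine_idx_cases[of _ j])
    case (2 i)
    have "negligible {v :: real ^ ('n \<times> 4). v $ (i, 0) = 0}" by (rule negligible_standard_hyperplane_cart)
    then have "AE v in lebesgue. v \<notin> {v :: real ^ ('n \<times> 4). v $ (i, 0) = 0}"
      unfolding negligible_iff_null_sets by (rule AE_not_in)
    then have "AE v in lborel. v \<notin> {v :: real ^ ('n \<times> 4). v $ (i, 0) = 0}" by (simp add: AE_completion_iff)
    then show ?thesis
    proof eventually_elim
      case (elim v)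
      have "quat_coord v i \<noteq> 0"
      proof
        assume "quat_coord v i = 0"
        then have "qc 0 (quat_coord v i) = 0" by simp
        then show False using elim by simp
      qed
      then show ?case by (simp add: 2)
    qed
  qed simp
  have "AE v in lborel. \<forall>k. affine_lift j v $ k \<noteq> 0" using a by (simp add: AE_all_countable)
  then show ?thesis by eventually_elim (simp add: chart_weight_def)
qed

lemma fs_volume_eq: "fs_volume = distr (density (count_space UNIV \<Otimes>\<^sub>M lborel) (\<lambda>p. ennreal (chart_weight (fst p) (snd p)))) borel
   (\<lambda>p. hchart (fst p) (snd p))"
  unfolding fs_volume_def case_prod_beta det_fs_metric hchart_in_range_iff chart_weight_def ..

lemma
  fixes f :: "'n::finite hproj \<Rightarrow> real"
  assumes f: "f \<in> borel_measurable borel" and B: "\<And>z. \<bar>f z\<bar> \<le> B"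
  shows fs_integrable: "integrable fs_volume f"
    and fs_integral: "(\<integral>z. f z \<partial>fs_volume) = 1 / (real CARD('n) + 1) *
      (\<Sum>j\<in>UNIV. \<integral>v. inverse (rr v) ^ (2 * CARD('n) + 2) * f (hchart j v) \<partial>lborel)"
proof -
  define M where "M = (count_space UNIV \<Otimes>\<^sub>M lborel :: ('n option \<times> (real ^ ('n \<times> 4))) measure)"
  define w :: "'n option \<times> (real ^ ('n \<times> 4)) \<Rightarrow> real" where "w p = chart_weight (fst p) (snd p)" for p
  define T :: "'n option \<times> (real ^ ('n \<times> 4)) \<Rightarrow> 'n hproj" where "T p = hchart (fst p) (snd p)" for p
  interpret P: pair_sigma_finite "count_space (UNIV :: 'n option set)" "lborel :: (real ^ ('n \<times> 4)) measure"
    by (intro pair_sigma_finite.intro sigma_finite_measure_count_space_finite lborel.sigma_finite_measure_axioms) simp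
  have cb: "countable (UNIV :: 'n option set)" by (rule countable_finite) simp
  have w: "w \<in> borel_measurable M" unfolding M_def w_def
    by (rule measurable_pair_measure_countable1[OF cb]) (simp add: chart_weight_measurable)
  have T: "T \<in> borel_measurable M" unfolding M_def T_def
    by (rule measurable_pair_measure_countable1[OF cb]) (simp add: hchart_measurable)
  have w0: "0 \<le> w p" for p unfolding w_def chart_weight_def
    by (intro divide_nonneg_nonneg zero_le_power) (simp_all add: less_imp_le[OF rr_pos])
  have Td: "T \<in> measurable (density M (\<lambda>p. ennreal (w p))) borel" using T by simp
  have V: "fs_volume = distr (density M (\<lambda>p. ennreal (w p))) borel T"
    unfolding fs_volume_eq M_def w_def T_def ..
  have fT: "(\<lambda>p. f (T p)) \<in> borel_measurable M" using measurable_compose[OF T f] .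
  have wj: "(\<lambda>v. chart_weight j v * f (hchart j v)) \<in> borel_measurable borel" for j
    by (intro borel_measurable_times chart_weight_measurable measurable_compose[OF hchart_measurable f])
  have fj: "(\<lambda>v. f (hchart j v)) \<in> borel_measurable borel" for j
    by (rule measurable_compose[OF hchart_measurable f])
  have AEj: "AE v in lborel. chart_weight j v * f (hchart j v) = 1 / (real CARD('n) + 1) * (inverse (rr v) ^ (2 * CARD('n) + 2) * f (hchart j v))" for j
    using chart_weight_AE[of j] by eventually_elim simp
  have i0: "integrable lborel (\<lambda>v. inverse (rr v) ^ (2 * CARD('n) + 2) * f (hchart j v))" for j
  proof (rule Bochner_Integration.integrable_bound)
    show "integrable lborel (\<lambda>v. B * inverse (rr (v :: real ^ ('n \<times> 4))) ^ (2 * CARD('n) + 2))"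
      using integrable_rr_power[where 'n = 'n and k = 1] by simp
    show "(\<lambda>v. inverse (rr v) ^ (2 * CARD('n) + 2) * f (hchart j v)) \<in> borel_measurable lborel"
      using fj by measurable
    show "AE v in lborel. norm (inverse (rr v) ^ (2 * CARD('n) + 2) * f (hchart j v)) \<le> norm (B * inverse (rr v) ^ (2 * CARD('n) + 2))"
    proof (rule AE_I2)
      fix v :: "real ^ ('n \<times> 4)"
      have "\<bar>f (hchart j v)\<bar> \<le> \<bar>B\<bar>" using B[of "hchart j v"] by simp
      then show "norm (inverse (rr v) ^ (2 * CARD('n) + 2) * f (hchart j v)) \<le> norm (B * inverse (rr v) ^ (2 * CARD('n) + 2))"
        by (simp add: abs_mult mult_mono mult.commute del: power_Suc)
    qed
  qed
  have ij: "integrable lborel (\<lambda>v. chart_weight j v * f (hchart j v))" for j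
    by (subst integrable_cong_AE[OF _ _ AEj]) (use wj i0[of j] in \<open>auto intro: borel_measurable_integrable\<close>)
  have iM: "integrable M (\<lambda>p. w p * f (T p))"
    unfolding M_def
  proof (rule P.Fubini_integrable)
    show "(\<lambda>p. w p * f (T p)) \<in> borel_measurable (count_space UNIV \<Otimes>\<^sub>M lborel)"
      using w fT unfolding M_def by simp
    show "integrable (count_space UNIV) (\<lambda>x. \<integral>y. norm (w (x, y) * f (T (x, y))) \<partial>lborel)"
      by (rule integrable_count_space) simp
    show "AE x in count_space UNIV. integrable lborel (\<lambda>y. w (x, y) * f (T (x, y)))"
      using ij by (simp add: w_def T_def)
  qed
  show "integrable fs_volume f"
    unfolding V integrable_distr_eq[OF Td f]
    by (subst integrable_density) (use fT w w0 iM in auto)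
  have "(\<integral>z. f z \<partial>fs_volume) = (\<integral>p. w p * f (T p) \<partial>M)"
    unfolding V integral_distr[OF Td f]
    by (subst integral_density) (use fT w w0 in auto)
  also have "\<dots> = (\<integral>j. (\<integral>v. w (j, v) * f (T (j, v)) \<partial>lborel) \<partial>count_space UNIV)"
    unfolding M_def by (rule P.integral_fst'[symmetric]) (use iM M_def in simp)
  also have "\<dots> = (\<Sum>j\<in>UNIV. \<integral>v. chart_weight j v * f (hchart j v) \<partial>lborel)"
    by (simp add: lebesgue_integral_count_space_finite w_def T_def)
  also have "\<dots> = (\<Sum>j\<in>UNIV. 1 / (real CARD('n) + 1) * (\<integral>v. inverse (rr v) ^ (2 * CARD('n) + 2) * f (hchart j v) \<partial>lborel))"
  proof (rule sum.cong[OF refl])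
    fix j
    have "(\<integral>v. chart_weight j v * f (hchart j v) \<partial>lborel)
        = (\<integral>v. 1 / (real CARD('n) + 1) * (inverse (rr v) ^ (2 * CARD('n) + 2) * f (hchart j v)) \<partial>lborel)"
      by (rule integral_cong_AE) (use wj fj AEj in auto)
    then show "(\<integral>v. chart_weight j v * f (hchart j v) \<partial>lborel)
        = 1 / (real CARD('n) + 1) * (\<integral>v. inverse (rr v) ^ (2 * CARD('n) + 2) * f (hchart j v) \<partial>lborel)"
      by simp
  qed
  finally show "(\<integral>z. f z \<partial>fs_volume) = 1 / (real CARD('n) + 1) *
      (\<Sum>j\<in>UNIV. \<integral>v. inverse (rr v) ^ (2 * CARD('n) + 2) * f (hchart j v) \<partial>lborel)"
    by (simp add: sum_distrib_left)
qed

lemma fs_volume_total: "(\<integral>z. 1 \<partial>(fs_volume :: 'n::finite hproj measure)) = pi ^ (2 * CARD('n)) / fact (2 * CARD('n) + 1)"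
  using fs_integral[of "\<lambda>_ :: 'n hproj. 1" 1] integral_rr_power[where 'n = 'n and k = 1] by (simp add: add.commute)

section \<open>Green's identity\<close>

lemma partial_deriv_outside_support:
  assumes supp: "\<And>v. norm v > r \<Longrightarrow> f v = 0" and v: "norm v > r"
  shows "partial_deriv a f v = 0"
proof -
  have "(f has_derivative (\<lambda>h. 0)) (at v)"
  proof (rule has_derivative_transform_within_open[of "\<lambda>_. 0"])
    show "((\<lambda>_. 0) has_derivative (\<lambda>h. 0)) (at v)" by simp
    show "open {w. r < norm w}" by (intro open_Collect_less continuous_intros)
  qed (use v supp in auto)
  from partial_deriv_eq[OF this] show ?thesis .
qed

text \<open>
  By translation invariance the difference quotients have integral \<open>0\<close>, and they converge to the
  partial derivative with a bounded majorant of compact support.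
\<close>

lemma integral_partial_deriv_eq_0:
  fixes \<psi> :: "real ^ 'm::finite \<Rightarrow> real"
  assumes diff: "\<And>v. \<psi> differentiable at v" and cont: "continuous_on UNIV (partial_deriv a \<psi>)"
    and supp: "\<And>v. norm v > r \<Longrightarrow> \<psi> v = 0"
  shows "integrable lborel (partial_deriv a \<psi>)" and "(\<integral>v. partial_deriv a \<psi> v \<partial>lborel) = 0"
proof -
  define D where "D = partial_deriv a \<psi>"
  define e where "e = axis a (1::real)"
  have ne: "norm e = 1" by (simp add: e_def norm_axis_1)
  have D0: "D v = 0" if "norm v > r" for v
    unfolding D_def by (rule partial_deriv_outside_support[OF supp that])
  have "bounded (D ` cball 0 r)"
    unfolding D_def by (intro compact_imp_bounded compact_continuous_image continuous_on_subset[OF cont]) auto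
  then obtain B0 where "\<forall>x\<in>D ` cball 0 r. norm x \<le> B0" unfolding bounded_iff by blast
  then have B0: "\<bar>D v\<bar> \<le> B0" if "norm v \<le> r" for v using that by simp
  define B where "B = \<bar>B0\<bar>"
  have B: "\<bar>D v\<bar> \<le> B" for v
  proof (cases "norm v > r")
    case False
    then show ?thesis using B0[of v] by (simp add: B_def)
  qed (simp add: D0 B_def)
  have contp: "continuous_on UNIV \<psi>" by (rule differentiable_UNIV_continuous[OF diff])
  have line: "((\<lambda>s. \<psi> (v + s *\<^sub>R e)) has_real_derivative D (v + s *\<^sub>R e)) (at s)" for v s
  proof -
    have "((\<lambda>s. \<psi> (v + s *\<^sub>R e)) has_derivative (\<lambda>h. \<Sum>b\<in>UNIV. (h *\<^sub>R e) $ b * partial_deriv b \<psi> (v + s *\<^sub>R e))) (at s)"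
      by (rule has_derivative_compose[OF _ has_derivative_partials[OF diff]]) (auto intro!: derivative_eq_intros)
    moreover have "(\<Sum>b\<in>UNIV. (h *\<^sub>R e) $ b * partial_deriv b \<psi> (v + s *\<^sub>R e)) = D (v + s *\<^sub>R e) * h" for h
    proof -
      have "(\<Sum>b\<in>UNIV. (h *\<^sub>R e) $ b * partial_deriv b \<psi> (v + s *\<^sub>R e)) = (\<Sum>b\<in>UNIV. if b = a then h * partial_deriv a \<psi> (v + s *\<^sub>R e) else 0)"
        by (rule sum.cong) (auto simp: e_def axis_def)
      then show ?thesis by (simp add: D_def)
    qed
    ultimately show ?thesis unfolding has_field_derivative_def by simp
  qed
  define q where "q k v = (\<psi> (v + inverse (real (Suc k)) *\<^sub>R e) - \<psi> v) / inverse (real (Suc k))" for k v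
  have qlim: "(\<lambda>k. q k v) \<longlonglongrightarrow> D v" for v
  proof -
    have "((\<lambda>h. (\<psi> (v + (0 + h) *\<^sub>R e) - \<psi> (v + 0 *\<^sub>R e)) / h) \<longlongrightarrow> D (v + 0 *\<^sub>R e)) (at 0)"
      using line[of v 0] unfolding DERIV_def .
    moreover have "filterlim (\<lambda>k. inverse (real (Suc k))) (at 0) sequentially"
      by (rule filterlim_atI[OF LIMSEQ_inverse_real_of_nat]) simp
    ultimately have "(\<lambda>k. (\<psi> (v + (0 + inverse (real (Suc k))) *\<^sub>R e) - \<psi> (v + 0 *\<^sub>R e)) / inverse (real (Suc k))) \<longlonglongrightarrow> D (v + 0 *\<^sub>R e)"
      by (rule filterlim_compose)
    then show ?thesis by (simp add: q_def)
  qed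
  have qb: "\<bar>q k v\<bar> \<le> B * indicator (cball 0 (r + 1)) v" for k v
  proof (cases "v \<in> cball 0 (r + 1)")
    case True
    have h: "0 < inverse (real (Suc k))" by simp
    obtain z where z: "\<psi> (v + inverse (real (Suc k)) *\<^sub>R e) - \<psi> (v + 0 *\<^sub>R e) = (inverse (real (Suc k)) - 0) * D (v + z *\<^sub>R e)"
      using MVT2[OF h, of "\<lambda>s. \<psi> (v + s *\<^sub>R e)" "\<lambda>s. D (v + s *\<^sub>R e)"] line by blast
    then have "q k v = D (v + z *\<^sub>R e)" by (simp add: q_def field_simps)
    then show ?thesis using B True by simp
  next
    case False
    then have n: "norm v > r + 1" by simp
    have "norm (inverse (real (Suc k)) *\<^sub>R e) \<le> 1" by (simp add: ne inverse_le_1_iff)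
    then have "norm (v + inverse (real (Suc k)) *\<^sub>R e) > r"
      using norm_diff_ineq[of v "inverse (real (Suc k)) *\<^sub>R e"] n by linarith
    then show ?thesis using n supp by (simp add: q_def indicator_def)
  qed
  have ind: "integrable lborel (indicator (cball 0 R) :: real ^ 'm \<Rightarrow> real)" for R
    by (rule integrable_real_indicator) (use emeasure_lborel_cball_finite[of 0 R] in auto)
  have ipsi: "integrable lborel \<psi>"
  proof -
    have "bounded (\<psi> ` cball 0 r)"
      by (intro compact_imp_bounded compact_continuous_image continuous_on_subset[OF contp]) auto
    then obtain C where "\<forall>x\<in>\<psi> ` cball 0 r. norm x \<le> C" unfolding bounded_iff by blast
    then have C: "\<bar>\<psi> v\<bar> \<le> C" if "norm v \<le> r" for v using that by simp
    show ?thesis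
    proof (rule Bochner_Integration.integrable_bound)
      show "integrable lborel (\<lambda>v :: real ^ 'm. C * indicator (cball 0 r) v :: real)" using ind by simp
      show "\<psi> \<in> borel_measurable lborel" using borel_measurable_continuous_onI[OF contp] by simp
      show "AE v in lborel. norm (\<psi> v) \<le> norm (C * indicator (cball 0 r) v)"
      proof (rule AE_I2)
        fix v :: "real ^ 'm"
        show "norm (\<psi> v) \<le> norm (C * indicator (cball 0 r) v)"
          using C[of v] supp[of v] by (cases "norm v \<le> r") (auto simp: indicator_def)
      qed
    qed
  qed
  have tr: "integrable lborel (\<lambda>v. \<psi> (v + c))" "(\<integral>v. \<psi> (v + c) \<partial>lborel) = (\<integral>v. \<psi> v \<partial>lborel)" for c
  proof -
    have m: "(\<lambda>v. c + v) \<in> measurable lborel borel" by simp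
    have d: "distr lborel borel (\<lambda>v. c + v) = (lborel :: (real ^ 'm) measure)" using lborel_distr_plus[of c] by simp
    have pm: "\<psi> \<in> borel_measurable borel" using borel_measurable_continuous_onI[OF contp] by simp
    have "integrable (distr lborel borel (\<lambda>v. c + v)) \<psi>" unfolding d by (rule ipsi)
    then show "integrable lborel (\<lambda>v. \<psi> (v + c))" using integrable_distr_eq[OF m pm] by (simp add: add.commute)
    have "(\<integral>v. \<psi> v \<partial>distr lborel borel (\<lambda>v. c + v)) = (\<integral>v. \<psi> (c + v) \<partial>lborel)" by (rule integral_distr[OF m pm])
    then show "(\<integral>v. \<psi> (v + c) \<partial>lborel) = (\<integral>v. \<psi> v \<partial>lborel)" unfolding d by (simp add: add.commute)
  qed
  have q0: "(\<integral>v. q k v \<partial>lborel) = 0" for k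
    unfolding q_def by (simp add: Bochner_Integration.integral_diff[OF tr(1) ipsi] tr(2))
  have Dm: "D \<in> borel_measurable lborel" unfolding D_def using borel_measurable_continuous_onI[OF cont] by simp
  have qm: "q k \<in> borel_measurable lborel" for k
    unfolding q_def using borel_measurable_integrable[OF tr(1)] borel_measurable_integrable[OF ipsi] by measurable
  have iw: "integrable lborel (\<lambda>v :: real ^ 'm. B * indicator (cball 0 (r + 1)) v :: real)" using ind by simp
  show "integrable lborel (partial_deriv a \<psi>)"
    unfolding D_def[symmetric]
    by (rule integrable_dominated_convergence[where s = q, OF Dm qm iw]) (use qlim qb in auto)
  have "(\<lambda>k. \<integral>v. q k v \<partial>lborel) \<longlonglongrightarrow> (\<integral>v. D v \<partial>lborel)"
    by (rule integral_dominated_convergence[where s = q, OF Dm qm iw]) (use qlim qb in auto)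
  then show "(\<integral>v. partial_deriv a \<psi> v \<partial>lborel) = 0"
    unfolding q0 D_def[symmetric] using LIMSEQ_unique[OF tendsto_const] by force
qed

lemma ratf_JJ: "ratf (\<lambda>v. JJ c v $ a)"
proof -
  obtain k d where a: "a = (k, d)" by (cases a)
  have "JJ c v $ a = (\<Sum>e\<in>UNIV. qc d (qe e * qe c) * v $ (k, e))" for v
  proof -
    have "JJ c v $ a = qc d ((\<Sum>e\<in>UNIV. qc e (quat_coord v k) *\<^sub>R qe e) * qe c)"
      unfolding a rmulq_def qpack_nth by (rule arg_cong[OF quat_expand, of "\<lambda>q. qc d (q * qe c)"])
    then show ?thesis by (simp add: sum_distrib_right qc_sum mult.commute)
  qed
  then have "(\<lambda>v. JJ c v $ a) = (\<lambda>v. \<Sum>e\<in>UNIV. qc d (qe e * qe c) * v $ (k, e))" by blast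
  then show ?thesis by (simp only:) (intro ratf_sum ratf_mult ratf_const ratf_coord)
qed

lemma ratf_quat_outer: "ratf (\<lambda>v. quat_outer v a b)"
  unfolding quat_outer_def by (intro ratf_sum ratf_mult ratf_JJ)

lemma ratf_flux_coeff: "ratf (\<lambda>v. flux_coeff v a b)"
  unfolding flux_coeff_def by (intro ratf_mult ratf_power ratf_inverse ratf_add ratf_const ratf_quat_outer)

lemma flux_coeff_sym: "flux_coeff v a b = flux_coeff v b a"
  by (simp add: flux_coeff_def quat_outer_sym[of v a b])

lemma chart_lap_divergence:
  fixes v :: "real ^ ('n::finite \<times> 4)"
  assumes f: "C2 f"
  shows "inverse (rr v) ^ (2 * CARD('n) + 2) * chart_lap f v =
     (\<Sum>a\<in>UNIV. \<Sum>b\<in>UNIV. partial_deriv a (\<lambda>w. flux_coeff w a b * partial_deriv b f w) v)"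
proof -
  have R: "rr v > 0" by (rule rr_pos)
  have "inverse (rr v) ^ (2 * CARD('n) + 2) * rr v ^ (2 * CARD('n) + 2) = 1"
    using R by (simp add: power_mult_distrib[symmetric] del: power_Suc)
  then have c: "inverse (rr v) ^ (2 * CARD('n) + 2) * (rr v ^ (2 * CARD('n) + 2) * X) = X" for X
    by (simp only: mult.assoc[symmetric] mult_1)
  show ?thesis
    unfolding laplace_beltrami_eq_chart_lap(1)[OF f, of None v, symmetric] laplace_beltrami_eq_chart_lap(2)[OF f, of None v] by (rule c)
qed

lemma continuous_chart_lap: "C2 f \<Longrightarrow> continuous_on UNIV (chart_lap f)"
  unfolding chart_lap_def
  by (intro continuous_intros continuous_rr C2_D C2_continuous(1)[OF ratf_C2[OF ratf_quat_outer]] C2_continuous)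

text \<open>
  Since \<open>flux_coeff\<close> is symmetric, the integrand is the divergence of a vector field with compact
  support.
\<close>

lemma green_compact_support:
  fixes h \<eta> :: "real ^ ('n::finite \<times> 4) \<Rightarrow> real"
  assumes h: "C2 h" and \<eta>: "C2 \<eta>" and supp: "\<And>v. norm v > r \<Longrightarrow> \<eta> v = 0"
  shows "(\<integral>v. inverse (rr v) ^ (2 * CARD('n) + 2) * (\<eta> v * chart_lap h v - h v * chart_lap \<eta> v) \<partial>lborel) = 0"
proof -
  define X where "X f a b = (\<lambda>w. flux_coeff w a b * partial_deriv b f w)" for f :: "real ^ ('n \<times> 4) \<Rightarrow> real" and a b
  note A = C2_D(1)[OF ratf_C2[OF ratf_flux_coeff]]
  have X: "X f a b differentiable at v" "continuous_on UNIV (X f a b)" "continuous_on UNIV (partial_deriv a (X f a b))"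
    if f: "C2 f" for f a b v
  proof -
    show "X f a b differentiable at v" "continuous_on UNIV (X f a b)" for v
      unfolding X_def
      by (intro differentiable_mult A C2_D[OF f] continuous_on_mult C2_continuous[OF f] C2_continuous(1)[OF ratf_C2[OF ratf_flux_coeff]])+
    have "partial_deriv a (X f a b) = (\<lambda>v. flux_coeff v a b * partial_deriv a (partial_deriv b f) v + partial_deriv a (\<lambda>w. flux_coeff w a b) v * partial_deriv b f v)"
      unfolding X_def using partial_deriv_mult[OF A C2_D(2)[OF f]] by blast
    then show "continuous_on UNIV (partial_deriv a (X f a b))"
      by (simp only:) (intro continuous_intros C2_continuous[OF f] C2_D(3)[OF f] C2_continuous[OF ratf_C2[OF ratf_flux_coeff]])
  qed
  define \<psi> where "\<psi> a b = (\<lambda>w. \<eta> w * X h a b w + (- 1) * (h w * X \<eta> a b w))" for a b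
  note dh = C2_D(1)[OF h] and de = C2_D(1)[OF \<eta>]
  have pd: "partial_deriv a (\<psi> a b) v = (\<eta> v * partial_deriv a (X h a b) v + partial_deriv a \<eta> v * X h a b v)
     - (h v * partial_deriv a (X \<eta> a b) v + partial_deriv a h v * X \<eta> a b v)" for a b v
  proof -
    have c: "partial_deriv a (\<lambda>w. (- 1) * g w) v = - partial_deriv a g v" if g: "g differentiable at v" for g :: "real ^ ('n \<times> 4) \<Rightarrow> real"
    proof -
      obtain G where G: "(g has_derivative G) (at v)" using g unfolding differentiable_def by blast
      have "((\<lambda>w. (- 1) * g w) has_derivative (\<lambda>h. (- 1) * G h)) (at v)" by (rule has_derivative_mult_right[OF G])
      from partial_deriv_eq[OF this] show ?thesis using partial_deriv_eq[OF G] by simp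
    qed
    show ?thesis
      unfolding \<psi>_def
      by (subst partial_deriv_add, (intro differentiable_mult differentiable_const dh de X h \<eta>)+,
          subst c, (intro differentiable_mult dh X \<eta>)+,
          simp add: partial_deriv_mult dh de X(1)[OF h] X(1)[OF \<eta>])
  qed
  have supp': "\<psi> a b v = 0" if "norm v > r" for a b v
  proof -
    have "partial_deriv b \<eta> v = 0" by (rule partial_deriv_outside_support[OF supp that])
    then show ?thesis using supp[OF that] by (simp add: \<psi>_def X_def)
  qed
  have dpsi: "\<psi> a b differentiable at v" for a b v
    unfolding \<psi>_def by (intro differentiable_add differentiable_mult differentiable_const dh de X h \<eta>)
  have cpsi: "continuous_on UNIV (partial_deriv a (\<psi> a b))" for a b
    unfolding pd[abs_def] by (intro continuous_intros C2_continuous h \<eta> X)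
  have i: "integrable lborel (partial_deriv a (\<psi> a b))" "(\<integral>v. partial_deriv a (\<psi> a b) v \<partial>lborel) = 0" for a b
    using integral_partial_deriv_eq_0[OF dpsi cpsi supp'] by auto
  have "inverse (rr v) ^ (2 * CARD('n) + 2) * (\<eta> v * chart_lap h v - h v * chart_lap \<eta> v) = (\<Sum>a\<in>UNIV. \<Sum>b\<in>UNIV. partial_deriv a (\<psi> a b) v)" for v
  proof -
    have sym: "(\<Sum>a\<in>UNIV. \<Sum>b\<in>UNIV. partial_deriv a \<eta> v * X h a b v) = (\<Sum>a\<in>UNIV. \<Sum>b\<in>UNIV. partial_deriv a h v * X \<eta> a b v)"
      by (subst sum.swap) (simp add: X_def flux_coeff_sym[of v] mult_ac)
    have "inverse (rr v) ^ (2 * CARD('n) + 2) * (\<eta> v * chart_lap h v - h v * chart_lap \<eta> v)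
       = \<eta> v * (inverse (rr v) ^ (2 * CARD('n) + 2) * chart_lap h v) - h v * (inverse (rr v) ^ (2 * CARD('n) + 2) * chart_lap \<eta> v)"
      by (simp add: algebra_simps)
    also have "\<dots> = \<eta> v * (\<Sum>a\<in>UNIV. \<Sum>b\<in>UNIV. partial_deriv a (X h a b) v) - h v * (\<Sum>a\<in>UNIV. \<Sum>b\<in>UNIV. partial_deriv a (X \<eta> a b) v)"
      unfolding chart_lap_divergence[OF h] chart_lap_divergence[OF \<eta>] X_def ..
    also have "\<dots> = (\<Sum>a\<in>UNIV. \<Sum>b\<in>UNIV. partial_deriv a (\<psi> a b) v)"
      unfolding pd sum_subtractf sum.distrib sym by (simp add: sum_distrib_left)
    finally show ?thesis .
  qed
  then show ?thesis by (simp add: i Bochner_Integration.integral_sum)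
qed

lemma DERIV_max0_power: "((\<lambda>x. max 0 x ^ (k + 2)) has_real_derivative (real k + 2) * max 0 x ^ (k + 1)) (at (x::real))"
proof -
  consider "x > 0" | "x < 0" | "x = 0" by linarith
  then show ?thesis
  proof cases
    case 1
    have "((\<lambda>x. x ^ (k + 2)) has_real_derivative (real k + 2) * x ^ (k + 1)) (at x)"
      by (rule DERIV_cong[OF DERIV_pow]) simp
    then have "((\<lambda>x. max 0 x ^ (k + 2)) has_real_derivative (real k + 2) * x ^ (k + 1)) (at x)"
      by (rule has_field_derivative_transform_within_open[of _ _ _ "{0<..}"]) (use 1 in auto)
    then show ?thesis using 1 by simp
  next
    case 2
    have "((\<lambda>x. max 0 x ^ (k + 2)) has_real_derivative 0) (at x)"
      by (rule has_field_derivative_transform_within_open[of "\<lambda>_. 0" _ _ "{..<0}"]) (use 2 in auto)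
    then show ?thesis using 2 by simp
  next
    case 3
    have "((\<lambda>h. max 0 h ^ (k + 2) / h) \<longlongrightarrow> 0) (at (0::real))"
    proof (rule Lim_null_comparison)
      have "((\<lambda>h. max 0 h ^ (k + 1)) \<longlongrightarrow> max 0 0 ^ (k + 1)) (at (0::real))" by (intro tendsto_intros)
      then show "((\<lambda>h. max 0 h ^ (k + 1)) \<longlongrightarrow> 0) (at (0::real))" by simp
      show "eventually (\<lambda>h. norm (max 0 h ^ (k + 2) / h) \<le> max 0 h ^ (k + 1)) (at (0::real))"
        by (rule always_eventually) (auto simp: max_def)
    qed
    then show ?thesis unfolding DERIV_def 3 by simp
  qed
qed

text \<open>
  Its cube is twice continuously differentiable with compact support, and it tends to \<open>1\<close> as
  \<open>\<epsilon>\<close> tends to \<open>0\<close>.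
\<close>

definition cutoff_base :: "real \<Rightarrow> real ^ ('n::finite \<times> 4) \<Rightarrow> real" where
  "cutoff_base \<epsilon> v = max 0 (1 - \<epsilon> * rr v)"

lemma partial_cutoff_base_power:
  fixes v :: "real ^ ('n::finite \<times> 4)"
  shows "(\<lambda>v. cutoff_base \<epsilon> v ^ (k + 2)) differentiable at v"
    and "partial_deriv a (\<lambda>v. cutoff_base \<epsilon> v ^ (k + 2)) v = - 2 * \<epsilon> * (real k + 2) * cutoff_base \<epsilon> v ^ (k + 1) * v $ a"
proof -
  have d1: "((\<lambda>v. 1 - \<epsilon> * rr v) has_derivative (\<lambda>h. - (\<epsilon> * (2 * (v \<bullet> h))))) (at v)"
    by (rule has_derivative_eq_rhs[OF has_derivative_diff[OF has_derivative_const has_derivative_mult_right[OF rr_has_derivative]]]) simp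
  have d: "((\<lambda>v. cutoff_base \<epsilon> v ^ (k + 2)) has_derivative (\<lambda>h. - (\<epsilon> * (2 * (v \<bullet> h))) * ((real k + 2) * cutoff_base \<epsilon> v ^ (k + 1)))) (at v)"
    unfolding cutoff_base_def
    using has_derivative_compose[OF d1 DERIV_max0_power[of k, unfolded has_field_derivative_def]] by (simp add: mult.commute)
  then show "(\<lambda>v. cutoff_base \<epsilon> v ^ (k + 2)) differentiable at v" by (auto simp: differentiable_def)
  show "partial_deriv a (\<lambda>v. cutoff_base \<epsilon> v ^ (k + 2)) v = - 2 * \<epsilon> * (real k + 2) * cutoff_base \<epsilon> v ^ (k + 1) * v $ a"
    using partial_deriv_eq[OF d] by (simp add: inner_axis)
qed

lemma continuous_cutoff_base: "continuous_on UNIV (cutoff_base \<epsilon>)"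
  unfolding cutoff_base_def by (intro continuous_intros continuous_rr)

lemma cutoff_C2:
  fixes v :: "real ^ ('n::finite \<times> 4)"
  shows "C2 (\<lambda>v :: real ^ ('n \<times> 4). cutoff_base \<epsilon> v ^ 3)"
    and "partial_deriv b (\<lambda>v. cutoff_base \<epsilon> v ^ 3) v = - 6 * \<epsilon> * (cutoff_base \<epsilon> v)\<^sup>2 * v $ b"
    and "partial_deriv a (partial_deriv b (\<lambda>v. cutoff_base \<epsilon> v ^ 3)) v =
      - 6 * \<epsilon> * (cutoff_base \<epsilon> v)\<^sup>2 * (if a = b then 1 else 0) + 24 * \<epsilon>\<^sup>2 * cutoff_base \<epsilon> v * (v $ a * v $ b)"
proof -
  have d3: "(\<lambda>v. cutoff_base \<epsilon> v ^ 3) differentiable at v" "partial_deriv b (\<lambda>v. cutoff_base \<epsilon> v ^ 3) v = - 6 * \<epsilon> * (cutoff_base \<epsilon> v)\<^sup>2 * v $ b" for b and v :: "real ^ ('n \<times> 4)"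
    using partial_cutoff_base_power[where \<epsilon> = \<epsilon> and k = 1] by (simp_all add: numeral_3_eq_3 numeral_2_eq_2)
  show "partial_deriv b (\<lambda>v. cutoff_base \<epsilon> v ^ 3) v = - 6 * \<epsilon> * (cutoff_base \<epsilon> v)\<^sup>2 * v $ b" by (rule d3)
  have d2: "(\<lambda>v. (cutoff_base \<epsilon> v)\<^sup>2) differentiable at v" "partial_deriv b (\<lambda>v. (cutoff_base \<epsilon> v)\<^sup>2) v = - 4 * \<epsilon> * cutoff_base \<epsilon> v * v $ b" for b and v :: "real ^ ('n \<times> 4)"
    using partial_cutoff_base_power[where \<epsilon> = \<epsilon> and k = 0] by (simp_all add: numeral_2_eq_2)
  have dc: "(\<lambda>v. - 6 * \<epsilon> * v $ b) differentiable at v" "partial_deriv a (\<lambda>v. - 6 * \<epsilon> * v $ b) v = - 6 * \<epsilon> * (if a = b then 1 else 0)" for a b and v :: "real ^ ('n \<times> 4)"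
  proof -
    have d: "((\<lambda>v. - 6 * \<epsilon> * v $ b) has_derivative (\<lambda>h. - 6 * \<epsilon> * h $ b)) (at v)"
      by (rule has_derivative_mult_right[OF coord_derivative])
    then show "(\<lambda>v. - 6 * \<epsilon> * v $ b) differentiable at v" by (auto simp: differentiable_def)
    show "partial_deriv a (\<lambda>v. - 6 * \<epsilon> * v $ b) v = - 6 * \<epsilon> * (if a = b then 1 else 0)"
      unfolding partial_deriv_eq[OF d] by (simp add: axis_def)
  qed
  have e: "partial_deriv b (\<lambda>v. cutoff_base \<epsilon> v ^ 3) = (\<lambda>v. (- 6 * \<epsilon> * v $ b) * (cutoff_base \<epsilon> v)\<^sup>2)" for b :: "'n \<times> 4"
    by (rule ext, subst d3(2), simp)
  have d4: "partial_deriv a (partial_deriv b (\<lambda>v. cutoff_base \<epsilon> v ^ 3)) v =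
      - 6 * \<epsilon> * (cutoff_base \<epsilon> v)\<^sup>2 * (if a = b then 1 else 0) + 24 * \<epsilon>\<^sup>2 * cutoff_base \<epsilon> v * (v $ a * v $ b)" for a b and v :: "real ^ ('n \<times> 4)"
  proof -
    have m: "partial_deriv a (\<lambda>v. (- 6 * \<epsilon> * v $ b) * (cutoff_base \<epsilon> v)\<^sup>2) v
      = (- 6 * \<epsilon> * v $ b) * partial_deriv a (\<lambda>v. (cutoff_base \<epsilon> v)\<^sup>2) v + partial_deriv a (\<lambda>v. - 6 * \<epsilon> * v $ b) v * (cutoff_base \<epsilon> v)\<^sup>2"
      by (rule partial_deriv_mult[OF dc(1) d2(1)])
    show ?thesis unfolding e m dc(2) d2(2) by (simp add: power2_eq_square)
  qed
  then show "partial_deriv a (partial_deriv b (\<lambda>v. cutoff_base \<epsilon> v ^ 3)) v =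
      - 6 * \<epsilon> * (cutoff_base \<epsilon> v)\<^sup>2 * (if a = b then 1 else 0) + 24 * \<epsilon>\<^sup>2 * cutoff_base \<epsilon> v * (v $ a * v $ b)" .
  show "C2 (\<lambda>v :: real ^ ('n \<times> 4). cutoff_base \<epsilon> v ^ 3)"
    unfolding C2_def
  proof (intro conjI allI)
    show "partial_deriv b (\<lambda>v. cutoff_base \<epsilon> v ^ 3) differentiable at v" for b and v :: "real ^ ('n \<times> 4)"
      unfolding e by (intro differentiable_mult dc(1) d2(1))
    show "continuous_on UNIV (partial_deriv a (partial_deriv b (\<lambda>v :: real ^ ('n \<times> 4). cutoff_base \<epsilon> v ^ 3)))" for a b
      unfolding d4[abs_def] by (intro continuous_intros continuous_cutoff_base)
  qed (rule d3)
qed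

lemma trace_quat_outer: "(\<Sum>a\<in>UNIV. quat_outer v a a) = 4 * (v \<bullet> v)"
proof -
  have "(\<Sum>a\<in>UNIV. quat_outer v a a) = (\<Sum>c\<in>UNIV. JJ c v \<bullet> JJ c v)"
    unfolding quat_outer_def by (subst sum.swap) (simp add: inner_vec_def)
  then show ?thesis unfolding inner_JJ by (simp add: sum_four)
qed

text \<open>
  The derivatives of the cutoff function are radial, and \<open>quat_outer v\<close> multiplies the radial vector
  \<open>v\<close> by \<open>|v|\<^sup>2\<close>; hence only the radial derivative of \<open>\<phi>\<close> occurs.
\<close>

lemma chart_lap_cutoff_mult:
  fixes v :: "real ^ ('n::finite \<times> 4)" and \<phi> :: "real ^ ('n \<times> 4) \<Rightarrow> real" and \<epsilon> :: real
  assumes \<phi>: "C2 \<phi>"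
  defines "m \<equiv> cutoff_base \<epsilon> v" and "R \<equiv> rr v"
  shows "chart_lap (\<lambda>v. cutoff_base \<epsilon> v ^ 3 * \<phi> v) v = m ^ 3 * chart_lap \<phi> v
     + \<phi> v * (24 * \<epsilon>\<^sup>2 * m * (v \<bullet> v) * R\<^sup>2 - 24 * real CARD('n) * \<epsilon> * m\<^sup>2 * R)
     - 12 * \<epsilon> * m\<^sup>2 * R\<^sup>2 * (\<Sum>a\<in>UNIV. v $ a * partial_deriv a \<phi> v)"
proof -
  define \<kappa> where "\<kappa> = (\<lambda>v :: real ^ ('n \<times> 4). cutoff_base \<epsilon> v ^ 3)"
  define E where "E = (\<Sum>a\<in>UNIV. v $ a * partial_deriv a \<phi> v)"
  define s where "s = v \<bullet> v"
  have K: "C2 \<kappa>" unfolding \<kappa>_def by (rule cutoff_C2)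
  have p1: "partial_deriv b \<kappa> v = (- 6 * \<epsilon> * m\<^sup>2) * v $ b" for b
    unfolding \<kappa>_def m_def by (rule cutoff_C2)
  have p2: "partial_deriv a (partial_deriv b \<kappa>) v = (- 6 * \<epsilon> * m\<^sup>2) * (if a = b then 1 else 0) + (24 * \<epsilon>\<^sup>2 * m) * (v $ a * v $ b)" for a b
    unfolding \<kappa>_def m_def by (rule cutoff_C2)
  define c d where "c = - 6 * \<epsilon> * m\<^sup>2" and "d = 24 * \<epsilon>\<^sup>2 * m"
  note p1 = p1[folded c_def] and p2 = p2[folded c_def d_def]
  have prod2: "partial_deriv a (partial_deriv b (\<lambda>v. \<kappa> v * \<phi> v)) v =
      \<kappa> v * partial_deriv a (partial_deriv b \<phi>) v + c * (v $ a * partial_deriv b \<phi> v)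
      + c * (v $ b * partial_deriv a \<phi> v) + \<phi> v * partial_deriv a (partial_deriv b \<kappa>) v" for a b
    unfolding C2_mult(2)[OF K \<phi>] p1 by (simp add: algebra_simps)
  have prod1: "partial_deriv b (\<lambda>v. \<kappa> v * \<phi> v) v = \<kappa> v * partial_deriv b \<phi> v + \<phi> v * partial_deriv b \<kappa> v" for b
    using partial_deriv_mult[OF C2_D(1)[OF K] C2_D(1)[OF \<phi>]] by (simp add: mult.commute)
  have M1: "(\<Sum>a\<in>UNIV. \<Sum>b\<in>UNIV. quat_outer v a b * (v $ a * partial_deriv b \<phi> v)) = s * E"
  proof -
    have "(\<Sum>a\<in>UNIV. \<Sum>b\<in>UNIV. quat_outer v a b * (v $ a * partial_deriv b \<phi> v)) = (\<Sum>b\<in>UNIV. (\<Sum>a\<in>UNIV. v $ a * quat_outer v a b) * partial_deriv b \<phi> v)"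
      by (subst sum.swap) (simp add: sum_distrib_left sum_distrib_right mult_ac)
    then show ?thesis unfolding sum_quat_outer_v by (simp add: E_def s_def sum_distrib_left mult.assoc)
  qed
  have M2: "(\<Sum>a\<in>UNIV. \<Sum>b\<in>UNIV. quat_outer v a b * (v $ b * partial_deriv a \<phi> v)) = s * E"
    unfolding M1[symmetric] by (subst sum.swap) (simp add: quat_outer_sym[of v])
  have M3: "(\<Sum>a\<in>UNIV. \<Sum>b\<in>UNIV. quat_outer v a b * (v $ a * v $ b)) = s * s"
  proof -
    have "(\<Sum>a\<in>UNIV. \<Sum>b\<in>UNIV. quat_outer v a b * (v $ a * v $ b)) = (\<Sum>b\<in>UNIV. (\<Sum>a\<in>UNIV. v $ a * quat_outer v a b) * v $ b)"
      by (subst sum.swap) (simp add: sum_distrib_left sum_distrib_right mult_ac)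
    then show ?thesis unfolding sum_quat_outer_v by (simp add: s_def inner_vec_def sum_distrib_left mult.assoc)
  qed
  have M4: "(\<Sum>a\<in>UNIV. \<Sum>b\<in>UNIV. quat_outer v a b * (if a = b then 1 else 0)) = 4 * s"
    unfolding trace_quat_outer[symmetric] s_def by (simp add: if_distrib[of "\<lambda>z. _ * z"] cong: if_cong)
  have ss: "(\<Sum>a\<in>UNIV. v $ a * v $ a) = s" by (simp add: s_def inner_vec_def)
  define T where "T f = (\<Sum>a\<in>UNIV. partial_deriv a (partial_deriv a f) v) + (\<Sum>a\<in>UNIV. \<Sum>b\<in>UNIV. quat_outer v a b * partial_deriv a (partial_deriv b f) v)" for f
  define N where "N f = (\<Sum>b\<in>UNIV. v $ b * partial_deriv b f v)" for f
  have hl: "chart_lap f v = R * (T f - 4 * N f)" for f by (simp add: chart_lap_def T_def N_def R_def)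
  have card: "real (card (UNIV :: ('n \<times> 4) set)) = 4 * real CARD('n)"
    unfolding card_affine_coords by simp
  have T\<kappa>: "T \<kappa> = c * (4 * real CARD('n)) + d * s + (c * (4 * s) + d * (s * s))"
  proof -
    have "(\<Sum>a\<in>UNIV. partial_deriv a (partial_deriv a \<kappa>) v) = c * (4 * real CARD('n)) + d * s"
      unfolding p2 sum.distrib sum_distrib_left[symmetric] ss card[symmetric] by simp
    moreover have "(\<Sum>a\<in>UNIV. \<Sum>b\<in>UNIV. quat_outer v a b * partial_deriv a (partial_deriv b \<kappa>) v) = c * (4 * s) + d * (s * s)"
    proof -
      have "(\<Sum>a\<in>UNIV. \<Sum>b\<in>UNIV. quat_outer v a b * partial_deriv a (partial_deriv b \<kappa>) v)
        = (\<Sum>a\<in>UNIV. \<Sum>b\<in>UNIV. c * (quat_outer v a b * (if a = b then 1 else 0)) + d * (quat_outer v a b * (v $ a * v $ b)))"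
        unfolding p2 by (intro sum.cong refl) (simp add: algebra_simps)
      then show ?thesis unfolding sum.distrib sum_distrib_left[symmetric] M3 M4 .
    qed
    ultimately show ?thesis by (simp add: T_def)
  qed
  have N\<kappa>: "N \<kappa> = c * s"
  proof -
    have "N \<kappa> = (\<Sum>b\<in>UNIV. c * (v $ b * v $ b))" unfolding N_def p1 by (simp add: mult.left_commute)
    then show ?thesis unfolding sum_distrib_left[symmetric] ss .
  qed
  have Tp: "T (\<lambda>v. \<kappa> v * \<phi> v) = \<kappa> v * T \<phi> + 2 * c * E + 2 * c * (s * E) + \<phi> v * T \<kappa>"
  proof -
    have "(\<Sum>a\<in>UNIV. partial_deriv a (partial_deriv a (\<lambda>v. \<kappa> v * \<phi> v)) v)
      = \<kappa> v * (\<Sum>a\<in>UNIV. partial_deriv a (partial_deriv a \<phi>) v) + c * E + c * E + \<phi> v * (\<Sum>a\<in>UNIV. partial_deriv a (partial_deriv a \<kappa>) v)"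
      unfolding prod2 sum.distrib sum_distrib_left E_def by simp
    moreover have "(\<Sum>a\<in>UNIV. \<Sum>b\<in>UNIV. quat_outer v a b * partial_deriv a (partial_deriv b (\<lambda>v. \<kappa> v * \<phi> v)) v)
      = \<kappa> v * (\<Sum>a\<in>UNIV. \<Sum>b\<in>UNIV. quat_outer v a b * partial_deriv a (partial_deriv b \<phi>) v) + c * (s * E) + c * (s * E)
        + \<phi> v * (\<Sum>a\<in>UNIV. \<Sum>b\<in>UNIV. quat_outer v a b * partial_deriv a (partial_deriv b \<kappa>) v)"
    proof -
      have "(\<Sum>a\<in>UNIV. \<Sum>b\<in>UNIV. quat_outer v a b * partial_deriv a (partial_deriv b (\<lambda>v. \<kappa> v * \<phi> v)) v)
        = (\<Sum>a\<in>UNIV. \<Sum>b\<in>UNIV. \<kappa> v * (quat_outer v a b * partial_deriv a (partial_deriv b \<phi>) v) + c * (quat_outer v a b * (v $ a * partial_deriv b \<phi> v))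
          + c * (quat_outer v a b * (v $ b * partial_deriv a \<phi> v)) + \<phi> v * (quat_outer v a b * partial_deriv a (partial_deriv b \<kappa>) v))"
        unfolding prod2 by (intro sum.cong refl) (simp add: algebra_simps)
      then show ?thesis unfolding sum.distrib sum_distrib_left[symmetric] M1 M2 .
    qed
    ultimately show ?thesis by (simp add: T_def algebra_simps)
  qed
  have Np: "N (\<lambda>v. \<kappa> v * \<phi> v) = \<kappa> v * N \<phi> + \<phi> v * N \<kappa>"
    unfolding N_def prod1 sum_distrib_left sum.distrib[symmetric] by (intro sum.cong refl) (simp add: algebra_simps)
  have Rs: "R = 1 + s" by (simp add: R_def rr_def s_def)
  have "chart_lap (\<lambda>v. \<kappa> v * \<phi> v) v = \<kappa> v * chart_lap \<phi> v + \<phi> v * (d * s * (R * R) + 4 * real CARD('n) * c * R) + 2 * c * (R * R) * E"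
    unfolding hl Tp Np T\<kappa> N\<kappa> unfolding Rs by (simp add: algebra_simps)
  then show ?thesis
    unfolding \<kappa>_def m_def[symmetric] E_def[symmetric] s_def[symmetric] c_def d_def
    by (simp add: power2_eq_square algebra_simps)
qed

text \<open>
  Replace \<open>\<phi>\<close> by its product with the cutoff function. On the support of the cutoff function \<open>\<epsilon> R \<le> 1\<close>,
  so by \<open>chart_lap_cutoff_mult\<close> the error terms are at most a multiple of \<open>R\<close>; the density contains
  \<open>R\<^sup>-\<^sup>2\<^sup>n\<^sup>-\<^sup>2\<close>, and \<open>R\<^sup>-\<^sup>2\<^sup>n\<^sup>-\<^sup>1\<close> is still integrable.
\<close>

lemma green_chart:
  fixes h \<phi> :: "real ^ ('n::finite \<times> 4) \<Rightarrow> real"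
  assumes h: "C2 h" and \<phi>: "C2 \<phi>"
    and Bh: "\<And>v. \<bar>h v\<bar> \<le> Bh" and BL: "\<And>v. \<bar>chart_lap h v\<bar> \<le> BL"
    and BP: "\<And>v. \<bar>\<phi> v\<bar> \<le> BP" and BQ: "\<And>v. \<bar>chart_lap \<phi> v\<bar> \<le> BQ"
    and BE: "\<And>v. \<bar>\<Sum>a\<in>UNIV. v $ a * partial_deriv a \<phi> v\<bar> \<le> BE"
  shows "(\<integral>v. inverse (rr v) ^ (2 * CARD('n) + 2) * (\<phi> v * chart_lap h v - h v * chart_lap \<phi> v) \<partial>lborel) = 0"
proof -
  define \<epsilon> where "\<epsilon> k = inverse (real (Suc k))" for k
  define \<eta> where "\<eta> k = (\<lambda>v :: real ^ ('n \<times> 4). cutoff_base (\<epsilon> k) v ^ 3 * \<phi> v)" for k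
  define \<rho> where "\<rho> v = inverse (rr v) ^ (2 * CARD('n) + 2)" for v :: "real ^ ('n \<times> 4)"
  define E where "E v = (\<Sum>a\<in>UNIV. v $ a * partial_deriv a \<phi> v)" for v
  define C where "C = BP * BL + Bh * (BQ + BP * (24 + 24 * real CARD('n)) + 12 * BE)"
  have nn: "0 \<le> Bh" "0 \<le> BL" "0 \<le> BP" "0 \<le> BQ" "0 \<le> BE"
    using order_trans[OF abs_ge_zero Bh] order_trans[OF abs_ge_zero BL] order_trans[OF abs_ge_zero BP]
      order_trans[OF abs_ge_zero BQ] order_trans[OF abs_ge_zero BE] by auto
  have \<epsilon>: "0 < \<epsilon> k" "\<epsilon> k \<le> 1" for k by (auto simp: \<epsilon>_def inverse_le_1_iff)
  have e0: "\<epsilon> \<longlonglongrightarrow> 0" unfolding \<epsilon>_def by (rule LIMSEQ_inverse_real_of_nat)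
  have C2\<eta>: "C2 (\<eta> k)" for k unfolding \<eta>_def by (rule C2_mult(1)[OF cutoff_C2(1) \<phi>])
  have supp: "\<eta> k v = 0" if v: "norm v > sqrt (real (Suc k))" for k v
  proof -
    have "sqrt (real (Suc k)) ^ 2 < norm v ^ 2" using v by (intro power_strict_mono) auto
    then have "real (Suc k) < rr v" by (simp add: rr_def power2_norm_eq_inner)
    then have "\<epsilon> k * rr v > 1" unfolding \<epsilon>_def by (simp add: field_simps)
    then have "cutoff_base (\<epsilon> k) v = 0" by (simp add: cutoff_base_def)
    then show ?thesis by (simp add: \<eta>_def)
  qed
  define q where "q k v = \<rho> v * (\<eta> k v * chart_lap h v - h v * chart_lap (\<eta> k) v)" for k v
  have q0: "(\<integral>v. q k v \<partial>lborel) = 0" for k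
    unfolding q_def \<rho>_def by (rule green_compact_support[OF h C2\<eta> supp])
  have hl: "chart_lap (\<eta> k) v = cutoff_base (\<epsilon> k) v ^ 3 * chart_lap \<phi> v
     + \<phi> v * (24 * (\<epsilon> k)\<^sup>2 * cutoff_base (\<epsilon> k) v * (v \<bullet> v) * (rr v)\<^sup>2 - 24 * real CARD('n) * \<epsilon> k * (cutoff_base (\<epsilon> k) v)\<^sup>2 * rr v)
     - 12 * \<epsilon> k * (cutoff_base (\<epsilon> k) v)\<^sup>2 * (rr v)\<^sup>2 * E v" for k v
    unfolding \<eta>_def E_def by (rule chart_lap_cutoff_mult[OF \<phi>])
  have qb: "\<bar>q k v\<bar> \<le> C * inverse (rr v) ^ (2 * CARD('n) + 0 + 1)" for k v
  proof -
    define m R s where "m = cutoff_base (\<epsilon> k) v" and "R = rr v" and "s = v \<bullet> v"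
    have R: "R \<ge> 1" unfolding R_def by (rule rr_ge_1)
    have s: "0 \<le> s" "s \<le> R" by (simp_all add: s_def R_def rr_def)
    have m: "0 \<le> m" "m \<le> 1"
      using \<epsilon>[of k] R by (auto simp: m_def cutoff_base_def R_def[symmetric])
    have mR: "\<epsilon> k * R \<le> 1" if "m \<noteq> 0" using that by (auto simp: m_def cutoff_base_def R_def max_def split: if_splits)
    have m2: "m\<^sup>2 \<le> 1" "0 \<le> m\<^sup>2" using m by (auto simp: power_le_one)
    have t1: "0 \<le> 24 * (\<epsilon> k)\<^sup>2 * m * s * R\<^sup>2 \<and> 24 * (\<epsilon> k)\<^sup>2 * m * s * R\<^sup>2 \<le> 24 * R"
    proof (cases "m = 0")
      case False
      have "(\<epsilon> k * R)\<^sup>2 \<le> 1" using mR[OF False] \<epsilon>[of k] R by (intro power_le_one) auto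
      then have "(\<epsilon> k * R)\<^sup>2 * (m * s) \<le> 1 * (1 * R)" using m s R by (intro mult_mono) auto
      then show ?thesis using m s by (simp add: power_mult_distrib mult_ac)
    qed (use R in simp)
    have t2: "0 \<le> 24 * real CARD('n) * \<epsilon> k * m\<^sup>2 * R \<and> 24 * real CARD('n) * \<epsilon> k * m\<^sup>2 * R \<le> 24 * real CARD('n) * R"
    proof -
      have "24 * real CARD('n) * (\<epsilon> k * m\<^sup>2) * R \<le> 24 * real CARD('n) * (1 * 1) * R"
        using \<epsilon>[of k] m2 R by (intro mult_right_mono mult_left_mono mult_mono) auto
      moreover have "0 \<le> 24 * real CARD('n) * \<epsilon> k * m\<^sup>2 * R" using \<epsilon>[of k] R by simp
      ultimately show ?thesis by (simp add: mult.assoc)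
    qed
    have t3: "0 \<le> 12 * \<epsilon> k * m\<^sup>2 * R\<^sup>2 \<and> 12 * \<epsilon> k * m\<^sup>2 * R\<^sup>2 \<le> 12 * R"
    proof (cases "m = 0")
      case False
      have "(\<epsilon> k * R) * m\<^sup>2 * R \<le> 1 * 1 * R" using mR[OF False] m2 \<epsilon>[of k] R by (intro mult_mono) auto
      then show ?thesis using \<epsilon>[of k] R m by (simp add: power2_eq_square mult_ac)
    qed (use R in simp)
    have L: "\<bar>chart_lap (\<eta> k) v\<bar> \<le> (BQ + BP * (24 + 24 * real CARD('n)) + 12 * BE) * R"
    proof -
      have a1: "\<bar>m ^ 3 * chart_lap \<phi> v\<bar> \<le> BQ * R"
      proof -
        have "\<bar>m ^ 3\<bar> * \<bar>chart_lap \<phi> v\<bar> \<le> 1 * BQ" using m BQ by (intro mult_mono) (auto simp: power_le_one)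
        also have "\<dots> \<le> BQ * R" using nn R by (simp add: mult_le_cancel_left1)
        finally show ?thesis by (simp add: abs_mult)
      qed
      have a2: "\<bar>\<phi> v * (24 * (\<epsilon> k)\<^sup>2 * m * s * R\<^sup>2 - 24 * real CARD('n) * \<epsilon> k * m\<^sup>2 * R)\<bar> \<le> BP * ((24 + 24 * real CARD('n)) * R)"
      proof -
        have "\<bar>24 * (\<epsilon> k)\<^sup>2 * m * s * R\<^sup>2 - 24 * real CARD('n) * \<epsilon> k * m\<^sup>2 * R\<bar> \<le> 24 * R + 24 * real CARD('n) * R"
          using t1 t2 by linarith
        then have "\<bar>24 * (\<epsilon> k)\<^sup>2 * m * s * R\<^sup>2 - 24 * real CARD('n) * \<epsilon> k * m\<^sup>2 * R\<bar> \<le> (24 + 24 * real CARD('n)) * R"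
          by (simp add: distrib_right)
        then show ?thesis unfolding abs_mult using BP[of v] nn by (intro mult_mono) auto
      qed
      have a3: "\<bar>12 * \<epsilon> k * m\<^sup>2 * R\<^sup>2 * E v\<bar> \<le> 12 * R * BE"
        unfolding abs_mult[of "12 * \<epsilon> k * m\<^sup>2 * R\<^sup>2"] using t3 BE[of v] R unfolding E_def[symmetric] by (intro mult_mono) auto
      have "\<bar>chart_lap (\<eta> k) v\<bar> \<le> BQ * R + BP * ((24 + 24 * real CARD('n)) * R) + 12 * R * BE"
        unfolding hl m_def[symmetric] R_def[symmetric] s_def[symmetric] using a1 a2 a3 by linarith
      then show ?thesis by (simp add: algebra_simps)
    qed
    have "\<bar>\<eta> k v * chart_lap h v - h v * chart_lap (\<eta> k) v\<bar> \<le> \<bar>\<eta> k v * chart_lap h v\<bar> + \<bar>h v * chart_lap (\<eta> k) v\<bar>" by (rule abs_triangle_ineq4)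
    also have "\<dots> \<le> (BP * BL) * R + Bh * ((BQ + BP * (24 + 24 * real CARD('n)) + 12 * BE) * R)"
    proof (rule add_mono)
      have "\<bar>\<eta> k v\<bar> \<le> 1 * BP" unfolding \<eta>_def abs_mult m_def[symmetric] using m BP by (intro mult_mono) (auto simp: power_le_one)
      then have "\<bar>\<eta> k v * chart_lap h v\<bar> \<le> BP * BL" unfolding abs_mult using BL[of v] nn by (intro mult_mono) auto
      also have "\<dots> \<le> (BP * BL) * R" using nn R mult_left_mono[of 1 R "BP * BL"] by simp
      finally show "\<bar>\<eta> k v * chart_lap h v\<bar> \<le> (BP * BL) * R" .
      show "\<bar>h v * chart_lap (\<eta> k) v\<bar> \<le> Bh * ((BQ + BP * (24 + 24 * real CARD('n)) + 12 * BE) * R)"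
        unfolding abs_mult using Bh[of v] L nn by (intro mult_mono) auto
    qed
    also have "\<dots> = C * R" by (simp add: C_def algebra_simps)
    finally have "\<bar>\<eta> k v * chart_lap h v - h v * chart_lap (\<eta> k) v\<bar> \<le> C * R" .
    moreover have "0 \<le> \<rho> v" unfolding \<rho>_def using R R_def by simp
    ultimately have "\<bar>q k v\<bar> \<le> \<rho> v * (C * R)"
      unfolding q_def abs_mult by (simp add: mult_left_mono)
    also have "\<rho> v * R = inverse (rr v) ^ (2 * CARD('n) + 0 + 1)"
      using R unfolding \<rho>_def R_def by simp
    then have "\<rho> v * (C * R) = C * inverse (rr v) ^ (2 * CARD('n) + 0 + 1)" by (simp add: mult.left_commute)
    finally show ?thesis .
  qed
  have qlim: "(\<lambda>k. q k v) \<longlonglongrightarrow> \<rho> v * (\<phi> v * chart_lap h v - h v * chart_lap \<phi> v)" for v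
  proof -
    have c: "(\<lambda>k. cutoff_base (\<epsilon> k) v) \<longlonglongrightarrow> max 0 (1 - 0 * rr v)"
      unfolding cutoff_base_def by (intro tendsto_intros e0)
    have c1: "(\<lambda>k. \<eta> k v) \<longlonglongrightarrow> (max 0 (1 - 0 * rr v)) ^ 3 * \<phi> v"
      unfolding \<eta>_def by (intro tendsto_intros c)
    have "(\<lambda>k. chart_lap (\<eta> k) v) \<longlonglongrightarrow> (max 0 (1 - 0 * rr v)) ^ 3 * chart_lap \<phi> v
     + \<phi> v * (24 * 0\<^sup>2 * max 0 (1 - 0 * rr v) * (v \<bullet> v) * (rr v)\<^sup>2 - 24 * real CARD('n) * 0 * (max 0 (1 - 0 * rr v))\<^sup>2 * rr v)
     - 12 * 0 * (max 0 (1 - 0 * rr v))\<^sup>2 * (rr v)\<^sup>2 * E v"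
      unfolding hl by (intro tendsto_intros c e0)
    then have c2: "(\<lambda>k. chart_lap (\<eta> k) v) \<longlonglongrightarrow> chart_lap \<phi> v" by simp
    have c1': "(\<lambda>k. \<eta> k v) \<longlonglongrightarrow> \<phi> v" using c1 by simp
    show ?thesis unfolding q_def by (intro tendsto_intros c1' c2)
  qed
  have cont\<rho>: "continuous_on UNIV \<rho>"
  proof -
    have "rr (v :: real ^ ('n \<times> 4)) \<noteq> 0" for v using rr_pos[of v] by simp
    then show ?thesis unfolding \<rho>_def by (intro continuous_intros continuous_rr) auto
  qed
  have meas: "(\<lambda>v. \<rho> v * (\<phi> v * chart_lap h v - h v * chart_lap \<phi> v)) \<in> borel_measurable lborel"
    using borel_measurable_continuous_onI[of "\<lambda>v. \<rho> v * (\<phi> v * chart_lap h v - h v * chart_lap \<phi> v)"]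
    by (simp add: continuous_on_mult continuous_on_diff cont\<rho> continuous_chart_lap h \<phi> C2_continuous(1))
  have measq: "q k \<in> borel_measurable lborel" for k
    unfolding q_def using borel_measurable_continuous_onI[of "\<lambda>v. \<rho> v * (\<eta> k v * chart_lap h v - h v * chart_lap (\<eta> k) v)"]
    by (simp add: continuous_on_mult continuous_on_diff cont\<rho> continuous_chart_lap h C2\<eta> C2_continuous(1))
  have iw: "integrable lborel (\<lambda>v :: real ^ ('n \<times> 4). C * inverse (rr v) ^ (2 * CARD('n) + 0 + 1))"
    by (intro integrable_mult_right integrable_rr_power)
  have "(\<lambda>k. \<integral>v. q k v \<partial>lborel) \<longlonglongrightarrow> (\<integral>v. \<rho> v * (\<phi> v * chart_lap h v - h v * chart_lap \<phi> v) \<partial>lborel)"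
    by (rule integral_dominated_convergence[where s = q, OF meas measq iw]) (use qlim qb in auto)
  then have "(\<lambda>k::nat. 0) \<longlonglongrightarrow> (\<integral>v. \<rho> v * (\<phi> v * chart_lap h v - h v * chart_lap \<phi> v) \<partial>lborel)" unfolding q0 .
  from LIMSEQ_unique[OF this tendsto_const] show ?thesis unfolding \<rho>_def .
qed

section \<open>Concentration of the powers\<close>

lemma chart_cont_mult: "chart_cont f \<Longrightarrow> chart_cont g \<Longrightarrow> chart_cont (\<lambda>z. f z * g z)"
  and chart_cont_diff: "chart_cont f \<Longrightarrow> chart_cont g \<Longrightarrow> chart_cont (\<lambda>z. f z - g z)"
  and chart_cont_const: "chart_cont (\<lambda>z. c)"
  unfolding chart_cont_def by (auto intro!: continuous_intros)

lemma chart_cont_integrable: "chart_cont f \<Longrightarrow> integrable fs_volume f"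
  by (metis chart_cont_bounded chart_cont_measurable fs_integrable)

lemma chart_cont_cossq_power: "chart_cont (\<lambda>z. cossq y z ^ N)"
  unfolding chart_cont_def using C2_continuous(1)[OF ratf_C2[OF cossq_power_ratf]] by blast

lemma chart_cont_laplacian:
  "(\<And>j. C2 (\<lambda>v. h (hchart j v))) \<Longrightarrow> chart_cont (fs_laplacian h)"
  unfolding chart_cont_def by (simp add: fs_laplacian_hchart continuous_chart_lap)

text \<open>
  By \<open>fs_integral\<close> an integral over the projective space is an average of integrals over the charts, and
  \<open>green_chart\<close> applies to each of them.
\<close>

lemma green_cossq_power:
  fixes h :: "'n::finite hproj \<Rightarrow> real"
  assumes h: "\<And>j. C2 (\<lambda>v. h (hchart j v))"
  shows "(\<integral>z. fs_laplacian h z * cossq y z ^ N \<partial>fs_volume) =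
     4 * real N * (real N + 1) * (\<integral>z. h z * cossq y z ^ (N - 1) \<partial>fs_volume) - eigval CARD('n) N * (\<integral>z. h z * cossq y z ^ N \<partial>fs_volume)"
proof -
  define c1 c2 where "c1 = 4 * real N * (real N + 1)" and "c2 = eigval CARD('n) N"
  have ch: "chart_cont h" unfolding chart_cont_def using C2_continuous(1)[OF h] by blast
  have cl: "chart_cont (fs_laplacian h)" by (rule chart_cont_laplacian[OF h])
  define f where "f z = fs_laplacian h z * cossq y z ^ N - (c1 * (h z * cossq y z ^ (N - 1)) - c2 * (h z * cossq y z ^ N))" for z
  have cf: "chart_cont f" unfolding f_def
    by (intro chart_cont_diff chart_cont_mult chart_cont_const ch cl chart_cont_cossq_power)
  obtain Bf where Bf: "\<And>z. \<bar>f z\<bar> \<le> Bf" using chart_cont_bounded[OF cf] by blast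
  obtain Bh where Bh: "\<And>z. \<bar>h z\<bar> \<le> Bh" using chart_cont_bounded[OF ch] by blast
  obtain BL where BL: "\<And>z. \<bar>fs_laplacian h z\<bar> \<le> BL" using chart_cont_bounded[OF cl] by blast
  have "(\<integral>z. f z \<partial>fs_volume) = 0"
  proof -
    have "(\<integral>v. inverse (rr v) ^ (2 * CARD('n) + 2) * f (hchart j v) \<partial>lborel) = 0" for j
    proof -
      define \<phi> where "\<phi> v = cossq y (hchart j v) ^ N" for v
      have L\<phi>: "chart_lap \<phi> v = c1 * cossq y (hchart j v) ^ (N - 1) - c2 * cossq y (hchart j v) ^ N" for v
        unfolding \<phi>_def[abs_def] chart_lap_cossq_power c1_def c2_def ..
      have u1: "0 \<le> cossq y (hchart j v) ^ k" "cossq y (hchart j v) ^ k \<le> 1" for k v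
        using cossq_bounds[of y "hchart j v"] by (simp_all add: power_le_one)
      have "(\<integral>v. inverse (rr v) ^ (2 * CARD('n) + 2) * (\<phi> v * chart_lap (\<lambda>v. h (hchart j v)) v - h (hchart j v) * chart_lap \<phi> v) \<partial>lborel) = 0"
      proof (rule green_chart[OF h])
        show "C2 \<phi>" unfolding \<phi>_def[abs_def] by (rule ratf_C2[OF cossq_power_ratf])
        show "\<bar>h (hchart j v)\<bar> \<le> Bh" for v by (rule Bh)
        show "\<bar>chart_lap (\<lambda>v. h (hchart j v)) v\<bar> \<le> BL" for v using BL[of "hchart j v"] by (simp add: fs_laplacian_hchart[OF h])
        show "\<bar>\<phi> v\<bar> \<le> 1" for v unfolding \<phi>_def using u1[of v N] by simp
        show "\<bar>chart_lap \<phi> v\<bar> \<le> c1 + c2" for v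
        proof -
          have "0 \<le> c1" "0 \<le> c2" by (simp_all add: c1_def c2_def eigval_def)
          then have "0 \<le> c1 * cossq y (hchart j v) ^ (N - 1)" "c1 * cossq y (hchart j v) ^ (N - 1) \<le> c1"
              "0 \<le> c2 * cossq y (hchart j v) ^ N" "c2 * cossq y (hchart j v) ^ N \<le> c2"
            using u1 by (auto simp: mult_left_le)
          then show ?thesis unfolding L\<phi> by linarith
        qed
        show "\<bar>\<Sum>a\<in>UNIV. v $ a * partial_deriv a \<phi> v\<bar> \<le> 4 * real N" for v
          unfolding \<phi>_def[abs_def] by (rule radial_cossq_power_bound)
      qed
      then show ?thesis
        unfolding L\<phi> by (simp add: f_def fs_laplacian_hchart[OF h] \<phi>_def algebra_simps)
    qed
    then show ?thesis using fs_integral[OF chart_cont_measurable[OF cf] Bf] by simp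
  qed
  moreover have "(\<integral>z. f z \<partial>fs_volume) = (\<integral>z. fs_laplacian h z * cossq y z ^ N \<partial>fs_volume)
     - (c1 * (\<integral>z. h z * cossq y z ^ (N - 1) \<partial>fs_volume) - c2 * (\<integral>z. h z * cossq y z ^ N \<partial>fs_volume))"
    unfolding f_def
    by (subst Bochner_Integration.integral_diff, (intro chart_cont_integrable chart_cont_diff chart_cont_mult chart_cont_const ch cl chart_cont_cossq_power)+,
        subst Bochner_Integration.integral_diff, (intro chart_cont_integrable chart_cont_diff chart_cont_mult chart_cont_const ch cl chart_cont_cossq_power)+) simp
  ultimately show ?thesis by (simp add: c1_def c2_def)
qed

text \<open>
  Green's identity with the constant function \<open>1\<close> is a recurrence in \<open>N\<close>; the case \<open>N = 0\<close> is the total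
  volume.
\<close>

lemma integral_cossq_power: "(\<integral>z. cossq y z ^ N \<partial>fs_volume) = power_mass CARD('n) N"
  for y :: "'n::finite hproj"
proof (induction N)
  case 0
  have "(\<integral>z. 1 \<partial>(fs_volume :: 'n hproj measure)) = power_mass CARD('n) 0" unfolding fs_volume_total power_mass_def by simp
  then show ?case by simp
next
  case (Suc N)
  have c: "C2 (\<lambda>v. (\<lambda>_ :: 'n hproj. 1 :: real) (hchart j v))" for j by (rule ratf_C2[OF ratf_const])
  have p0: "partial_deriv a (\<lambda>_. k) = (\<lambda>_ :: real ^ ('n \<times> 4). 0)" for a and k :: real
    using partial_deriv_eq[OF has_derivative_const] by blast
  have "fs_laplacian (\<lambda>_. 1) z = 0" for z :: "'n hproj"
  proof -
    obtain j v where "z = hchart j v" by (rule hproj_chart_cover)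
    then show ?thesis using fs_laplacian_hchart[OF c, of j v] by (simp add: chart_lap_def p0)
  qed
  then have "eigval CARD('n) (Suc N) * (\<integral>z. cossq y z ^ Suc N \<partial>fs_volume) = 4 * real (Suc N) * (real (Suc N) + 1) * (\<integral>z. cossq y z ^ N \<partial>fs_volume)"
    using green_cossq_power[OF c, of y "Suc N"] by simp
  also have "\<dots> = eigval CARD('n) (Suc N) * power_mass CARD('n) (Suc N)"
    unfolding Suc.IH power_mass_rec by simp
  finally show ?case by (simp add: eigval_def add_nonneg_eq_0_iff)
qed

text \<open>
  The case of equality in the Cauchy-Schwarz inequality: the vector \<open>X\<close> is equal to its projection
  \<open>hscale Y (hinner Y X)\<close>.
\<close>

lemma cossq_eq_1D: "cossq y z = 1 \<Longrightarrow> z = y"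
  for y z :: "'n::finite hproj"
proof -
  assume u: "cossq y z = 1"
  obtain Y :: "quat ^ 'n option" where Y: "abs_hproj Y = y" "norm Y = 1" using hproj_rep by metis
  obtain X :: "quat ^ 'n option" where X: "X \<noteq> 0" "abs_hproj X = z" using hproj_rep by metis
  define A where "A = hinner Y X"
  have "cossq_rep Y X = 1" using u cossq_abs[OF X(1) Y(2)] X Y by simp
  then have nA: "(norm A)\<^sup>2 = (norm X)\<^sup>2" using X(1) by (simp add: cossq_rep_def A_def)
  have dot: "(\<Sum>i\<in>UNIV. qdot (X $ i) (hscale Y A $ i)) = (norm A)\<^sup>2"
  proof -
    note z = qRe_eq_qc[symmetric]
    have "(\<Sum>i\<in>UNIV. qdot (X $ i) (hscale Y A $ i)) = (\<Sum>i\<in>UNIV. qc 0 (qcnj (X $ i) * (Y $ i * A)))"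
      unfolding z qRe_cnj_mult qdot_def by simp
    also have "\<dots> = qc 0 (hinner X Y * A)" unfolding hinner_def sum_distrib_right qc_sum by (simp add: mult.assoc)
    also have "hinner X Y = qcnj A" by (simp add: A_def qcnj_hinner)
    also have "qc 0 (qcnj A * A) = (norm A)\<^sup>2" unfolding norm_quat_sq_qc by (simp add: z qRe_cnj_mult power2_eq_square)
    finally show ?thesis .
  qed
  have "(norm (X + (- 1) *\<^sub>R hscale Y A))\<^sup>2 = 0"
    unfolding norm_add_sq_vec dot norm_hscale Y(2) using nA by simp
  then have XY: "X = hscale Y A" by simp
  then have "A \<noteq> 0" using X(1) by (auto simp: hscale_eq_zero)
  then show "z = y" using XY X Y abs_hproj_hscale[of A Y] by simp
qed

text \<open>
  Where \<open>h\<close> differs from \<open>h y\<close> by at least \<open>e / 2\<close>, the squared cosine is at most some \<open>\<delta> < 1\<close> by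
  compactness. This part contributes at most a multiple of \<open>\<delta>\<^sup>N\<close>, while the total mass
  decreases only like a power of \<open>N\<close>.
\<close>

lemma cossq_power_concentration:
  fixes h :: "'n::finite hproj \<Rightarrow> real"
  assumes h: "chart_cont h"
  shows "(\<lambda>N. (\<integral>z. h z * cossq y z ^ N \<partial>fs_volume) / power_mass CARD('n) N) \<longlonglongrightarrow> h y"
proof -
  define W where "W = power_mass CARD('n)"
  have W: "W N > 0" for N by (simp add: W_def power_mass_def)
  obtain B where B: "B \<ge> 0" "\<And>z. \<bar>h z\<bar> \<le> B" using chart_cont_bounded[OF h] by blast
  have c0: "chart_cont (\<lambda>z. cossq y z)" using chart_cont_cossq_power[of y 1] by simp
  show ?thesis unfolding W_def[symmetric]
  proof (rule LIMSEQ_I)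
    fix e :: real assume e: "e > 0"
    have "\<exists>\<delta><1. 0 \<le> \<delta> \<and> (\<forall>v\<in>cball 0 (sqrt (real CARD('n))). e / 2 \<le> \<bar>h (hchart j v) - h y\<bar> \<longrightarrow> cossq y (hchart j v) \<le> \<delta>)" for j
    proof -
      define S where "S = cball 0 (sqrt (real CARD('n))) \<inter> {v. e / 2 \<le> \<bar>h (hchart j v) - h y\<bar>}"
      have ch: "continuous_on UNIV (\<lambda>v. h (hchart j v))" using h by (simp add: chart_cont_def)
      have cu: "continuous_on UNIV (\<lambda>v. cossq y (hchart j v))" using c0 by (simp add: chart_cont_def)
      have "closed {v. e / 2 \<le> \<bar>h (hchart j v) - h y\<bar>}" by (intro closed_Collect_le continuous_intros ch)
      then have cS: "compact S" unfolding S_def by (intro compact_Int_closed compact_cball)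
      show ?thesis
      proof (cases "S = {}")
        case True
        then show ?thesis unfolding S_def by (intro exI[of _ 0]) auto
      next
        case False
        obtain w where w: "w \<in> S" "\<And>v. v \<in> S \<Longrightarrow> cossq y (hchart j v) \<le> cossq y (hchart j w)"
          using continuous_attains_sup[OF cS False continuous_on_subset[OF cu]] by auto
        have "cossq y (hchart j w) \<noteq> 1"
        proof
          assume "cossq y (hchart j w) = 1"
          then have "hchart j w = y" by (rule cossq_eq_1D)
          then show False using w(1) e by (simp add: S_def)
        qed
        then have "cossq y (hchart j w) < 1" using cossq_bounds(2)[of y "hchart j w"] by simp
        then show ?thesis using w(2) cossq_bounds(1) unfolding S_def by (intro exI[of _ "cossq y (hchart j w)"]) auto
      qed
    qed
    then obtain \<delta>0 where \<delta>0: "\<And>j. \<delta>0 j < 1" "\<And>j. 0 \<le> \<delta>0 j"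
      "\<And>j v. v \<in> cball 0 (sqrt (real CARD('n))) \<Longrightarrow> e / 2 \<le> \<bar>h (hchart j v) - h y\<bar> \<Longrightarrow> cossq y (hchart j v) \<le> \<delta>0 j"
      by metis
    define \<delta> where "\<delta> = Max (range \<delta>0)"
    have "\<delta> \<in> range \<delta>0" unfolding \<delta>_def by (rule Max_in) auto
    then have \<delta>: "0 \<le> \<delta>" "\<delta> < 1" using \<delta>0 by auto
    have \<delta>j: "\<delta>0 j \<le> \<delta>" for j unfolding \<delta>_def by (rule Max_ge) auto
    have far: "cossq y z \<le> \<delta>" if "e / 2 \<le> \<bar>h z - h y\<bar>" for z
    proof -
      obtain j v where z: "z = hchart j v" "norm v \<le> sqrt (real CARD('n))" by (rule hproj_chart_cover)
      then show ?thesis using \<delta>0(3)[of v j] that order_trans[OF _ \<delta>j[of j]] by simp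
    qed
    have pt: "\<bar>(h z - h y) * cossq y z ^ N\<bar> \<le> e / 2 * cossq y z ^ N + 2 * B * \<delta> ^ N" for z N
    proof (cases "e / 2 \<le> \<bar>h z - h y\<bar>")
      case True
      have "cossq y z ^ N \<le> \<delta> ^ N" using far[OF True] cossq_bounds by (intro power_mono) auto
      moreover have "\<bar>h z - h y\<bar> \<le> 2 * B" using B(2)[of z] B(2)[of y] by linarith
      ultimately have "\<bar>h z - h y\<bar> * cossq y z ^ N \<le> 2 * B * \<delta> ^ N" using cossq_bounds[of y z] B(1) by (intro mult_mono) auto
      moreover have "0 \<le> e / 2 * cossq y z ^ N" using e cossq_bounds[of y z] by simp
      ultimately show ?thesis using cossq_bounds[of y z] by (simp add: abs_mult)
    next
      case False
      then have "\<bar>h z - h y\<bar> * cossq y z ^ N \<le> e / 2 * cossq y z ^ N" using cossq_bounds[of y z] by (intro mult_right_mono) auto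
      moreover have "0 \<le> 2 * B * \<delta> ^ N" using B \<delta> by simp
      ultimately show ?thesis using cossq_bounds[of y z] by (simp add: abs_mult)
    qed
    have est: "\<bar>(\<integral>z. h z * cossq y z ^ N \<partial>fs_volume) / W N - h y\<bar> \<le> e / 2 + 2 * B * W 0 * (\<delta> ^ N / W N)" for N
    proof -
      have i1: "integrable fs_volume (\<lambda>z. h z * cossq y z ^ N)" by (intro chart_cont_integrable chart_cont_mult h chart_cont_cossq_power)
      have i2: "integrable fs_volume (\<lambda>z. cossq y z ^ N)" by (intro chart_cont_integrable chart_cont_cossq_power)
      have i3: "integrable fs_volume (\<lambda>z :: 'n hproj. 1 :: real)" by (intro chart_cont_integrable chart_cont_const)
      have I2: "(\<integral>z. cossq y z ^ N \<partial>fs_volume) = W N" unfolding W_def by (rule integral_cossq_power)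
      have I3: "(\<integral>z. 1 \<partial>(fs_volume :: 'n hproj measure)) = W 0" using integral_cossq_power[of y 0] by (simp add: W_def)
      have "(\<integral>z. (h z - h y) * cossq y z ^ N \<partial>fs_volume) = (\<integral>z. h z * cossq y z ^ N - h y * cossq y z ^ N \<partial>fs_volume)"
        by (simp add: left_diff_distrib)
      also have "\<dots> = (\<integral>z. h z * cossq y z ^ N \<partial>fs_volume) - h y * W N"
        using i1 i2 by (simp add: I2)
      finally have d: "(\<integral>z. h z * cossq y z ^ N \<partial>fs_volume) - h y * W N = (\<integral>z. (h z - h y) * cossq y z ^ N \<partial>fs_volume)" ..
      have i4: "integrable fs_volume (\<lambda>z. (h z - h y) * cossq y z ^ N)"
        by (intro chart_cont_integrable chart_cont_mult chart_cont_diff chart_cont_const h chart_cont_cossq_power)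
      have "\<bar>\<integral>z. (h z - h y) * cossq y z ^ N \<partial>fs_volume\<bar> \<le> (\<integral>z. \<bar>(h z - h y) * cossq y z ^ N\<bar> \<partial>fs_volume)"
        by (rule integral_abs_bound)
      also have "\<dots> \<le> (\<integral>z. e / 2 * cossq y z ^ N + 2 * B * \<delta> ^ N * 1 \<partial>fs_volume)"
        by (intro integral_mono integrable_abs i4 Bochner_Integration.integrable_add integrable_mult_right i2 i3) (use pt in simp)
      also have "\<dots> = e / 2 * W N + 2 * B * \<delta> ^ N * W 0"
        by (subst Bochner_Integration.integral_add, intro integrable_mult_right i2, intro integrable_mult_right i3) (simp only: integral_mult_right_zero I2 I3)
      finally have "\<bar>(\<integral>z. h z * cossq y z ^ N \<partial>fs_volume) - h y * W N\<bar> \<le> e / 2 * W N + 2 * B * \<delta> ^ N * W 0" unfolding d .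
      then have "\<bar>(\<integral>z. h z * cossq y z ^ N \<partial>fs_volume) - h y * W N\<bar> / W N \<le> (e / 2 * W N + 2 * B * \<delta> ^ N * W 0) / W N"
        using W[of N] by (intro divide_right_mono) auto
      also have "(e / 2 * W N + 2 * B * \<delta> ^ N * W 0) / W N = e / 2 + 2 * B * W 0 * (\<delta> ^ N / W N)"
        using W[of N] by (simp add: field_simps)
      also have "\<bar>(\<integral>z. h z * cossq y z ^ N \<partial>fs_volume) - h y * W N\<bar> / W N = \<bar>(\<integral>z. h z * cossq y z ^ N \<partial>fs_volume) / W N - h y\<bar>"
      proof -
        have "(\<integral>z. h z * cossq y z ^ N \<partial>fs_volume) / W N - h y = ((\<integral>z. h z * cossq y z ^ N \<partial>fs_volume) - h y * W N) / W N"
          using W[of N] by (simp add: field_simps)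
        then show ?thesis using W[of N] by (simp add: abs_divide)
      qed
      finally show ?thesis .
    qed
    have Wlow: "\<delta> ^ N / W N \<le> \<delta> ^ N * (real N + 2 * real CARD('n) + 1) ^ (2 * CARD('n)) / pi ^ (2 * CARD('n))" for N
    proof -
      have "fact (N + 2 * CARD('n) + 1) \<le> fact (N + 1) * (real N + 2 * real CARD('n) + 1) ^ (2 * CARD('n))"
      proof -
        have "fact (N + 1 + k) \<le> fact (N + 1) * (real N + real k + 1) ^ k" for k
        proof -
          have "(fact (N + 1 + k) :: real) = fact (N + 1) * pochhammer (1 + real (N + 1)) k"
            using pochhammer_product'[of "1::real" "N + 1" k] by (simp only: pochhammer_fact of_nat_1)
          also have "pochhammer (1 + real (N + 1)) k = (\<Prod>i = 0..<k. 1 + real (N + 1) + real i)" by (rule pochhammer_prod)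
          also have "\<dots> \<le> (\<Prod>i = 0..<k. real N + real k + 1)" by (intro prod_mono) auto
          finally show ?thesis by simp
        qed
        from this[of "2 * CARD('n)"] show ?thesis by (simp add: add_ac)
      qed
      then have "1 / W N \<le> (real N + 2 * real CARD('n) + 1) ^ (2 * CARD('n)) / pi ^ (2 * CARD('n))"
        unfolding W_def power_mass_def by (simp add: divide_simps mult.commute del: fact_Suc)
      from mult_left_mono[OF this, of "\<delta> ^ N"] \<delta> show ?thesis by simp
    qed
    have "(\<lambda>N. \<delta> ^ N / W N) \<longlonglongrightarrow> 0"
    proof (rule tendsto_sandwich)
      show "eventually (\<lambda>N. 0 \<le> \<delta> ^ N / W N) sequentially" using \<delta> W by (simp add: less_imp_le)
      show "eventually (\<lambda>N. \<delta> ^ N / W N \<le> \<delta> ^ N * (real N + 2 * real CARD('n) + 1) ^ (2 * CARD('n)) / pi ^ (2 * CARD('n))) sequentially"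
        using Wlow by simp
      show "(\<lambda>N. \<delta> ^ N * (real N + 2 * real CARD('n) + 1) ^ (2 * CARD('n)) / pi ^ (2 * CARD('n))) \<longlonglongrightarrow> 0"
      proof (cases "\<delta> = 0")
        case True
        have "eventually (\<lambda>N. \<delta> ^ N * (real N + 2 * real CARD('n) + 1) ^ (2 * CARD('n)) / pi ^ (2 * CARD('n)) = 0) sequentially"
          using eventually_gt_at_top[of 0] by eventually_elim (simp add: True)
        then show ?thesis by (rule tendsto_eventually)
      next
        case False
        then have "\<delta> > 0" using \<delta> by simp
        have "(\<lambda>N. \<delta> ^ N * (real N + 2 * real k + 1) ^ m / P) \<longlonglongrightarrow> 0" if "P > 0" for P :: real and k m :: nat
          using \<open>\<delta> > 0\<close> \<delta>(2) that by real_asymp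
        note lim0 = this
        show ?thesis by (rule lim0) (rule zero_less_power[OF pi_gt_zero])
      qed
    qed simp
    then have "(\<lambda>N. 2 * B * W 0 * (\<delta> ^ N / W N)) \<longlonglongrightarrow> 2 * B * W 0 * 0" by (intro tendsto_intros)
    then have "eventually (\<lambda>N. 2 * B * W 0 * (\<delta> ^ N / W N) < e / 2) sequentially"
      using e by (intro order_tendstoD) auto
    then obtain N0 where N0: "\<And>N. N \<ge> N0 \<Longrightarrow> 2 * B * W 0 * (\<delta> ^ N / W N) < e / 2" by (auto simp: eventually_sequentially)
    then show "\<exists>no. \<forall>N\<ge>no. norm ((\<integral>z. h z * cossq y z ^ N \<partial>fs_volume) / W N - h y) < e"
    proof (intro exI[of _ N0] allI impI)
      fix N assume "N \<ge> N0"
      then have "2 * B * W 0 * (\<delta> ^ N / W N) < e / 2" by (rule N0)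
      then show "norm ((\<integral>z. h z * cossq y z ^ N \<partial>fs_volume) / W N - h y) < e"
        using est[of N] unfolding real_norm_def by linarith
    qed
  qed
qed

section \<open>The moments of the heat kernel\<close>

lemma smooth_on_slice_deriv:
  fixes F :: "real \<times> (real ^ 'm::finite) \<Rightarrow> real"
  assumes "F differentiable at (t, v)"
  shows "(\<lambda>v. F (t, v)) differentiable at v"
    and "partial_deriv a (\<lambda>v. F (t, v)) v = frechet_derivative F (at (t, v)) (0, axis a 1)"
    and "((\<lambda>s. F (s, v)) has_real_derivative frechet_derivative F (at (t, v)) (1, 0)) (at t)"
proof -
  define D where "D = frechet_derivative F (at (t, v))"
  have D: "(F has_derivative D) (at (t, v))" unfolding D_def using assms by (simp add: frechet_derivative_works)
  have 1: "((\<lambda>v. F (t, v)) has_derivative (\<lambda>h. D (0, h))) (at v)"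
    using has_derivative_compose[of "\<lambda>v. (t, v)" "\<lambda>h. (0, h)" v UNIV F D] D
      has_derivative_Pair[OF has_derivative_const[of t "at v"] has_derivative_ident] by simp
  show "(\<lambda>v. F (t, v)) differentiable at v" by (rule differentiableI[OF 1])
  show "partial_deriv a (\<lambda>v. F (t, v)) v = frechet_derivative F (at (t, v)) (0, axis a 1)"
    using partial_deriv_eq[OF 1, of a] unfolding D_def .
  have 2: "((\<lambda>s. F (s, v)) has_derivative (\<lambda>h. D (h, 0))) (at t)"
    using has_derivative_compose[of "\<lambda>s. (s, v)" "\<lambda>h. (h, 0)" t UNIV F D] D
      has_derivative_Pair[OF has_derivative_ident has_derivative_const[of v "at t"]] by simp
  have "(\<lambda>h. D (h, 0)) = (*) (D (1, 0))"
  proof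
    fix h :: real
    have "D (h *\<^sub>R (1, 0)) = h *\<^sub>R D (1, 0)" by (rule linear_scale[OF has_derivative_linear[OF D]])
    then show "D (h, 0) = D (1, 0) * h" by (simp add: mult.commute)
  qed
  then show "((\<lambda>s. F (s, v)) has_real_derivative frechet_derivative F (at (t, v)) (1, 0)) (at t)"
    using 2 unfolding has_field_derivative_def D_def by metis
qed

lemma smooth_on_slices:
  fixes F :: "real \<times> (real ^ 'm::finite) \<Rightarrow> real"
  assumes F: "smooth_on ({0<..} \<times> UNIV) F"
  shows "t > 0 \<Longrightarrow> C2 (\<lambda>v. F (t, v))"
    and "continuous_on ({0<..} \<times> UNIV) (\<lambda>p. frechet_derivative F (at p) (1, 0))"
    and "t > 0 \<Longrightarrow> ((\<lambda>s. F (s, v)) has_real_derivative frechet_derivative F (at (t, v)) (1, 0)) (at t)"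
proof -
  let ?S = "{0<..} \<times> (UNIV :: (real ^ 'm) set)"
  have d1: "F differentiable at p" if "p \<in> ?S" for p
    using spec[OF F[unfolded smooth_on_def], of "Suc 0"] that unfolding Ck_on.simps by blast
  have sm1: "Ck_on k ?S (\<lambda>p. frechet_derivative F (at p) b)" if "b \<in> Basis" for k b
    using spec[OF F[unfolded smooth_on_def], of "Suc k"] that unfolding Ck_on.simps by blast
  have ax: "(0, axis a 1) \<in> (Basis :: (real \<times> (real ^ 'm)) set)" "(1, 0) \<in> (Basis :: (real \<times> (real ^ 'm)) set)" for a
    by (auto simp: Basis_prod_def Basis_vec_def)
  define G where "G a p = frechet_derivative F (at p) (0, axis a 1)" for a p
  have G: "Ck_on k ?S (G a)" for k a unfolding G_def[abs_def] by (rule sm1[OF ax(1)])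
  have dG: "G a differentiable at p" if "p \<in> ?S" for a p
    using G[of "Suc 0" a] that unfolding Ck_on.simps by blast
  define K where "K a b p = frechet_derivative (G b) (at p) (0, axis a 1)" for a b p
  have cK: "continuous_on ?S (K a b)" for a b
    using G[of "Suc 0" b] ax(1)[of a] unfolding K_def[abs_def] by simp
  show "continuous_on ?S (\<lambda>p. frechet_derivative F (at p) (1, 0))"
    using sm1[OF ax(2), of 0] by simp
  show "((\<lambda>s. F (s, v)) has_real_derivative frechet_derivative F (at (t, v)) (1, 0)) (at t)" if "t > 0"
    by (rule smooth_on_slice_deriv(3)[OF d1]) (use that in simp)
  show "C2 (\<lambda>v. F (t, v))" if t: "t > 0"
  proof -
    have tS: "(t, v) \<in> ?S" for v using t by simp
    have p1: "partial_deriv a (\<lambda>v. F (t, v)) = (\<lambda>v. G a (t, v))" for a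
      using smooth_on_slice_deriv(2)[OF d1[OF tS]] unfolding G_def by blast
    have p2: "partial_deriv a (\<lambda>v. G b (t, v)) = (\<lambda>v. K a b (t, v))" for a b
      using smooth_on_slice_deriv(2)[OF dG[OF tS]] unfolding K_def by blast
    have "continuous_on UNIV (\<lambda>v. K a b (t, v))" for a b
      by (rule continuous_on_compose2[OF cK]) (use t in \<open>auto intro!: continuous_intros\<close>)
    then show ?thesis unfolding C2_def p1 p2
      using smooth_on_slice_deriv(1)[OF d1[OF tS]] smooth_on_slice_deriv(1)[OF dG[OF tS]] by blast
  qed
qed

lemma heat_kernel_C2: "is_heat_kernel H \<Longrightarrow> t > 0 \<Longrightarrow> C2 (\<lambda>v. H t x (hchart j v))"
  using smooth_on_slices(1)[of "\<lambda>(t, v). H t x (hchart j v)" t] unfolding is_heat_kernel_def by auto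

text \<open>
  The Laplacian of the kernel is its time derivative, which is jointly continuous in time and affine
  coordinates. The bound is the majorant for differentiating the moments under the integral sign.
\<close>

lemma heat_kernel_laplacian_bounded:
  fixes H :: "real \<Rightarrow> 'n::finite hproj \<Rightarrow> 'n hproj \<Rightarrow> real"
  assumes H: "is_heat_kernel H" and ab: "0 < a"
  obtains B where "\<And>s z. a \<le> s \<Longrightarrow> s \<le> b \<Longrightarrow> \<bar>fs_laplacian (H s x) z\<bar> \<le> B"
proof -
  define F where "F j p = (case p of (t, v) \<Rightarrow> H t x (hchart j v))" for j p
  define G where "G j p = frechet_derivative (F j) (at p) (1, 0)" for j p
  have smF: "smooth_on ({0<..} \<times> UNIV) (F j)" for j
    using H unfolding is_heat_kernel_def F_def[abs_def] by blast
  have G: "fs_laplacian (H s x) (hchart j v) = G j (s, v)" if "s > 0" for s j v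
  proof (rule DERIV_unique)
    show "((\<lambda>s. H s x (hchart j v)) has_real_derivative fs_laplacian (H s x) (hchart j v)) (at s)"
      using H that unfolding is_heat_kernel_def by blast
    show "((\<lambda>s. H s x (hchart j v)) has_real_derivative G j (s, v)) (at s)"
      using smooth_on_slices(3)[OF smF that, of j v] unfolding G_def by (simp add: F_def)
  qed
  define K where "K = {a..b} \<times> cball (0 :: real ^ ('n \<times> 4)) (sqrt (real CARD('n)))"
  have "\<exists>B. \<forall>p\<in>K. \<bar>G j p\<bar> \<le> B" for j
  proof -
    have "continuous_on K (G j)"
      unfolding G_def[abs_def] by (rule continuous_on_subset[OF smooth_on_slices(2)[OF smF]]) (use ab in \<open>auto simp: K_def\<close>)
    moreover have "compact K" unfolding K_def by (intro compact_Times compact_Icc compact_cball)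
    ultimately have "bounded (G j ` K)" by (intro compact_imp_bounded compact_continuous_image)
    then show ?thesis unfolding bounded_iff by auto
  qed
  then obtain B where B: "\<And>j p. p \<in> K \<Longrightarrow> \<bar>G j p\<bar> \<le> B j" by metis
  show ?thesis
  proof (rule that)
    fix s :: real and z :: "'n hproj" assume s: "a \<le> s" "s \<le> b"
    obtain j v where z: "z = hchart j v" "norm v \<le> sqrt (real CARD('n))" by (rule hproj_chart_cover)
    have "\<bar>fs_laplacian (H s x) z\<bar> \<le> B j"
      using B[of "(s, v)" j] s ab z by (simp add: G K_def)
    also have "\<dots> \<le> (\<Sum>j\<in>UNIV. \<bar>B j\<bar>)"
      using member_le_sum[of j UNIV "\<lambda>j. \<bar>B j\<bar>"] by simp
    finally show "\<bar>fs_laplacian (H s x) z\<bar> \<le> (\<Sum>j\<in>UNIV. \<bar>B j\<bar>)" .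
  qed
qed

lemma heat_kernel_moment_deriv:
  fixes H :: "real \<Rightarrow> 'n::finite hproj \<Rightarrow> 'n hproj \<Rightarrow> real"
  assumes H: "is_heat_kernel H" and t: "t > 0" and g: "chart_cont g"
  shows "((\<lambda>s. \<integral>z. H s x z * g z \<partial>fs_volume) has_real_derivative
     (\<integral>z. fs_laplacian (H t x) z * g z \<partial>fs_volume)) (at t)"
proof -
  obtain B where B: "\<And>s z. t / 2 \<le> s \<Longrightarrow> s \<le> 3 * t / 2 \<Longrightarrow> \<bar>fs_laplacian (H s x) z\<bar> \<le> B"
    using heat_kernel_laplacian_bounded[OF H, of "t / 2" "3 * t / 2" x] t by auto
  obtain C where C: "C \<ge> 0" "\<And>z. \<bar>g z\<bar> \<le> C" using chart_cont_bounded[OF g] by blast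
  have B0: "B \<ge> 0" using abs_ge_zero order_trans[OF _ B[of t undefined]] t by fastforce
  have cH: "chart_cont (H s x)" if "s > 0" for s
    unfolding chart_cont_def using C2_continuous(1)[OF heat_kernel_C2[OF H that]] by blast
  have cL: "chart_cont (fs_laplacian (H t x))"
    by (rule chart_cont_laplacian[OF heat_kernel_C2[OF H t]])
  have dH: "((\<lambda>s. H s x z) has_real_derivative fs_laplacian (H s x) z) (at s)" if "s > 0" for s z
    using H that unfolding is_heat_kernel_def by blast
  have int: "integrable fs_volume (\<lambda>z. H s x z * g z)" if "s > 0" for s
    by (rule chart_cont_integrable[OF chart_cont_mult[OF cH[OF that] g]])
  have meas: "f \<in> borel_measurable fs_volume" if "chart_cont f" for f :: "'n hproj \<Rightarrow> real"
    using chart_cont_measurable[OF that] by (simp add: fs_volume_def)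
  define Q where "Q s = ((\<integral>z. H s x z * g z \<partial>fs_volume) - (\<integral>z. H t x z * g z \<partial>fs_volume)) / (s - t)" for s
  have "(Q \<longlongrightarrow> (\<integral>z. fs_laplacian (H t x) z * g z \<partial>fs_volume)) (at t)"
    unfolding tendsto_at_iff_sequentially
  proof (intro allI impI)
    fix X :: "nat \<Rightarrow> real" assume X: "\<forall>i. X i \<in> UNIV - {t}" and lim: "X \<longlonglongrightarrow> t"
    obtain N0 where N0: "\<And>N. N \<ge> N0 \<Longrightarrow> \<bar>X N - t\<bar> < t / 2"
      using LIMSEQ_D[OF lim, of "t / 2"] t by auto
    \<comment> \<open>All terms of this sequence lie in the interval on which \<open>B\<close> is a bound.\<close>
    define Y where "Y i = X (i + N0)" for i
    have Y1: "\<bar>Y i - t\<bar> < t / 2" for i unfolding Y_def by (rule N0) simp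
    have Y3: "Y i > 0" for i using Y1[of i] t by linarith
    have Y2: "Y i \<noteq> t" for i using X unfolding Y_def by blast
    have limY: "Y \<longlonglongrightarrow> t" unfolding Y_def using lim by (rule LIMSEQ_ignore_initial_segment)
    define q where "q i z = (H (Y i) x z - H t x z) / (Y i - t) * g z" for i z
    have "(\<lambda>i. \<integral>z. q i z \<partial>fs_volume) \<longlonglongrightarrow> (\<integral>z. fs_laplacian (H t x) z * g z \<partial>fs_volume)"
    proof (rule integral_dominated_convergence)
      show "(\<lambda>z. fs_laplacian (H t x) z * g z) \<in> borel_measurable fs_volume"
        by (rule meas[OF chart_cont_mult[OF cL g]])
      show "q i \<in> borel_measurable fs_volume" for i
        unfolding q_def[abs_def] using meas[OF cH[OF Y3]] meas[OF cH[OF t]] meas[OF g] by measurable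
      show "integrable fs_volume (\<lambda>z. B * C)" by (rule chart_cont_integrable[OF chart_cont_const])
      show "AE z in fs_volume. (\<lambda>i. q i z) \<longlonglongrightarrow> fs_laplacian (H t x) z * g z"
      proof (rule AE_I2)
        fix z
        have "((\<lambda>s. (H s x z - H t x z) / (s - t)) \<longlongrightarrow> fs_laplacian (H t x) z) (at t)"
          using dH[OF t, of z] by (simp add: has_field_derivative_iff)
        then have "(\<lambda>i. (H (Y i) x z - H t x z) / (Y i - t)) \<longlonglongrightarrow> fs_laplacian (H t x) z"
          unfolding tendsto_at_iff_sequentially comp_def using Y2 limY by blast
        then show "(\<lambda>i. q i z) \<longlonglongrightarrow> fs_laplacian (H t x) z * g z" unfolding q_def by (intro tendsto_intros)
      qed
      show "AE z in fs_volume. norm (q i z) \<le> B * C" for i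
      proof (rule AE_I2)
        fix z
        have "norm (H (Y i) x z - H t x z) \<le> B * norm (Y i - t)"
        proof (rule field_differentiable_bound[where S = "{t / 2..3 * t / 2}"])
          show "convex {t / 2..3 * t / 2}" by (rule convex_real_interval)
          show "((\<lambda>s. H s x z) has_field_derivative fs_laplacian (H s x) z) (at s within {t / 2..3 * t / 2})"
            if "s \<in> {t / 2..3 * t / 2}" for s
          proof -
            have "s > 0" using that t by simp
            then show ?thesis by (rule has_field_derivative_at_within[OF dH])
          qed
          show "norm (fs_laplacian (H s x) z) \<le> B" if "s \<in> {t / 2..3 * t / 2}" for s
            using that B[of s z] by simp
          have "t / 2 \<le> Y i" "Y i \<le> 3 * t / 2" using Y1[of i] by linarith+
          then show "Y i \<in> {t / 2..3 * t / 2}" by simp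
          show "t \<in> {t / 2..3 * t / 2}" using t by simp
        qed
        then have "\<bar>H (Y i) x z - H t x z\<bar> \<le> B * \<bar>Y i - t\<bar>" unfolding real_norm_def .
        then have "\<bar>(H (Y i) x z - H t x z) / (Y i - t)\<bar> \<le> B"
          using Y2[of i] by (simp add: abs_divide divide_le_eq)
        then show "norm (q i z) \<le> B * C"
          unfolding q_def real_norm_def abs_mult using C(2)[of z] B0 by (intro mult_mono) auto
      qed
    qed
    moreover have "(\<integral>z. q i z \<partial>fs_volume) = Q (Y i)" for i
    proof -
      have "(\<integral>z. q i z \<partial>fs_volume) = (\<integral>z. (H (Y i) x z * g z - H t x z * g z) / (Y i - t) \<partial>fs_volume)"
        by (simp add: q_def left_diff_distrib)
      also have "\<dots> = (\<integral>z. H (Y i) x z * g z - H t x z * g z \<partial>fs_volume) / (Y i - t)"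
        by (rule integral_divide_zero)
      also have "\<dots> = Q (Y i)"
        unfolding Q_def Bochner_Integration.integral_diff[OF int[OF Y3] int[OF t]] ..
      finally show ?thesis .
    qed
    ultimately have "(\<lambda>i. Q (X (i + N0))) \<longlonglongrightarrow> (\<integral>z. fs_laplacian (H t x) z * g z \<partial>fs_volume)"
      by (simp add: Y_def)
    then show "(Q \<circ> X) \<longlonglongrightarrow> (\<integral>z. fs_laplacian (H t x) z * g z \<partial>fs_volume)"
      unfolding comp_def by (rule LIMSEQ_offset[where k = N0 and f = "\<lambda>i. Q (X i)"])
  qed
  then show ?thesis unfolding has_field_derivative_iff Q_def .
qed

text \<open>
  The moments divided by \<open>power_mass\<close> converge both to the kernel and to the series.
\<close>

theorem heat_kernel_series:
  fixes H :: "real \<Rightarrow> 'n::finite hproj \<Rightarrow> 'n hproj \<Rightarrow> real"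
  assumes H: "is_heat_kernel H" and t: "t > 0"
  defines "n \<equiv> CARD('n)"
  shows "H t x y = 1 / pi ^ (2 * n) * (\<Sum>l. zonal_weight n l * exp (- eigval n l * t) * zonal n l (cossq y x))"
proof -
  define m where "m N s = (\<integral>z. H s x z * cossq y z ^ N \<partial>fs_volume)" for N s
  have m: "m N t = zonal_moment n N (cossq y x) t" for N
  proof (rule moment_ode_unique[OF _ _ t])
    fix N :: nat and s :: real assume s: "s > 0"
    show "(m N has_real_derivative 4 * real N * (real N + 1) * m (N - 1) s - eigval n N * m N s) (at s)"
      using heat_kernel_moment_deriv[OF H s chart_cont_cossq_power[of y N], of x]
      unfolding green_cossq_power[of "H s x" y N, OF heat_kernel_C2[OF H s]] m_def[abs_def] n_def .
  next
    fix N :: nat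
    show "(m N \<longlongrightarrow> cossq y x ^ N) (at_right 0)"
      using H cossq_power_smooth[of y N] unfolding is_heat_kernel_def m_def[abs_def] by blast
  qed
  have "chart_cont (H t x)"
    unfolding chart_cont_def using C2_continuous(1)[OF heat_kernel_C2[OF H t]] by blast
  then have "(\<lambda>N. m N t / power_mass n N) \<longlonglongrightarrow> H t x y"
    unfolding m_def n_def by (rule cossq_power_concentration)
  moreover have "(\<lambda>N. m N t / power_mass n N) \<longlonglongrightarrow>
      1 / pi ^ (2 * n) * (\<Sum>l. zonal_weight n l * exp (- eigval n l * t) * zonal n l (cossq y x))"
    unfolding m by (rule zonal_moment_asymptotics(2)[OF t cossq_bounds])
  ultimately show ?thesis by (rule LIMSEQ_unique)
qed

section \<open>The two representations\<close>

theorem mainTheorem1: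
  fixes n :: nat
    and H :: "real \<Rightarrow> 'n::finite hproj \<Rightarrow> 'n hproj \<Rightarrow> real"
    and t d :: real
    and x y :: "'n hproj"
  assumes "n \<ge> 1" and "CARD('n) = n"
    and "is_heat_kernel H"
    and "t > 0"
    and "d = fs_dist x y"
  shows "(0 \<le> d \<and> d < pi / 2 \<longrightarrow>
      (\<lambda>u. sqrt ((cos d)\<^sup>2 - (cos u)\<^sup>2) / (cos d)\<^sup>2 * hp_Psi n t u) integrable_on {d..pi / 2} \<and>
      H t x y = exp ((2 * real n + 1)\<^sup>2 * t) / (2 ^ (2 * n - 2) * pi ^ (2 * n + 1)) *
        integral {d..pi / 2}
          (\<lambda>u. sqrt ((cos d)\<^sup>2 - (cos u)\<^sup>2) / (cos d)\<^sup>2 * hp_Psi n t u))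
    \<and>
      summable (\<lambda>l. real (2 * l + 2 * n + 1) * (fact (l + 2 * n) / fact (l + 1)) *
          exp (- 4 * real l * real (l + 2 * n + 1) * t) *
          jacobi_P l (2 * real n - 1) 1 (cos (2 * d))) \<and>
      H t x y = 1 / pi ^ (2 * n) *
        (\<Sum>l. real (2 * l + 2 * n + 1) * (fact (l + 2 * n) / fact (l + 1)) *
          exp (- 4 * real l * real (l + 2 * n + 1) * t) *
          jacobi_P l (2 * real n - 1) 1 (cos (2 * d)))"
proof -
  note t = \<open>t > 0\<close>
  define u where "u = (cos d)\<^sup>2"
  have u: "cossq y x = u" by (simp add: cossq_def u_def \<open>d = fs_dist x y\<close>)
  have u01: "0 \<le> u" "u \<le> 1" using cossq_bounds[of y x] by (simp_all add: u)
  define s where "s l = zonal_weight n l * exp (- eigval n l * t) * zonal n l u" for l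
  have ser: "real (2 * l + 2 * n + 1) * (fact (l + 2 * n) / fact (l + 1)) *
          exp (- 4 * real l * real (l + 2 * n + 1) * t) *
          jacobi_P l (2 * real n - 1) 1 (cos (2 * d)) = s l" for l
  proof -
    have "cos (2 * d) = 2 * u - 1" unfolding u_def by (simp add: cos_double_cos)
    moreover have "- 4 * real l * real (l + 2 * n + 1) * t = - eigval n l * t"
      by (simp add: eigval_def algebra_simps)
    ultimately show ?thesis unfolding s_def zonal_weight_def using jacobi_P_eq_zonal[OF \<open>n \<ge> 1\<close>] by simp
  qed
  have sum: "summable s" unfolding s_def by (rule zonal_moment_asymptotics(1)[OF t u01])
  have H: "H t x y = 1 / pi ^ (2 * n) * (\<Sum>l. s l)"
    using heat_kernel_series[OF \<open>is_heat_kernel H\<close> t, of x y] unfolding \<open>CARD('n) = n\<close> u s_def .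
  have int: "(\<lambda>u. sqrt ((cos d)\<^sup>2 - (cos u)\<^sup>2) / (cos d)\<^sup>2 * hp_Psi n t u) integrable_on {d..pi / 2} \<and>
      H t x y = exp ((2 * real n + 1)\<^sup>2 * t) / (2 ^ (2 * n - 2) * pi ^ (2 * n + 1)) *
        integral {d..pi / 2} (\<lambda>u. sqrt ((cos d)\<^sup>2 - (cos u)\<^sup>2) / (cos d)\<^sup>2 * hp_Psi n t u)"
    if d: "0 \<le> d" "d < pi / 2"
  proof -
    define E where "E = exp ((2 * real n + 1)\<^sup>2 * t)"
    define S where "S = (\<Sum>l. zonal_weight n l * gauss_wt n t l * zonal n l u)"
    have hi: "((\<lambda>u. sqrt ((cos d)\<^sup>2 - (cos u)\<^sup>2) / (cos d)\<^sup>2 * hp_Psi n t u) has_integral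
        2 ^ (2 * n) * (pi / 4) * S) {d..pi / 2}"
      using hp_Psi_integral[OF t d] unfolding S_def u_def .
    have gw: "zonal_weight n l * gauss_wt n t l * zonal n l u = s l * inverse E" for l
    proof -
      have "gauss_wt n t l = exp (- eigval n l * t) * inverse E"
        unfolding gauss_wt_def E_def exp_minus[symmetric] exp_add[symmetric]
        by (simp add: eigval_def power2_eq_square algebra_simps)
      then show ?thesis unfolding s_def by (simp only: mult_ac)
    qed
    have E: "E > 0" by (simp add: E_def)
    have "S = (\<Sum>l. s l) * inverse E" unfolding S_def gw by (rule suminf_mult2[OF sum, symmetric])
    then have "(\<Sum>l. s l) = E * S" using E by simp
    moreover have "(2 :: real) ^ (2 * n) = 4 * 2 ^ (2 * n - 2)"
    proof -
      \<comment> \<open>Without \<open>n \<ge> 1\<close> the difference in the exponent would be truncated.\<close>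
      have "2 * n = 2 + (2 * n - 2)" using \<open>n \<ge> 1\<close> by simp
      then show ?thesis using power_add[of "2 :: real" 2 "2 * n - 2"] by simp
    qed
    moreover have "1 / p * (E * S) = E / (Q * (p * pi)) * (4 * Q * (pi / 4) * S)" if "p > 0" "Q > 0" for p Q :: real
      using that by (simp add: field_simps)
    from this[of "pi ^ (2 * n)" "2 ^ (2 * n - 2)"]
    have "1 / pi ^ (2 * n) * (E * S) =
        E / (2 ^ (2 * n - 2) * pi ^ (2 * n + 1)) * (4 * 2 ^ (2 * n - 2) * (pi / 4) * S)"
      unfolding power_add power_one_right by (simp only: zero_less_power pi_gt_zero zero_less_numeral)
    ultimately have "H t x y = E / (2 ^ (2 * n - 2) * pi ^ (2 * n + 1)) * (2 ^ (2 * n) * (pi / 4) * S)"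
      unfolding H by (simp only:)
    then show ?thesis unfolding E_def[symmetric] integral_unique[OF hi] using has_integral_integrable[OF hi] by blast
  qed
  show ?thesis unfolding ser using int sum H by blast
qed

end
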